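(* Assume $\phi=\tanh$ in a full residual network (FRN), with mean-field quantities $p^{(l)},q^{(l)},\gamma^{(l)},\lambda^{(l)},e^{(l)},s^{(l)}$. Suppose $e^{(0)}<1$. (1) If $\sigma_w=0$, then $\lambda^{(l)}=\sigma_b^2$ and $\gamma^{(l)}=l(\sigma_v^2\,\mathrm W\phi(\sigma_b^2,\sigma_b^2)+\sigma_a^2)+\gamma^{(0)}=l(\sigma_v^2\,\mathrm V\phi(\sigma_b^2)+\sigma_a^2)+\gamma^{(0)}$. Thus $e^{(l)}\to1$ and $1-e^{(l)}=\Theta(l^{-1})$. As a result, $s^{(l)}=p^{(l)}(1-e^{(l)})=\Theta(1)$. (2) If $\sigma_w>0$, then $e^{(l)}$ converges to the unique fixed point $e^*\ne1$ determined by the equation $$e^*=\frac1{\sigma_v^2+\sigma_a^2}\Big[\sigma_v^2\,\frac2\pi\arcsin(e^* )+\sigma_a^2\Big].$$ Furthermore, $e^{(l)}$ converges to $e^*$ polynomially: $|e^{(l)}-e^*|$ is $\check\Theta(l^{-\delta^*})$, where $$\delta^*:=1-\frac2\pi\,\frac1{\sqrt{1-(e^* )^2}}\,\frac{\sigma_v^2}{\sigma_v^2+\sigma_a^2}\in\Big[1-\frac2\pi,\frac12\Big).$$ Since $e^*<1$, $s^{(l)}=\Theta(p^{(l)})=\Theta(l)$.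
   Context: Put $\mathrm V\phi(q)=\mathbb E[\phi(z)^2]$ for $z\sim\mathcal N(0,q)$, and $\mathrm W\phi(\rho,\nu)=\mathbb E[\phi(z)\phi(z')]$ for $(z,z')\sim\mathcal N\!\left(0,\begin{pmatrix}\rho&\nu\\ \nu&\rho\end{pmatrix}\right)$. An FRN of width $N$ has layers $x^{(l)}_i=\sum_jv^{(l)}_{ij}\phi(h^{(l)}_j)+x^{(l-1)}_i+a^{(l)}_i$, $h^{(l)}_i=\sum_jw^{(l)}_{ij}x^{(l-1)}_j+b^{(l)}_i$ with independent Gaussian parameters of mean $0$ and variances $\sigma_v^2/N$, $\sigma_a^2$, $\sigma_w^2/N$, $\sigma_b^2$ respectively for $v,a,w,b$. Take two inputs $x^{(0)},x^{(0)\prime}$ with the same normalized squared length $p^{(0)}=\|x^{(0)}\|^2/N=\|x^{(0)\prime}\|^2/N$, and let $\gamma^{(0)}=x^{(0)}\cdot x^{(0)\prime}/N$. The mean-field ($N\to\infty$) quantities $p^{(l)}=\langle (x^{(l)}_1)^2\rangle$, $q^{(l)}=\langle (h^{(l)}_1)^2\rangle$, $\gamma^{(l)}=\langle x^{(l)}_1x^{(l)\prime}_1\rangle$, $\lambda^{(l)}=\langle h^{(l)}_1h^{(l)\prime}_1\rangle$ satisfy, for $l\ge1$, $$q^{(l)}=\sigma_w^2p^{(l-1)}+\sigma_b^2,\quad p^{(l)}=\sigma_v^2\,\mathrm V\phi(q^{(l)})+\sigma_a^2+p^{(l-1)},$$ $$\lambda^{(l)}=\sigma_w^2\gamma^{(l-1)}+\sigma_b^2,\quad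 \gamma^{(l)}=\sigma_v^2\,\mathrm W\phi(q^{(l)},\lambda^{(l)})+\sigma_a^2+\gamma^{(l-1)}.$$ Further $e^{(l)}=\gamma^{(l)}/p^{(l)}$ and $s^{(l)}=p^{(l)}-\gamma^{(l)}=(1-e^{(l)})p^{(l)}$. Asymptotics are as $l\to\infty$. $f=\check\Theta(g)$ means that for every $\varepsilon>0$, $f(l)=O(g(l)l^{\varepsilon})$ and $f(l)=\Omega(g(l)l^{-\varepsilon})$.
   Formalization: Excluded where the claim fails: in (1), for e→1 and its rate, σ_a=0 with σ_vσ_b=0; in (2), σ_v=0; the solution -1 if σ_a=0; e(0)=-1 if σ_a=σ_b=0 (convergence and rate); and, for the lower half of the rate, at most one γ(0) for given σ's and p(0). *)

theory Defs
  imports "HOL-Probability.Probability" "HOL-Library.Landau_Symbols"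
begin

text \<open>
  The centred Gaussian laws are linear images of independent standard normal variables, so that
  degenerate covariances are included: \<open>gauss1 0\<close> and \<open>gauss2 0 0\<close> are point masses at the origin,
  and \<open>gauss2 \<rho> \<rho>\<close> lives on the diagonal. \<open>gauss1 q\<close> is meaningful for \<open>q \<ge> 0\<close> and
  \<open>gauss2 \<rho> \<nu>\<close> for \<open>\<bar>\<nu>\<bar> \<le> \<rho>\<close>, where it has covariance matrix
  with diagonal entries \<open>\<rho>\<close> and off-diagonal entries \<open>\<nu>\<close>.
\<close>

definition gauss1 :: "real \<Rightarrow> real measure" where
  "gauss1 q = distr std_normal_distribution borel (\<lambda>u. sqrt q * u)"

definition gauss2 :: "real \<Rightarrow> real \<Rightarrow> (real \<times> real) measure" where
  "gauss2 \<rho> \<nu> = distr (std_normal_distribution \<Otimes>\<^sub>M std_normal_distribution) borel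
     (\<lambda>(u, v). (sqrt ((\<rho> + \<nu>) / 2) * u + sqrt ((\<rho> - \<nu>) / 2) * v,
               sqrt ((\<rho> + \<nu>) / 2) * u - sqrt ((\<rho> - \<nu>) / 2) * v))"

lemma gauss1_eq_normal_density:
  assumes "q > 0"
  shows "gauss1 q = density lborel (normal_density 0 (sqrt q))"
proof -
  interpret N: prob_space std_normal_distribution
    by (rule prob_space_normal_density) simp
  have "distributed std_normal_distribution lborel (\<lambda>x. x) std_normal_density"
    unfolding distributed_def
    by (auto intro!: measure_eqI simp: emeasure_distr)
  from N.normal_density_affine[OF this, of "sqrt q" 0] assms
  have "distributed std_normal_distribution lborel (\<lambda>x. sqrt q * x) (normal_density 0 (sqrt q))"
    by simp
  then have "distr std_normal_distribution lborel (\<lambda>x. sqrt q * x)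
      = density lborel (normal_density 0 (sqrt q))"
    by (simp add: distributed_def)
  moreover have "distr std_normal_distribution lborel (\<lambda>x. sqrt q * x) = gauss1 q"
    unfolding gauss1_def by (rule distr_cong) simp_all
  ultimately show ?thesis by simp
qed

lemma gauss2_covariance:
  assumes "\<bar>\<nu>\<bar> \<le> \<rho>"
  shows "(\<integral>z. fst z * fst z \<partial>gauss2 \<rho> \<nu>) = \<rho>"
    and "(\<integral>z. snd z * snd z \<partial>gauss2 \<rho> \<nu>) = \<rho>"
    and "(\<integral>z. fst z * snd z \<partial>gauss2 \<rho> \<nu>) = \<nu>"
proof -
  let ?N = std_normal_distribution
  interpret N: prob_space ?N
    by (rule prob_space_normal_density) simp
  interpret P: pair_prob_space ?N ?N ..
  have i1: "integrable ?N (\<lambda>x. x)"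
    using integrable_std_normal_distribution_moment[of 1] by simp
  have i2: "integrable ?N (\<lambda>x. x * x)"
    using integrable_std_normal_distribution_moment[of 2] by (simp add: power2_eq_square)
  have e1: "(\<integral>x. x \<partial>?N) = 0"
    using integral_std_normal_distribution_moment_odd[of 1] by simp
  have e2: "(\<integral>x. x * x \<partial>?N) = 1"
    using std_normal_distribution_even_moments(1)[of 1] by (simp add: power2_eq_square)
  have c: "integrable (?N \<Otimes>\<^sub>M ?N) (\<lambda>z. f (fst z) * g (snd z))
      \<and> (\<integral>z. f (fst z) * g (snd z) \<partial>(?N \<Otimes>\<^sub>M ?N)) = (\<integral>x. f x \<partial>?N) * (\<integral>x. g x \<partial>?N)"
    if "integrable ?N f" "integrable ?N g" for f g :: "real \<Rightarrow> real"
  proof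
    have "integrable (?N \<Otimes>\<^sub>M ?N) (\<lambda>(x, y). f x * g y)"
      using that by (intro P.Fubini_integrable) (auto simp: abs_mult)
    then show *: "integrable (?N \<Otimes>\<^sub>M ?N) (\<lambda>z. f (fst z) * g (snd z))"
      by (simp add: case_prod_beta')
    show "(\<integral>z. f (fst z) * g (snd z) \<partial>(?N \<Otimes>\<^sub>M ?N)) = (\<integral>x. f x \<partial>?N) * (\<integral>x. g x \<partial>?N)"
      using P.integral_fst'[OF *] by simp
  qed
  note uu = c[OF i2, of "\<lambda>_. 1", simplified, unfolded e2]
  note vv = c[OF _ i2, of "\<lambda>_. 1", simplified, unfolded e2]
  note uv = c[OF i1 i1, unfolded e1]
  define a where "a = sqrt ((\<rho> + \<nu>) / 2)"
  define b where "b = sqrt ((\<rho> - \<nu>) / 2)"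
  have ab: "a * a = (\<rho> + \<nu>) / 2" "b * b = (\<rho> - \<nu>) / 2"
    using assms by (auto simp: a_def b_def simp flip: power2_eq_square)
  have T: "gauss2 \<rho> \<nu> = distr (?N \<Otimes>\<^sub>M ?N) borel (\<lambda>z. (a * fst z + b * snd z, a * fst z - b * snd z))"
    by (simp add: gauss2_def a_def b_def case_prod_beta')
  have quad: "(\<integral>z. A * (fst z * fst z) + B * (fst z * snd z) + C * (snd z * snd z) \<partial>(?N \<Otimes>\<^sub>M ?N))
      = A + C" for A B C
    using uu vv uv N.prob_space by simp
  have D: "(\<integral>z. g z \<partial>gauss2 \<rho> \<nu>)
      = (\<integral>z. g (a * fst z + b * snd z, a * fst z - b * snd z) \<partial>(?N \<Otimes>\<^sub>M ?N))"
    if "g \<in> borel_measurable borel" for g :: "real \<times> real \<Rightarrow> real"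
    unfolding T using that by (subst integral_distr) (auto simp: borel_prod[symmetric])
  have sq: "(a * u + b * v) * (a * u + b * v) = a * a * (u * u) + 2 * (a * b) * (u * v) + b * b * (v * v)"
    "(a * u - b * v) * (a * u - b * v) = a * a * (u * u) + - (2 * (a * b)) * (u * v) + b * b * (v * v)"
    "(a * u + b * v) * (a * u - b * v) = a * a * (u * u) + 0 * (u * v) + - (b * b) * (v * v)" for u v
    by algebra+
  have m: "(\<lambda>z. fst z * fst z) \<in> borel_measurable (borel :: (real \<times> real) measure)"
    "(\<lambda>z. snd z * snd z) \<in> borel_measurable (borel :: (real \<times> real) measure)"
    "(\<lambda>z. fst z * snd z) \<in> borel_measurable (borel :: (real \<times> real) measure)"
    by (auto simp: borel_prod[symmetric])
  have ab': "a * a + b * b = \<rho>" "a * a + - (b * b) = \<nu>"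
    unfolding ab by (simp_all add: field_simps)
  show "(\<integral>z. fst z * fst z \<partial>gauss2 \<rho> \<nu>) = \<rho>"
    unfolding D[OF m(1)] fst_conv snd_conv sq quad by (rule ab')
  show "(\<integral>z. snd z * snd z \<partial>gauss2 \<rho> \<nu>) = \<rho>"
    unfolding D[OF m(2)] fst_conv snd_conv sq quad by (rule ab')
  show "(\<integral>z. fst z * snd z \<partial>gauss2 \<rho> \<nu>) = \<nu>"
    unfolding D[OF m(3)] fst_conv snd_conv sq quad by (rule ab')
qed

definition Vt :: "(real \<Rightarrow> real) \<Rightarrow> real \<Rightarrow> real" where
  "Vt \<phi> q = (\<integral>z. (\<phi> z)\<^sup>2 \<partial>gauss1 q)"

definition Wt :: "(real \<Rightarrow> real) \<Rightarrow> real \<Rightarrow> real \<Rightarrow> real" where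
  "Wt \<phi> \<rho> \<nu> = (\<integral>z. \<phi> (fst z) * \<phi> (snd z) \<partial>gauss2 \<rho> \<nu>)"

definition frn_inputs :: "real ^ 'n \<Rightarrow> real ^ 'n \<Rightarrow> real \<Rightarrow> real \<Rightarrow> bool" where
  "frn_inputs x x' p0 \<gamma>0 \<longleftrightarrow>
     p0 = (norm x)\<^sup>2 / real CARD('n) \<and> p0 = (norm x')\<^sup>2 / real CARD('n) \<and>
     \<gamma>0 = (x \<bullet> x') / real CARD('n)"

text \<open>
  The mean-field recurrences of a full residual network with nonlinearity \<open>\<phi>\<close>, where
  \<open>\<sigma>\<^sub>v\<close>, \<open>\<sigma>\<^sub>a\<close>, \<open>\<sigma>\<^sub>w\<close>, \<open>\<sigma>\<^sub>b\<close> are standard deviations, and \<open>p0\<close> and \<open>\<gamma>0\<close> are the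
  normalized squared length and inner product of the two inputs. The pre-activation quantities
  \<open>q\<close> and \<open>\<lambda>\<close> exist only for layers \<open>l \<ge> 1\<close>; \<open>frn_q\<close> and \<open>frn_lambda\<close> at \<open>0\<close>
  carry no meaning.
\<close>

primrec frn_p :: "(real \<Rightarrow> real) \<Rightarrow> real \<Rightarrow> real \<Rightarrow> real \<Rightarrow> real \<Rightarrow> real \<Rightarrow> nat \<Rightarrow> real" where
  "frn_p \<phi> \<sigma>\<^sub>v \<sigma>\<^sub>a \<sigma>\<^sub>w \<sigma>\<^sub>b p0 0 = p0"
| "frn_p \<phi> \<sigma>\<^sub>v \<sigma>\<^sub>a \<sigma>\<^sub>w \<sigma>\<^sub>b p0 (Suc l) =
     \<sigma>\<^sub>v\<^sup>2 * Vt \<phi> (\<sigma>\<^sub>w\<^sup>2 * frn_p \<phi> \<sigma>\<^sub>v \<sigma>\<^sub>a \<sigma>\<^sub>w \<sigma>\<^sub>b p0 l + \<sigma>\<^sub>b\<^sup>2)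
       + \<sigma>\<^sub>a\<^sup>2 + frn_p \<phi> \<sigma>\<^sub>v \<sigma>\<^sub>a \<sigma>\<^sub>w \<sigma>\<^sub>b p0 l"

definition frn_q :: "(real \<Rightarrow> real) \<Rightarrow> real \<Rightarrow> real \<Rightarrow> real \<Rightarrow> real \<Rightarrow> real \<Rightarrow> nat \<Rightarrow> real" where
  "frn_q \<phi> \<sigma>\<^sub>v \<sigma>\<^sub>a \<sigma>\<^sub>w \<sigma>\<^sub>b p0 l = \<sigma>\<^sub>w\<^sup>2 * frn_p \<phi> \<sigma>\<^sub>v \<sigma>\<^sub>a \<sigma>\<^sub>w \<sigma>\<^sub>b p0 (l - 1) + \<sigma>\<^sub>b\<^sup>2"

primrec frn_gamma :: "(real \<Rightarrow> real) \<Rightarrow> real \<Rightarrow> real \<Rightarrow> real \<Rightarrow> real \<Rightarrow> real \<Rightarrow> real \<Rightarrow> nat \<Rightarrow> real" where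
  "frn_gamma \<phi> \<sigma>\<^sub>v \<sigma>\<^sub>a \<sigma>\<^sub>w \<sigma>\<^sub>b p0 \<gamma>0 0 = \<gamma>0"
| "frn_gamma \<phi> \<sigma>\<^sub>v \<sigma>\<^sub>a \<sigma>\<^sub>w \<sigma>\<^sub>b p0 \<gamma>0 (Suc l) =
     \<sigma>\<^sub>v\<^sup>2 * Wt \<phi> (frn_q \<phi> \<sigma>\<^sub>v \<sigma>\<^sub>a \<sigma>\<^sub>w \<sigma>\<^sub>b p0 (Suc l))
                 (\<sigma>\<^sub>w\<^sup>2 * frn_gamma \<phi> \<sigma>\<^sub>v \<sigma>\<^sub>a \<sigma>\<^sub>w \<sigma>\<^sub>b p0 \<gamma>0 l + \<sigma>\<^sub>b\<^sup>2)
       + \<sigma>\<^sub>a\<^sup>2 + frn_gamma \<phi> \<sigma>\<^sub>v \<sigma>\<^sub>a \<sigma>\<^sub>w \<sigma>\<^sub>b p0 \<gamma>0 l"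

definition frn_lambda :: "(real \<Rightarrow> real) \<Rightarrow> real \<Rightarrow> real \<Rightarrow> real \<Rightarrow> real \<Rightarrow> real \<Rightarrow> real \<Rightarrow> nat \<Rightarrow> real" where
  "frn_lambda \<phi> \<sigma>\<^sub>v \<sigma>\<^sub>a \<sigma>\<^sub>w \<sigma>\<^sub>b p0 \<gamma>0 l =
     \<sigma>\<^sub>w\<^sup>2 * frn_gamma \<phi> \<sigma>\<^sub>v \<sigma>\<^sub>a \<sigma>\<^sub>w \<sigma>\<^sub>b p0 \<gamma>0 (l - 1) + \<sigma>\<^sub>b\<^sup>2"

lemma frn_recurrences:
  assumes "l \<ge> 1"
  shows "frn_p \<phi> \<sigma>\<^sub>v \<sigma>\<^sub>a \<sigma>\<^sub>w \<sigma>\<^sub>b p0 l =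
      \<sigma>\<^sub>v\<^sup>2 * Vt \<phi> (frn_q \<phi> \<sigma>\<^sub>v \<sigma>\<^sub>a \<sigma>\<^sub>w \<sigma>\<^sub>b p0 l) + \<sigma>\<^sub>a\<^sup>2 + frn_p \<phi> \<sigma>\<^sub>v \<sigma>\<^sub>a \<sigma>\<^sub>w \<sigma>\<^sub>b p0 (l - 1)"
    and "frn_gamma \<phi> \<sigma>\<^sub>v \<sigma>\<^sub>a \<sigma>\<^sub>w \<sigma>\<^sub>b p0 \<gamma>0 l =
      \<sigma>\<^sub>v\<^sup>2 * Wt \<phi> (frn_q \<phi> \<sigma>\<^sub>v \<sigma>\<^sub>a \<sigma>\<^sub>w \<sigma>\<^sub>b p0 l) (frn_lambda \<phi> \<sigma>\<^sub>v \<sigma>\<^sub>a \<sigma>\<^sub>w \<sigma>\<^sub>b p0 \<gamma>0 l)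
        + \<sigma>\<^sub>a\<^sup>2 + frn_gamma \<phi> \<sigma>\<^sub>v \<sigma>\<^sub>a \<sigma>\<^sub>w \<sigma>\<^sub>b p0 \<gamma>0 (l - 1)"
  using assms by (cases l; simp add: frn_q_def frn_lambda_def)+

definition frn_e :: "(real \<Rightarrow> real) \<Rightarrow> real \<Rightarrow> real \<Rightarrow> real \<Rightarrow> real \<Rightarrow> real \<Rightarrow> real \<Rightarrow> nat \<Rightarrow> real" where
  "frn_e \<phi> \<sigma>\<^sub>v \<sigma>\<^sub>a \<sigma>\<^sub>w \<sigma>\<^sub>b p0 \<gamma>0 l =
     frn_gamma \<phi> \<sigma>\<^sub>v \<sigma>\<^sub>a \<sigma>\<^sub>w \<sigma>\<^sub>b p0 \<gamma>0 l / frn_p \<phi> \<sigma>\<^sub>v \<sigma>\<^sub>a \<sigma>\<^sub>w \<sigma>\<^sub>b p0 l"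

definition frn_s :: "(real \<Rightarrow> real) \<Rightarrow> real \<Rightarrow> real \<Rightarrow> real \<Rightarrow> real \<Rightarrow> real \<Rightarrow> real \<Rightarrow> nat \<Rightarrow> real" where
  "frn_s \<phi> \<sigma>\<^sub>v \<sigma>\<^sub>a \<sigma>\<^sub>w \<sigma>\<^sub>b p0 \<gamma>0 l =
     frn_p \<phi> \<sigma>\<^sub>v \<sigma>\<^sub>a \<sigma>\<^sub>w \<sigma>\<^sub>b p0 l - frn_gamma \<phi> \<sigma>\<^sub>v \<sigma>\<^sub>a \<sigma>\<^sub>w \<sigma>\<^sub>b p0 \<gamma>0 l"

definition frn_fixpoint :: "real \<Rightarrow> real \<Rightarrow> real \<Rightarrow> bool" where
  "frn_fixpoint \<sigma>\<^sub>v \<sigma>\<^sub>a e \<longleftrightarrow>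
     e = 1 / (\<sigma>\<^sub>v\<^sup>2 + \<sigma>\<^sub>a\<^sup>2) * (\<sigma>\<^sub>v\<^sup>2 * (2 / pi) * arcsin e + \<sigma>\<^sub>a\<^sup>2)"

definition frn_delta :: "real \<Rightarrow> real \<Rightarrow> real \<Rightarrow> real" where
  "frn_delta \<sigma>\<^sub>v \<sigma>\<^sub>a e =
     1 - 2 / pi * (1 / sqrt (1 - e\<^sup>2)) * (\<sigma>\<^sub>v\<^sup>2 / (\<sigma>\<^sub>v\<^sup>2 + \<sigma>\<^sub>a\<^sup>2))"

text \<open>The two halves of \<open>f = \<Theta>(g)\<close> up to factors \<open>l powr \<epsilon>\<close> for arbitrarily small \<open>\<epsilon> > 0\<close>.\<close>

definition check_O :: "(nat \<Rightarrow> real) \<Rightarrow> (nat \<Rightarrow> real) \<Rightarrow> bool" where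
  "check_O f g \<longleftrightarrow> (\<forall>\<epsilon>>0. f \<in> O(\<lambda>l. g l * real l powr \<epsilon>))"

definition check_Omega :: "(nat \<Rightarrow> real) \<Rightarrow> (nat \<Rightarrow> real) \<Rightarrow> bool" where
  "check_Omega f g \<longleftrightarrow> (\<forall>\<epsilon>>0. f \<in> \<Omega>(\<lambda>l. g l * real l powr (- \<epsilon>)))"

definition check_Theta :: "(nat \<Rightarrow> real) \<Rightarrow> (nat \<Rightarrow> real) \<Rightarrow> bool" where
  "check_Theta f g \<longleftrightarrow> check_O f g \<and> check_Omega f g"

end

theory Submission
  imports Defs
begin

text \<open>
  Writing \<open>z = a u + b v\<close>, \<open>z' = a u - b v\<close> with independent standard normal \<open>u\<close>, \<open>v\<close>, the product
  \<open>tanh z tanh z'\<close> is increasing in \<open>\<bar>a u\<bar>\<close> and decreasing in \<open>\<bar>b v\<bar>\<close>. This makes \<open>W\<close> monotone in the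
  covariance and bounds \<open>V - W\<close> below by a multiple of \<open>sqrt (s / p)\<close>, which forces
  \<open>s = p - \<gamma>\<close> (and, by the symmetry \<open>\<nu> \<mapsto> -\<nu>\<close>, also \<open>p + \<gamma>\<close>) to grow linearly: the correlation stays
  away from \<open>1\<close> and \<open>-1\<close>. There \<open>tanh\<close> may be replaced by \<open>sgn\<close> at the cost \<open>O(1 / sqrt p)\<close>, and
  Sheppard's formula gives \<open>E (sgn z sgn z') = (2 / pi) arcsin\<close>. Hence \<open>e\<close> follows a perturbed Euler
  scheme for \<open>de/d(log p) = T e - e\<close>, \<open>T\<close> being the map of the fixed point equation, whose
  linearisation at the fixed point has rate \<open>- \<delta>\<close>; since \<open>\<delta> < 1 / 2\<close> the perturbation is
  negligible, which gives the upper bound.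

  For the lower bound, two trajectories with the same \<open>p\<close> are compared. The difference between \<open>W\<close>
  and its limit is Lipschitz in the correlation with a constant tending to \<open>0\<close>, so the two
  trajectories separate at the exact rate \<open>p powr - \<delta>\<close> up to \<open>\<epsilon>\<close>. A trajectory that converges faster
  than this must be faster by a fixed power, so there is at most one such trajectory.
\<close>

subsection \<open>Monotonicity of the Gaussian integrals\<close>

text \<open>Two obstacles shape the argument. At correlation 1 the arcsine has infinite slope, so
  neither linearisation nor Lipschitz bounds for the limiting drift work there; the repulsion from
  1, of order sqrt (1 - e), therefore has to be proved for \<open>tanh\<close> itself, before
  \<open>sgn\<close> enters. An error O(p powr - (1 / 2)) is smaller than p powr - \<delta>, yet it
  gives no lower bound: summing the linearised recurrence makes the coefficient of p powr - \<delta>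
  an initial value plus a convergent sum of errors, and this total may vanish. Error bounds alone
  cannot exclude an inner product for which it does, so one value \<open>\<gamma>exc\<close> is left
  out. For the comparison of trajectories a bound on the size of the errors is not enough either:
  their difference has to be small relative to the difference of the correlations. The exclusion of
  e = -1 has another origin: W is odd in the covariance, so without biases antipodal inputs stay
  antipodal at every layer, and -1 then solves the fixed point equation as well.\<close>

lemma tanh_add_mult_tanh_diff:
  "tanh (x + y) * tanh (x - y) =
     ((sinh x)\<^sup>2 - (sinh y)\<^sup>2) / (1 + (sinh x)\<^sup>2 + (sinh y)\<^sup>2)" for x y :: real
proof -
  have "sinh (x + y) * sinh (x - y) = (sinh x)\<^sup>2 * (cosh y)\<^sup>2 - (cosh x)\<^sup>2 * (sinh y)\<^sup>2"
    by (simp add: sinh_add sinh_diff power2_eq_square algebra_simps)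
  moreover have "cosh (x + y) * cosh (x - y) = (cosh x)\<^sup>2 * (cosh y)\<^sup>2 - (sinh x)\<^sup>2 * (sinh y)\<^sup>2"
    by (simp add: cosh_add cosh_diff power2_eq_square algebra_simps)
  ultimately show ?thesis
    unfolding tanh_def by (simp add: cosh_square_eq algebra_simps)
qed

text \<open>With P and Q the squares of sinh x and sinh y, the product is (P - Q) / (1 + P + Q),
  which increases in P and decreases in Q.\<close>

lemma tanh_add_mult_tanh_diff_mono:
  fixes x x' y y' :: real
  assumes "\<bar>x'\<bar> \<le> \<bar>x\<bar>" and "\<bar>y\<bar> \<le> \<bar>y'\<bar>"
  shows "tanh (x' + y') * tanh (x' - y') \<le> tanh (x + y) * tanh (x - y)"
proof -
  have sq: "(sinh s)\<^sup>2 \<le> (sinh t)\<^sup>2" if "\<bar>s\<bar> \<le> \<bar>t\<bar>" for s t :: real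
    using that by (metis abs_le_square_iff sinh_real_abs sinh_real_le_iff)
  have quotient_mono: "(P' - Q') / (1 + P' + Q') \<le> (P - Q) / (1 + P + Q)"
    if h: "0 \<le> P'" "P' \<le> P" "0 \<le> Q" "Q \<le> Q'" for P P' Q Q' :: real
  proof -
    \<comment> \<open>Cross-multiplied, the claim is
      \<open>P' * (1 + 2 * Q) + Q \<le> P * (1 + 2 * Q') + Q'\<close>.\<close>
    have "P' * (1 + 2 * Q) \<le> P * (1 + 2 * Q')" "Q * (1 + 0) \<le> Q' * (1 + 0)"
      using h by (intro mult_mono; simp)+
    then show ?thesis
      using h by (simp add: field_simps)
  qed
  show ?thesis
    unfolding tanh_add_mult_tanh_diff
    by (intro quotient_mono sq assms zero_le_power2)
qed

lemma abs_tanh_le_1: "\<bar>tanh x\<bar> \<le> 1" for x :: real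
  by (meson abs_leI less_imp_le minus_le_iff tanh_real_gt_neg1 tanh_real_lt_1)

lemma abs_tanh_mult_tanh_le_1: "\<bar>tanh x * tanh y\<bar> \<le> 1" for x y :: real
  by (simp add: abs_mult mult_le_one abs_tanh_le_1)

lemma measurable_tanh_real [measurable]: "(tanh :: real \<Rightarrow> real) \<in> borel_measurable borel"
  by (intro borel_measurable_continuous_onI continuous_intros) simp

lemma measurable_sgn_real [measurable]: "(sgn :: real \<Rightarrow> real) \<in> borel_measurable borel"
  unfolding sgn_real_def by measurable

abbreviation std_normal_pair :: "(real \<times> real) measure" where
  "std_normal_pair \<equiv> std_normal_distribution \<Otimes>\<^sub>M std_normal_distribution"

interpretation std_normal: prob_space std_normal_distribution
  by (rule prob_space_normal_density) simp

interpretation std_normal_pair: pair_prob_space std_normal_distribution std_normal_distribution ..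

lemma Wt_tanh_eq:
  "Wt tanh q \<nu> = (\<integral>z. tanh (sqrt ((q + \<nu>) / 2) * fst z + sqrt ((q - \<nu>) / 2) * snd z) *
     tanh (sqrt ((q + \<nu>) / 2) * fst z - sqrt ((q - \<nu>) / 2) * snd z) \<partial>std_normal_pair)"
proof -
  have m: "(\<lambda>z. tanh (fst z) * tanh (snd z)) \<in> borel_measurable (borel :: (real \<times> real) measure)"
    by (simp add: borel_prod[symmetric])
  show ?thesis
    unfolding Wt_def gauss2_def
    by (subst integral_distr[OF _ m]) (auto simp: case_prod_beta' borel_prod[symmetric])
qed

lemma integral_std_normal_pair_fst:
  fixes f :: "real \<Rightarrow> real"
  assumes [measurable]: "f \<in> borel_measurable borel" and "\<And>x. \<bar>f x\<bar> \<le> C"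
  shows "(\<integral>z. f (fst z) \<partial>std_normal_pair) = (\<integral>x. f x \<partial>std_normal_distribution)"
proof -
  have "integrable std_normal_pair (\<lambda>z. f (fst z))"
    by (rule std_normal_pair.integrable_const_bound[where B = C]) (auto simp: assms)
  from std_normal_pair.integral_fst'[OF this] show ?thesis
    using std_normal.prob_space by simp
qed

lemma integral_std_normal_pair_swap:
  fixes f :: "real \<times> real \<Rightarrow> real"
  assumes "f \<in> borel_measurable (borel \<Otimes>\<^sub>M borel)"
  shows "(\<integral>z. f (snd z, fst z) \<partial>std_normal_pair) = (\<integral>z. f z \<partial>std_normal_pair)"
proof -
  have "f \<in> borel_measurable std_normal_pair"
    using assms by (simp cong: measurable_cong_sets sets_pair_measure_cong)
  from std_normal_pair.integral_product_swap[OF this] show ?thesis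
    by (simp add: case_prod_beta')
qed

lemma integrable_tanh_mult_tanh:
  "integrable std_normal_pair (\<lambda>z. tanh (a * fst z + b * snd z) * tanh (c * fst z + d * snd z))"
  by (rule std_normal_pair.integrable_const_bound[where B = 1])
     (auto simp: abs_tanh_mult_tanh_le_1)

lemma integrable_tanh_mult_tanh_diff:
  "integrable std_normal_pair (\<lambda>z. tanh (a * fst z + b * snd z) * tanh (c * fst z - d * snd z))"
  using integrable_tanh_mult_tanh[of a b c "- d"] by simp

lemma Wt_tanh_diag_eq_Vt: "Wt tanh q q = Vt tanh q"
proof -
  have "Vt tanh q = (\<integral>u. (tanh (sqrt q * u))\<^sup>2 \<partial>std_normal_distribution)"
    unfolding Vt_def gauss1_def by (subst integral_distr) auto
  also have "\<dots> = (\<integral>z. (tanh (sqrt q * fst z))\<^sup>2 \<partial>std_normal_pair)"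
    by (rule integral_std_normal_pair_fst[symmetric, where C = 1])
       (auto simp: abs_tanh_le_1 abs_square_le_1)
  finally show ?thesis
    unfolding Wt_tanh_eq by (simp add: power2_eq_square)
qed

text \<open>Negating the covariance exchanges the two square-root coefficients; exchanging the
  coordinates undoes this up to the sign of the second factor.\<close>

lemma Wt_tanh_minus: "Wt tanh q (- \<nu>) = - Wt tanh q \<nu>"
proof -
  define f :: "real \<times> real \<Rightarrow> real" where
    "f = (\<lambda>z. tanh (sqrt ((q + \<nu>) / 2) * fst z + sqrt ((q - \<nu>) / 2) * snd z) *
     tanh (sqrt ((q + \<nu>) / 2) * fst z - sqrt ((q - \<nu>) / 2) * snd z))"
  have "Wt tanh q (- \<nu>) = (\<integral>z. - f (snd z, fst z) \<partial>std_normal_pair)"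
    unfolding Wt_tanh_eq f_def
  proof (intro Bochner_Integration.integral_cong refl)
    fix z :: "real \<times> real"
    have "tanh (s - t) = - tanh (t - s)" for s t :: real
      using tanh_minus[of "t - s"] by simp
    from this[of "sqrt ((q + - \<nu>) / 2) * fst z" "sqrt ((q - - \<nu>) / 2) * snd z"]
    show "tanh (sqrt ((q + - \<nu>) / 2) * fst z + sqrt ((q - - \<nu>) / 2) * snd z) *
         tanh (sqrt ((q + - \<nu>) / 2) * fst z - sqrt ((q - - \<nu>) / 2) * snd z) =
         - (tanh (sqrt ((q + \<nu>) / 2) * fst (snd z, fst z) + sqrt ((q - \<nu>) / 2) * snd (snd z, fst z)) *
            tanh (sqrt ((q + \<nu>) / 2) * fst (snd z, fst z) - sqrt ((q - \<nu>) / 2) * snd (snd z, fst z)))"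
      by (simp add: add.commute)
  qed
  also have "\<dots> = - (\<integral>z. f z \<partial>std_normal_pair)"
    by (subst Bochner_Integration.integral_minus, subst integral_std_normal_pair_swap)
       (auto simp: f_def)
  finally show ?thesis
    unfolding Wt_tanh_eq f_def .
qed

lemma Wt_tanh_mono:
  assumes "- q \<le> \<nu>'" "\<nu>' \<le> \<nu>" "\<nu> \<le> q"
  shows "Wt tanh q \<nu>' \<le> Wt tanh q \<nu>"
  unfolding Wt_tanh_eq
proof (intro integral_mono integrable_tanh_mult_tanh_diff)
  fix z :: "real \<times> real"
  show "tanh (sqrt ((q + \<nu>') / 2) * fst z + sqrt ((q - \<nu>') / 2) * snd z) *
         tanh (sqrt ((q + \<nu>') / 2) * fst z - sqrt ((q - \<nu>') / 2) * snd z)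
         \<le> tanh (sqrt ((q + \<nu>) / 2) * fst z + sqrt ((q - \<nu>) / 2) * snd z) *
            tanh (sqrt ((q + \<nu>) / 2) * fst z - sqrt ((q - \<nu>) / 2) * snd z)"
    using assms by (intro tanh_add_mult_tanh_diff_mono) (auto simp: abs_mult mult_right_mono)
qed

lemma Wt_tanh_le_Vt: "\<bar>\<nu>\<bar> \<le> q \<Longrightarrow> \<bar>Wt tanh q \<nu>\<bar> \<le> Vt tanh q"
  using Wt_tanh_mono[of q \<nu> q] Wt_tanh_mono[of q "- \<nu>" q] Wt_tanh_minus[of q \<nu>]
    Wt_tanh_diag_eq_Vt[of q] by (auto simp: abs_le_iff)

lemma Vt_tanh_le_1: "Vt tanh q \<le> 1"
proof -
  have "Wt tanh q q \<le> (\<integral>z. 1 \<partial>std_normal_pair)"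
    unfolding Wt_tanh_eq
    by (intro integral_mono integrable_tanh_mult_tanh_diff)
       (use abs_tanh_mult_tanh_le_1 in \<open>auto simp: abs_le_iff\<close>)
  then show ?thesis
    by (simp add: Wt_tanh_diag_eq_Vt std_normal_pair.prob_space)
qed

lemma std_normal_interval_ge:
  assumes "0 \<le> s" "s \<le> t"
  shows "(t - s) * std_normal_density t \<le> measure std_normal_distribution {s..t}"
proof -
  have "ennreal ((t - s) * std_normal_density t)
      = (\<integral>\<^sup>+x. ennreal (std_normal_density t) * indicator {s..t} x \<partial>lborel)"
    using assms by (simp add: nn_integral_cmult_indicator ennreal_mult' mult.commute)
  also have "\<dots> \<le> (\<integral>\<^sup>+x. ennreal (std_normal_density x) * indicator {s..t} x \<partial>lborel)"
    using assms
    by (intro nn_integral_mono)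
       (auto simp: indicator_def std_normal_density_def ennreal_leI power_mono field_simps)
  also have "\<dots> = emeasure std_normal_distribution {s..t}"
    by (simp add: emeasure_density)
  finally show ?thesis
    by (simp add: std_normal.emeasure_eq_measure)
qed

text \<open>The integrand of W is pointwise at most that of V, so any set on which the gap is
  explicit gives a lower bound. The rectangle \<open>R\<close> yields both factors: the gap there is
  at least the squared \<open>tanh\<close>, and its measure is of the order of the square
  root.\<close>

lemma Vt_minus_Wt_tanh_ge:
  obtains \<kappa> where "\<kappa> > 0"
    "\<And>q \<nu>. \<bar>\<nu>\<bar> \<le> q \<Longrightarrow> 0 < q \<Longrightarrow> \<kappa> * (tanh (sqrt ((q - \<nu>) / 2) / 2))\<^sup>2 * sqrt ((q - \<nu>) / q)
       \<le> Vt tanh q - Wt tanh q \<nu>"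
proof
  define n where "n = std_normal_density"
  \<comment> \<open>The two densities bound the sides of \<open>R\<close> from below; 2 comes from
    the length \<open>b / (2 * sqrt q)\<close> of the first side and \<open>sqrt 2\<close> from
    rewriting \<open>b / sqrt q\<close>.\<close>
  define \<kappa> where "\<kappa> = n 1 * n 2 / (2 * sqrt 2)"
  show "\<kappa> > 0"
    by (simp add: \<kappa>_def n_def normal_density_pos)
  fix q \<nu> :: real
  assume \<nu>: "\<bar>\<nu>\<bar> \<le> q" and q: "0 < q"
  define a where "a = sqrt ((q + \<nu>) / 2)"
  define b where "b = sqrt ((q - \<nu>) / 2)"
  have ab: "0 \<le> a" "0 \<le> b" "a \<le> sqrt q" "b \<le> sqrt q"
    using \<nu> unfolding a_def b_def real_sqrt_le_iff by auto
  have sqrt_b: "sqrt ((q - \<nu>) / q) = sqrt 2 * (b / sqrt q)"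
    unfolding b_def by (simp add: real_sqrt_divide)
  define K where "K = (\<lambda>z. tanh (a * fst z + b * snd z) * tanh (a * fst z - b * snd z))"
  define T where "T = (\<lambda>z :: real \<times> real. (tanh (sqrt q * fst z))\<^sup>2)"
  \<comment> \<open>On \<open>R\<close>, \<open>sqrt q * fst z\<close> lies between
    \<open>b / 2\<close> and \<open>b\<close> while \<open>b * snd z\<close> is at least
    \<open>b\<close>. Hence the second factor of \<open>K\<close> is nonpositive, whereas
    \<open>T\<close> is at least the square of \<open>tanh (b / 2)\<close>.\<close>
  define R where "R = {b / (2 * sqrt q)..b / sqrt q} \<times> {1..2::real}"
  have intK: "integrable std_normal_pair K"
    unfolding K_def by (rule integrable_tanh_mult_tanh_diff)
  have T_eq: "T z = tanh (sqrt q * fst z + 0) * tanh (sqrt q * fst z - 0)" for z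
    by (simp add: T_def power2_eq_square)
  have intT: "integrable std_normal_pair T"
    using integrable_tanh_mult_tanh[of "sqrt q" 0 "sqrt q" 0] by (simp add: T_def power2_eq_square)
  have R: "R \<in> sets std_normal_pair"
    by (auto simp: R_def)
  have "K z \<le> T z" for z
    unfolding K_def T_eq using ab by (intro tanh_add_mult_tanh_diff_mono) (auto simp: abs_mult mult_right_mono)
  moreover have "(tanh (b / 2))\<^sup>2 \<le> T z - K z" if "z \<in> R" for z
  proof -
    from that have z: "b / (2 * sqrt q) \<le> fst z" "fst z \<le> b / sqrt q" "1 \<le> snd z"
      by (auto simp: R_def mem_Times_iff)
    then have le: "b / 2 \<le> sqrt q * fst z" "sqrt q * fst z \<le> b"
      using q by (auto simp: field_simps)
    then have "a * fst z \<le> b * snd z" "0 \<le> a * fst z"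
    proof -
      show f: "0 \<le> a * fst z"
        using z(1) ab q by (intro mult_nonneg_nonneg) (auto intro: order.trans[rotated])
      have "a * fst z \<le> sqrt q * fst z"
        using z(1) ab q by (intro mult_right_mono) (auto intro: order.trans[rotated])
      also have "\<dots> \<le> b * snd z"
        using le(2) mult_left_mono[OF z(3) ab(2)] by simp
      finally show "a * fst z \<le> b * snd z" .
    qed
    then have "K z \<le> 0"
      unfolding K_def by (intro mult_nonneg_nonpos) auto
    moreover have "(tanh (b / 2))\<^sup>2 \<le> T z"
      unfolding T_def using le(1) ab by (intro power_mono) auto
    ultimately show ?thesis by simp
  qed
  ultimately have "(tanh (b / 2))\<^sup>2 * indicator R z \<le> T z - K z" for z
    by (auto simp: indicator_def)
  then have "(\<integral>z. (tanh (b / 2))\<^sup>2 * indicator R z \<partial>std_normal_pair)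
      \<le> (\<integral>z. T z - K z \<partial>std_normal_pair)"
    using R by (intro integral_mono Bochner_Integration.integrable_diff intT intK)
       (auto simp: integrable_indicator_iff std_normal_pair.emeasure_eq_measure)
  also have "\<dots> = Vt tanh q - Wt tanh q \<nu>"
    using intK intT
    by (simp add: K_def T_def Wt_tanh_diag_eq_Vt[symmetric] Wt_tanh_eq a_def b_def power2_eq_square)
  also have "(\<integral>z. (tanh (b / 2))\<^sup>2 * indicator R z \<partial>std_normal_pair)
      = (tanh (b / 2))\<^sup>2 * measure std_normal_pair R"
    using R by simp
  also have "measure std_normal_pair R = measure std_normal_distribution {b / (2 * sqrt q)..b / sqrt q} *
      measure std_normal_distribution {1..2}"
    unfolding R_def
    by (simp add: measure_def std_normal.emeasure_pair_measure_Times enn2real_mult)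
  finally have *: "(tanh (b / 2))\<^sup>2 * (measure std_normal_distribution {b / (2 * sqrt q)..b / sqrt q} *
      measure std_normal_distribution {1..2}) \<le> Vt tanh q - Wt tanh q \<nu>" .
  have "b / (2 * sqrt q) * n 1 \<le> b / (2 * sqrt q) * n (b / sqrt q)"
  proof (intro mult_left_mono)
    have "(b / sqrt q)\<^sup>2 \<le> 1"
      using ab q by (intro power_le_one) auto
    then show "n 1 \<le> n (b / sqrt q)"
      unfolding n_def std_normal_density_def by (simp add: divide_right_mono)
  qed (use ab q in auto)
  also have "\<dots> \<le> measure std_normal_distribution {b / (2 * sqrt q)..b / sqrt q}"
    using std_normal_interval_ge[of "b / (2 * sqrt q)" "b / sqrt q"] ab q
    by (simp add: n_def field_simps)
  finally have "b / (2 * sqrt q) * n 1 * n 2 \<le>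
      measure std_normal_distribution {b / (2 * sqrt q)..b / sqrt q} * measure std_normal_distribution {1..2}"
    using std_normal_interval_ge[of 1 2] by (intro mult_mono) (auto simp: n_def)
  then have "(tanh (b / 2))\<^sup>2 * (b / (2 * sqrt q) * n 1 * n 2) \<le> Vt tanh q - Wt tanh q \<nu>"
    using * by (meson mult_left_mono order.trans zero_le_power2)
  also have "(tanh (b / 2))\<^sup>2 * (b / (2 * sqrt q) * n 1 * n 2)
      = \<kappa> * (tanh (sqrt ((q - \<nu>) / 2) / 2))\<^sup>2 * sqrt ((q - \<nu>) / q)"
    unfolding sqrt_b by (simp add: \<kappa>_def flip: b_def)
  finally show "\<kappa> * (tanh (sqrt ((q - \<nu>) / 2) / 2))\<^sup>2 * sqrt ((q - \<nu>) / q)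
       \<le> Vt tanh q - Wt tanh q \<nu>" .
qed

subsection \<open>Comparison with the sign function\<close>

text \<open>The decay is in fact exponential; a quadratic Taylor bound is enough for an integrable
  majorant on the line.\<close>

lemma one_minus_tanh_abs_le: "1 - tanh \<bar>x\<bar> \<le> inverse (1 + x\<^sup>2)" for x :: real
proof -
  define y where "y = \<bar>x\<bar>"
  have y: "0 \<le> y" "y\<^sup>2 = x\<^sup>2"
    by (auto simp: y_def)
  have "1 + 2 * y + 2 * y\<^sup>2 \<le> exp (2 * y)"
    using exp_lower_Taylor_quadratic[of "2 * y"] y by (simp add: power2_eq_square)
  then have le: "2 * (1 + y\<^sup>2) \<le> exp (2 * y) + 1"
    using y by simp
  have "1 - tanh y = 1 / ((exp (2 * y) + 1) / 2)"
    using exp_gt_zero[of "2 * y"]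
    by (simp add: tanh_real_altdef exp_minus divide_simps del: exp_gt_zero)
  also have "\<dots> \<le> 1 / (1 + y\<^sup>2)"
    using le add_pos_nonneg[of 1 "y\<^sup>2"] by (intro divide_left_mono mult_pos_pos) auto
  finally show ?thesis
    by (simp add: y inverse_eq_divide flip: y_def)
qed

lemma one_minus_tanh_abs_bounds:
  "0 \<le> 1 - tanh \<bar>x\<bar>" "1 - tanh \<bar>x\<bar> \<le> 1" "\<bar>1 - tanh \<bar>x\<bar>\<bar> \<le> 1" for x :: real
  using abs_tanh_le_1[of "\<bar>x\<bar>"] by (auto simp: abs_le_iff)

lemma integrable_one_minus_tanh_abs: "integrable lborel (\<lambda>x :: real. 1 - tanh \<bar>x\<bar>)"
proof (rule Bochner_Integration.integrable_bound)
  show "integrable lborel (\<lambda>x :: real. inverse (1 + x\<^sup>2))"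
    using integrable_inverse_1_plus_square by (simp add: set_integrable_def)
  have "\<bar>1 - tanh \<bar>x\<bar>\<bar> \<le> \<bar>inverse (1 + x\<^sup>2)\<bar>" for x :: real
    using one_minus_tanh_abs_le[of x] abs_tanh_le_1[of "\<bar>x\<bar>"] by linarith
  then show "AE x in lborel. norm (1 - tanh \<bar>x\<bar>) \<le> norm (inverse (1 + x\<^sup>2) :: real)"
    by auto
qed measurable

text \<open>The L1 distance between \<open>tanh\<close> and \<open>sgn\<close> on the line, that is
  2 ln 2. It enters only as a nonnegative constant.\<close>

definition tanh_defect :: real where
  "tanh_defect = (\<integral>x. 1 - tanh \<bar>x\<bar> \<partial>lborel)"

lemma tanh_defect_nonneg: "0 \<le> tanh_defect"
  unfolding tanh_defect_def by (intro integral_nonneg_AE) (use one_minus_tanh_abs_bounds in auto)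

text \<open>The standard normal density is at most 1, so the Lebesgue integral dominates; there the
  affine substitution produces the factor 1 / a and makes the bound uniform in the shift
  \<open>t\<close>.\<close>

lemma integral_one_minus_tanh_affine_le:
  assumes "a > 0"
  shows "(\<integral>u. 1 - tanh \<bar>a * u + t\<bar> \<partial>std_normal_distribution) \<le> tanh_defect / a"
proof -
  have int: "integrable lborel (\<lambda>u. 1 - tanh \<bar>t + a * u\<bar>)"
    using lborel_integrable_real_affine[OF integrable_one_minus_tanh_abs, of a t] assms by simp
  have dens: "std_normal_density u \<le> 1" for u
  proof -
    have "1 \<le> sqrt (2 * pi)"
      using pi_ge_two by simp
    then show ?thesis
      unfolding std_normal_density_def by (intro mult_le_one) (auto simp: field_simps)
  qed
  have "(\<integral>u. 1 - tanh \<bar>a * u + t\<bar> \<partial>std_normal_distribution)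
      = (\<integral>u. std_normal_density u * (1 - tanh \<bar>t + a * u\<bar>) \<partial>lborel)"
    by (subst integral_density) (auto simp: add.commute)
  also have "\<dots> \<le> (\<integral>u. 1 - tanh \<bar>t + a * u\<bar> \<partial>lborel)"
  proof (intro integral_mono int Bochner_Integration.integrable_bound[OF int])
    show "AE u in lborel. norm (std_normal_density u * (1 - tanh \<bar>t + a * u\<bar>)) \<le> norm (1 - tanh \<bar>t + a * u\<bar>)"
      using dens by (auto simp: abs_mult mult_left_le_one_le)
    show "std_normal_density u * (1 - tanh \<bar>t + a * u\<bar>) \<le> 1 - tanh \<bar>t + a * u\<bar>" for u
      using dens by (intro mult_left_le_one_le one_minus_tanh_abs_bounds) auto
  qed measurable
  also have "\<dots> = tanh_defect / a"
    using lborel_integral_real_affine[of a "\<lambda>x. 1 - tanh \<bar>x\<bar>" t] assms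
    by (simp add: tanh_defect_def field_simps)
  finally show ?thesis .
qed

lemma integrable_one_minus_tanh_pair:
  "integrable std_normal_pair (\<lambda>z. 1 - tanh \<bar>a * fst z + b * snd z\<bar>)"
  by (rule std_normal_pair.integrable_const_bound[where B = 1])
     (use one_minus_tanh_abs_bounds in auto)

lemma integral_one_minus_tanh_pair_le:
  assumes "a > 0"
  shows "(\<integral>z. 1 - tanh \<bar>a * fst z + b * snd z\<bar> \<partial>std_normal_pair) \<le> tanh_defect / a"
proof -
  have int: "integrable std_normal_pair (\<lambda>(u, v). 1 - tanh \<bar>a * u + b * v\<bar>)"
    using integrable_one_minus_tanh_pair[of a b] by (simp add: case_prod_beta')
  have "(\<integral>z. 1 - tanh \<bar>a * fst z + b * snd z\<bar> \<partial>std_normal_pair)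
      = (\<integral>v. (\<integral>u. 1 - tanh \<bar>a * u + b * v\<bar> \<partial>std_normal_distribution) \<partial>std_normal_distribution)"
    unfolding std_normal_pair.integral_snd[OF int] by (simp add: case_prod_beta')
  also have "\<dots> \<le> (\<integral>v. tanh_defect / a \<partial>std_normal_distribution)"
    by (intro integral_mono std_normal_pair.integrable_snd[OF int] integral_one_minus_tanh_affine_le assms) auto
  also have "\<dots> = tanh_defect / a"
    using std_normal.prob_space by simp
  finally show ?thesis .
qed

lemma Vt_tanh_ge:
  assumes "q > 0"
  shows "1 - 2 * tanh_defect / sqrt q \<le> Vt tanh q"
proof -
  have int: "integrable std_normal_distribution (\<lambda>u. 1 - tanh \<bar>sqrt q * u\<bar>)"
    by (rule std_normal.integrable_const_bound[where B = 1]) (use one_minus_tanh_abs_bounds in auto)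
  have sq: "1 - 2 * (1 - tanh \<bar>t\<bar>) \<le> (tanh t)\<^sup>2" for t :: real
    using zero_le_power2[of "1 - \<bar>tanh t\<bar>"] by (simp add: power2_diff)
  have "1 - 2 * (tanh_defect / sqrt q) \<le> 1 - 2 * (\<integral>u. 1 - tanh \<bar>sqrt q * u\<bar> \<partial>std_normal_distribution)"
    using integral_one_minus_tanh_affine_le[of "sqrt q" 0] assms by simp
  also have "\<dots> = (\<integral>u. 1 - 2 * (1 - tanh \<bar>sqrt q * u\<bar>) \<partial>std_normal_distribution)"
    using std_normal.prob_space
      Bochner_Integration.integral_diff[OF std_normal.integrable_const integrable_mult_right[OF int], of 1 2]
    unfolding integral_mult_right_zero by simp
  also have "\<dots> \<le> (\<integral>u. (tanh (sqrt q * u))\<^sup>2 \<partial>std_normal_distribution)"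
  proof (intro integral_mono sq)
    show "integrable std_normal_distribution (\<lambda>u. 1 - 2 * (1 - tanh \<bar>sqrt q * u\<bar>))"
      by (intro Bochner_Integration.integrable_diff integrable_mult_right int) auto
    show "integrable std_normal_distribution (\<lambda>u. (tanh (sqrt q * u))\<^sup>2)"
      by (rule std_normal.integrable_const_bound[where B = 1])
         (auto simp: abs_square_le_1 abs_tanh_le_1)
  qed
  also have "\<dots> = Vt tanh q"
    unfolding Vt_def gauss1_def by (subst integral_distr) auto
  finally show ?thesis by simp
qed

text \<open>The expected product of the signs of two standard normal variables with correlation
  \<open>c\<close>; it is the limit of \<open>Wt tanh q (c * q)\<close> for large
  \<open>q\<close>.\<close>

definition sgn_corr :: "real \<Rightarrow> real" where
  "sgn_corr c = (\<integral>z. sgn (sqrt ((1 + c) / 2) * fst z + sqrt ((1 - c) / 2) * snd z) *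
     sgn (sqrt ((1 + c) / 2) * fst z - sqrt ((1 - c) / 2) * snd z) \<partial>std_normal_pair)"

lemma tanh_prod_minus_sgn_prod_le:
  fixes s t :: real
  shows "\<bar>tanh s * tanh t - sgn s * sgn t\<bar> \<le> (1 - tanh \<bar>s\<bar>) + (1 - tanh \<bar>t\<bar>)"
proof -
  have *: "\<bar>tanh x - sgn x\<bar> \<le> 1 - tanh \<bar>x\<bar>" "\<bar>sgn x\<bar> \<le> 1" for x :: real
    using abs_tanh_le_1[of x] by (auto simp: sgn_real_def abs_if)
  have "tanh s * tanh t - sgn s * sgn t = (tanh s - sgn s) * tanh t + sgn s * (tanh t - sgn t)"
    by (simp add: algebra_simps)
  also have "\<bar>\<dots>\<bar> \<le> \<bar>tanh s - sgn s\<bar> * \<bar>tanh t\<bar> + \<bar>sgn s\<bar> * \<bar>tanh t - sgn t\<bar>"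
    by (metis abs_mult abs_triangle_ineq)
  also have "\<dots> \<le> (1 - tanh \<bar>s\<bar>) * 1 + 1 * (1 - tanh \<bar>t\<bar>)"
    by (intro add_mono mult_mono * abs_tanh_le_1 one_minus_tanh_abs_bounds) auto
  finally show ?thesis by simp
qed

text \<open>Since \<open>sgn\<close> ignores positive factors, both integrals can use the same
  coefficients \<open>a\<close> and \<open>b\<close>. Their squares add up to \<open>q\<close>, so
  one of them is at least sqrt (q / 2). Integrating first along that coordinate bounds each of the
  two defects by \<open>sqrt 2 * tanh_defect / sqrt q\<close>, uniformly in \<open>c\<close> and
  including the degenerate ends.\<close>

lemma Wt_tanh_approx:
  assumes "q > 0" "\<bar>c\<bar> \<le> 1"
  shows "\<bar>Wt tanh q (c * q) - sgn_corr c\<bar> \<le> 2 * sqrt 2 * tanh_defect / sqrt q"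
proof -
  define a where "a = sqrt ((q + c * q) / 2)"
  define b where "b = sqrt ((q - c * q) / 2)"
  have eq: "a = sqrt q * sqrt ((1 + c) / 2)" "b = sqrt q * sqrt ((1 - c) / 2)"
    unfolding a_def b_def real_sqrt_mult[symmetric] by (simp_all add: algebra_simps)
  have sgn: "sgn_corr c = (\<integral>z. sgn (a * fst z + b * snd z) * sgn (a * fst z - b * snd z) \<partial>std_normal_pair)"
  proof -
    have "sgn (sqrt q * x) = sgn x" for x
      using assms by (simp add: sgn_mult)
    moreover have "a * u + b * v = sqrt q * (sqrt ((1 + c) / 2) * u + sqrt ((1 - c) / 2) * v)"
      "a * u - b * v = sqrt q * (sqrt ((1 + c) / 2) * u - sqrt ((1 - c) / 2) * v)" for u v
      unfolding eq by (simp_all add: algebra_simps)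
    ultimately show ?thesis
      unfolding sgn_corr_def by simp
  qed
  have int_sgn: "integrable std_normal_pair (\<lambda>z. sgn (a * fst z + b * snd z) * sgn (a * fst z - b * snd z))"
    by (rule std_normal_pair.integrable_const_bound[where B = 1]) (auto simp: abs_mult sgn_real_def)
  note int_tanh = integrable_tanh_mult_tanh_diff[of a b a b]
  note int1 = integrable_one_minus_tanh_pair[of a b]
  have int2: "integrable std_normal_pair (\<lambda>z. 1 - tanh \<bar>a * fst z - b * snd z\<bar>)"
    using integrable_one_minus_tanh_pair[of a "- b"] by simp
  have nonneg: "0 \<le> a" "0 \<le> b" and max: "sqrt q / sqrt 2 \<le> max a b"
  proof -
    show "0 \<le> a" "0 \<le> b"
      using assms unfolding eq by auto
    have "sqrt (q / 2) \<le> max a b"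
    proof (cases "c \<ge> 0")
      case True
      then have "sqrt (q / 2) \<le> a"
        unfolding a_def using assms by simp
      then show ?thesis by simp
    next
      case False
      then have "c * q \<le> 0"
        using assms by (simp add: mult_nonpos_nonneg)
      then have "sqrt (q / 2) \<le> b"
        unfolding b_def by simp
      then show ?thesis by simp
    qed
    then show "sqrt q / sqrt 2 \<le> max a b"
      by (simp add: real_sqrt_divide)
  qed
  have swap: "(\<integral>z. 1 - tanh \<bar>x * fst z + y * snd z\<bar> \<partial>std_normal_pair)
      = (\<integral>z. 1 - tanh \<bar>y * fst z + x * snd z\<bar> \<partial>std_normal_pair)" for x y :: real
    using integral_std_normal_pair_swap[of "\<lambda>z. 1 - tanh \<bar>y * fst z + x * snd z\<bar>"]
    by (simp add: add.commute)
  have bound: "(\<integral>z. 1 - tanh \<bar>x * fst z + y * snd z\<bar> \<partial>std_normal_pair) \<le> sqrt 2 * tanh_defect / sqrt q"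
    if "\<bar>x\<bar> = a" "\<bar>y\<bar> = b" for x y
  proof -
    have *: "(\<integral>z. 1 - tanh \<bar>x * fst z + y * snd z\<bar> \<partial>std_normal_pair) \<le> tanh_defect / \<bar>x\<bar>"
      if "x \<noteq> 0" for x y
    proof (cases "x > 0")
      case True
      then show ?thesis
        using integral_one_minus_tanh_pair_le[of x y] by simp
    next
      case False
      have "(\<integral>z. 1 - tanh \<bar>x * fst z + y * snd z\<bar> \<partial>std_normal_pair)
          = (\<integral>z. 1 - tanh \<bar>- x * fst z + - y * snd z\<bar> \<partial>std_normal_pair)"
        by (intro Bochner_Integration.integral_cong refl) (simp add: abs_if)
      also have "\<dots> \<le> tanh_defect / (- x)"
        using False that by (intro integral_one_minus_tanh_pair_le) auto
      finally show ?thesis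
        using False by simp
    qed
      have "max a b > 0"
      using max assms by (auto intro: less_le_trans[of 0 "sqrt q / sqrt 2"])
    have "(\<integral>z. 1 - tanh \<bar>x * fst z + y * snd z\<bar> \<partial>std_normal_pair) \<le> tanh_defect / max a b"
    proof (cases "b \<le> a")
      case True
      then show ?thesis
        using *[of x y] \<open>max a b > 0\<close> that by (auto simp: max_def)
    next
      case False
      then show ?thesis
        using *[of y x] swap[of x y] \<open>max a b > 0\<close> that by (auto simp: max_def)
    qed
    also have "\<dots> \<le> tanh_defect / (sqrt q / sqrt 2)"
      using max \<open>max a b > 0\<close> assms
      by (intro divide_left_mono tanh_defect_nonneg mult_pos_pos) auto
    finally show ?thesis
      by (simp add: mult.commute)
  qed
  have "\<bar>Wt tanh q (c * q) - sgn_corr c\<bar> =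
      \<bar>\<integral>z. tanh (a * fst z + b * snd z) * tanh (a * fst z - b * snd z)
          - sgn (a * fst z + b * snd z) * sgn (a * fst z - b * snd z) \<partial>std_normal_pair\<bar>"
    unfolding Wt_tanh_eq sgn a_def[symmetric] b_def[symmetric]
    using int_tanh int_sgn by simp
  also have "\<dots> \<le> (\<integral>z. (1 - tanh \<bar>a * fst z + b * snd z\<bar>) + (1 - tanh \<bar>a * fst z - b * snd z\<bar>) \<partial>std_normal_pair)"
    using tanh_prod_minus_sgn_prod_le
    by (intro integral_abs_bound[THEN order.trans] integral_mono integrable_abs
        Bochner_Integration.integrable_add Bochner_Integration.integrable_diff int_tanh int_sgn int1 int2)
  also have "\<dots> = (\<integral>z. 1 - tanh \<bar>a * fst z + b * snd z\<bar> \<partial>std_normal_pair)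
      + (\<integral>z. 1 - tanh \<bar>a * fst z + (- b) * snd z\<bar> \<partial>std_normal_pair)"
    using Bochner_Integration.integral_add[OF int1 int2] by simp
  also have "\<dots> \<le> sqrt 2 * tanh_defect / sqrt q + sqrt 2 * tanh_defect / sqrt q"
    using nonneg by (intro add_mono bound) auto
  finally show ?thesis by (simp add: mult_ac)
qed

section \<open>Sheppard's formula through the Cauchy law of a Gaussian quotient\<close>

lemma sets_cone [measurable]:
  "{z :: real \<times> real. \<bar>snd z\<bar> < k * \<bar>fst z\<bar>} \<in> sets (borel \<Otimes>\<^sub>M borel)"
proof -
  have "{z \<in> space (borel \<Otimes>\<^sub>M borel). \<bar>snd z :: real\<bar> < k * \<bar>fst z\<bar>} \<in> sets (borel \<Otimes>\<^sub>M borel)"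
    by measurable
  then show ?thesis
    by (simp add: space_pair_measure)
qed

text \<open>The quotient of two independent standard normal variables is Cauchy distributed:
  substituting v = u t and exchanging the integrals leaves the density 1 / (pi (1 + t^2)) on the
  interval from -k to k.\<close>

lemma emeasure_std_normal_pair_cone:
  assumes "k > 0"
  shows "emeasure std_normal_pair {z. \<bar>snd z\<bar> < k * \<bar>fst z\<bar>} = ennreal (2 / pi * arctan k)"
proof -
  let ?n = std_normal_density
  have "emeasure std_normal_pair {z. \<bar>snd z\<bar> < k * \<bar>fst z\<bar>}
      = (\<integral>\<^sup>+z. indicator {z. \<bar>snd z\<bar> < k * \<bar>fst z\<bar>} z \<partial>std_normal_pair)"
    by (rule nn_integral_indicator[symmetric]) (simp add: sets_cone)
  also have "\<dots> = (\<integral>\<^sup>+u. \<integral>\<^sup>+v. indicator {v. \<bar>v\<bar> < k * \<bar>u\<bar>} v \<partial>std_normal_distribution \<partial>std_normal_distribution)"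
  proof (subst std_normal.nn_integral_fst[symmetric])
    have "indicator {z. \<bar>snd z\<bar> < k * \<bar>fst z\<bar>} (u, v) = (indicator {v. \<bar>v\<bar> < k * \<bar>u\<bar>} v :: ennreal)" for u v
      by (simp add: indicator_def)
    then show "(\<integral>\<^sup>+u. \<integral>\<^sup>+v. indicator {z. \<bar>snd z\<bar> < k * \<bar>fst z\<bar>} (u, v) \<partial>std_normal_distribution \<partial>std_normal_distribution)
      = (\<integral>\<^sup>+u. \<integral>\<^sup>+v. indicator {v. \<bar>v\<bar> < k * \<bar>u\<bar>} v \<partial>std_normal_distribution \<partial>std_normal_distribution)"
      by (simp only:)
  qed (simp add: sets_cone)
  also have "\<dots> = (\<integral>\<^sup>+u. ennreal (?n u) * (\<integral>\<^sup>+v. ennreal (?n v) * indicator {v. \<bar>v\<bar> < k * \<bar>u\<bar>} v \<partial>lborel) \<partial>lborel)"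
  proof -
    have "(\<integral>\<^sup>+v. indicator {v. \<bar>v\<bar> < k * \<bar>u\<bar>} v \<partial>std_normal_distribution)
        = (\<integral>\<^sup>+v. ennreal (?n v) * indicator {v. \<bar>v\<bar> < k * \<bar>u\<bar>} v \<partial>lborel)" for u
      by (rule nn_integral_density) measurable
    then show ?thesis
      by (simp only:) (rule nn_integral_density; measurable)
  qed
  also have "\<dots> = (\<integral>\<^sup>+u. \<integral>\<^sup>+t. ennreal (\<bar>u\<bar> * ?n u * ?n (u * t)) * indicator {-k<..<k} t \<partial>lborel \<partial>lborel)"
  \<comment> \<open>The substitution v = u t degenerates at u = 0, a null set.\<close>
  proof (intro nn_integral_cong_AE AE_I[of _ _ "{0}"] subsetI)
    fix u :: real
    assume "u \<in> {x \<in> space lborel.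
      ennreal (?n x) * (\<integral>\<^sup>+v. ennreal (?n v) * indicator {v. \<bar>v\<bar> < k * \<bar>x\<bar>} v \<partial>lborel) \<noteq>
      (\<integral>\<^sup>+t. ennreal (\<bar>x\<bar> * ?n x * ?n (x * t)) * indicator {-k<..<k} t \<partial>lborel)}"
    moreover have "ennreal (?n u) * (\<integral>\<^sup>+v. ennreal (?n v) * indicator {v. \<bar>v\<bar> < k * \<bar>u\<bar>} v \<partial>lborel) =
      (\<integral>\<^sup>+t. ennreal (\<bar>u\<bar> * ?n u * ?n (u * t)) * indicator {-k<..<k} t \<partial>lborel)" if u: "u \<noteq> 0"
    proof -
      have "\<bar>u * t\<bar> < k * \<bar>u\<bar> \<longleftrightarrow> - k < t \<and> t < k" for t
        using u by (auto simp: abs_mult abs_less_iff mult.commute)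
      then have "(\<integral>\<^sup>+v. ennreal (?n v) * indicator {v. \<bar>v\<bar> < k * \<bar>u\<bar>} v \<partial>lborel)
          = ennreal \<bar>u\<bar> * (\<integral>\<^sup>+t. ennreal (?n (u * t)) * indicator {-k<..<k} t \<partial>lborel)"
        using u by (subst nn_integral_real_affine[where c = u and t = 0]) (auto simp: indicator_def)
      then show ?thesis
        by (simp add: nn_integral_cmult[symmetric] ennreal_mult' mult_ac)
    qed
    ultimately show "u \<in> {0}" by auto
  qed auto
  also have "\<dots> = (\<integral>\<^sup>+t. \<integral>\<^sup>+u. ennreal (\<bar>u\<bar> * ?n u * ?n (u * t)) * indicator {-k<..<k} t \<partial>lborel \<partial>lborel)"
    by (rule lborel_pair.Fubini') measurable
  also have "\<dots> = (\<integral>\<^sup>+t. ennreal (1 / pi * (1 / (1 + t\<^sup>2))) * indicator {-k..k} t \<partial>lborel)"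
  \<comment> \<open>The interval is closed at the cost of its two end points, as the fundamental
    theorem is applied to \<open>{-k..k}\<close>.\<close>
  proof (intro nn_integral_cong_AE AE_I[of _ _ "{-k, k}"] subsetI)
    fix t :: real
    assume t: "t \<in> {x \<in> space lborel.
      (\<integral>\<^sup>+u. ennreal (\<bar>u\<bar> * ?n u * ?n (u * x)) * indicator {-k<..<k} x \<partial>lborel) \<noteq>
      ennreal (1 / pi * (1 / (1 + x\<^sup>2))) * indicator {-k..k} x}"
    \<comment> \<open>For fixed \<open>t\<close> the product of the two densities is, up to a
      constant, a centred normal density in \<open>u\<close> with standard deviation
      \<open>s\<close>; the inner integral is its first absolute moment,
      \<open>s * sqrt (2 / pi)\<close>.\<close>
    define s where "s = 1 / sqrt (1 + t\<^sup>2)"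
    have s: "s > 0" "s\<^sup>2 = 1 / (1 + t\<^sup>2)"
      unfolding s_def by (auto simp: add_pos_nonneg power_divide)
    have "\<bar>u\<bar> * ?n u * ?n (u * t) = s / sqrt (2 * pi) * (normal_density 0 s u * \<bar>u\<bar>)" for u
    proof -
      have "u\<^sup>2 / (2 * s\<^sup>2) = u\<^sup>2 / 2 + (u * t)\<^sup>2 / 2"
        unfolding s(2) by (simp add: power_mult_distrib algebra_simps)
      moreover have "sqrt (2 * pi * s\<^sup>2) = sqrt (2 * pi) * s"
        using s(1) by (simp add: real_sqrt_mult)
      ultimately show ?thesis
        using s(1) unfolding normal_density_def
        by (simp add: mult_ac flip: exp_add)
    qed
    moreover have "has_bochner_integral lborel (\<lambda>u. s / sqrt (2 * pi) * (normal_density 0 s u * \<bar>u\<bar>))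
        (s / sqrt (2 * pi) * (s * sqrt (2 / pi)))"
      using normal_moment_abs_odd[OF s(1), of 0 0]
      by (intro has_bochner_integral_mult_right) simp
    ultimately have "(\<integral>\<^sup>+u. ennreal (\<bar>u\<bar> * ?n u * ?n (u * t)) \<partial>lborel)
        = ennreal (s / sqrt (2 * pi) * (s * sqrt (2 / pi)))"
      using s(1) by (simp only:) (subst nn_integral_eq_integral, auto simp: has_bochner_integral_iff)
    also have "s / sqrt (2 * pi) * (s * sqrt (2 / pi)) = s\<^sup>2 / pi"
      by (simp add: real_sqrt_divide real_sqrt_mult power2_eq_square field_simps)
    also have "\<dots> = 1 / pi * (1 / (1 + t\<^sup>2))"
      by (simp add: s(2))
    finally have *: "(\<integral>\<^sup>+u. ennreal (\<bar>u\<bar> * ?n u * ?n (u * t)) \<partial>lborel) = \<dots>" .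
    show "t \<in> {-k, k}"
      by (cases "- k < t \<and> t < k") (use t * in \<open>auto simp: indicator_eq_0_iff\<close>)
  qed (auto simp: emeasure_lborel_countable)
  also have "\<dots> = ennreal (1 / pi * arctan k - 1 / pi * arctan (- k))"
    using assms
    by (intro nn_integral_FTC_Icc) (auto intro!: derivative_eq_intros simp: inverse_eq_divide)
  finally show ?thesis
    by (simp add: arctan_minus field_simps)
qed

text \<open>The product of the signs is the sign of (a u)^2 - (b v)^2, hence the difference of the
  indicators of two complementary cones. Their measures are given by arctan (a / b) and arctan (b /
  a).\<close>

lemma sgn_corr_eq_arcsin:
  assumes "\<bar>c\<bar> < 1"
  shows "sgn_corr c = 2 / pi * arcsin c"
proof -
  define a where "a = sqrt ((1 + c) / 2)"
  define b where "b = sqrt ((1 - c) / 2)"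
  have ab: "0 < a" "0 < b" "a\<^sup>2 = (1 + c) / 2" "b\<^sup>2 = (1 - c) / 2"
    using assms by (auto simp: a_def b_def abs_less_iff)
  define P where "P = (\<lambda>k :: real. {z :: real \<times> real. \<bar>snd z\<bar> < k * \<bar>fst z\<bar>})"
  have meas [measurable]: "P k \<in> sets std_normal_pair" for k
    unfolding P_def by (simp add: sets_cone)
  have P: "measure std_normal_pair (P k) = 2 / pi * arctan k" if "k > 0" for k
    using emeasure_std_normal_pair_cone[OF that] that
    by (simp add: measure_def P_def)
  have sgn: "sgn (a * u + b * v) * sgn (a * u - b * v)
      = indicator (P (a / b)) (u, v) - indicator (P (b / a)) (v, u)" for u v
  proof -
    define D where "D = (a * u)\<^sup>2 - (b * v)\<^sup>2"
    have lt: "x\<^sup>2 < y\<^sup>2 \<longleftrightarrow> \<bar>x\<bar> < \<bar>y\<bar>" for x y :: real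
      using abs_le_square_iff[of y x] by (simp add: not_le[symmetric])
    have "sgn (a * u + b * v) * sgn (a * u - b * v) = sgn D"
      by (simp add: D_def power2_eq_square algebra_simps flip: sgn_mult)
    moreover have "(u, v) \<in> P (a / b) \<longleftrightarrow> 0 < D"
      using ab unfolding P_def D_def diff_gt_0_iff_gt lt by (simp add: abs_mult field_simps)
    moreover have "(v, u) \<in> P (b / a) \<longleftrightarrow> D < 0"
      using ab unfolding P_def D_def diff_less_0_iff_less lt by (simp add: abs_mult field_simps)
    ultimately show ?thesis
      by (simp add: indicator_def sgn_real_def)
  qed
  have int: "integrable std_normal_pair (indicat_real (P k))" for k
    by (rule std_normal_pair.integrable_const_bound[where B = 1]) auto
  have swap: "(\<integral>z. indicat_real (P k) (snd z, fst z) \<partial>std_normal_pair) = measure std_normal_pair (P k)" for k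
    using integral_std_normal_pair_swap[of "indicat_real (P k)"] meas[of k]
    by (simp cong: measurable_cong_sets sets_pair_measure_cong)
  have int': "integrable std_normal_pair (\<lambda>z. indicat_real (P k) (snd z, fst z))" for k
    by (rule std_normal_pair.integrable_const_bound[where B = 1]) auto
  have "sgn_corr c = (\<integral>z. indicat_real (P (a / b)) z - indicat_real (P (b / a)) (snd z, fst z) \<partial>std_normal_pair)"
    unfolding sgn_corr_def a_def[symmetric] b_def[symmetric] sgn by simp
  also have "\<dots> = measure std_normal_pair (P (a / b)) - measure std_normal_pair (P (b / a))"
    using int int' swap by (subst Bochner_Integration.integral_diff) (auto simp: space_pair_measure)
  also have "\<dots> = 2 / pi * (arctan (a / b) - arctan (b / a))"
    using ab by (simp add: P right_diff_distrib)
  also have "arctan (b / a) = pi / 2 - arctan (a / b)"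
    using arctan_inverse[of "a / b"] ab by simp
  \<comment> \<open>With t = arctan (a / b) the angle is 2 t - pi / 2, whose sine is - cos (2 t) =
    (a^2 - b^2) / (a^2 + b^2) = c.\<close>
  also have "arctan (a / b) - (pi / 2 - arctan (a / b)) = arcsin c"
  proof (rule sym, rule arcsin_unique)
    define t where "t = arctan (a / b)"
    have t: "0 < t" "t < pi / 2"
      using ab arctan_ubound[of "a / b"] by (auto simp: t_def)
    then show "- pi / 2 \<le> arctan (a / b) - (pi / 2 - arctan (a / b))"
      "arctan (a / b) - (pi / 2 - arctan (a / b)) \<le> pi / 2"
      by (auto simp flip: t_def)
    have "sin (t - (pi / 2 - t)) = - cos (2 * t)"
      by (simp add: sin_diff cos_diff cos_double sin_cos_eq[symmetric] power2_eq_square algebra_simps)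
    also have "cos (2 * t) = (1 - (tan t)\<^sup>2) / (1 + (tan t)\<^sup>2)"
      using t cos_gt_zero[of t] by (intro cos_tan_half[of t]) auto
    also have "tan t = a / b"
      by (simp add: t_def tan_arctan)
    also have "- ((1 - (a / b)\<^sup>2) / (1 + (a / b)\<^sup>2)) = (a\<^sup>2 - b\<^sup>2) / (a\<^sup>2 + b\<^sup>2)"
      using ab(1,2) by (simp add: power_divide divide_simps) (simp add: field_simps add_pos_pos)
    also have "\<dots> = c"
      by (simp add: ab field_simps)
    finally show "sin (arctan (a / b) - (pi / 2 - arctan (a / b))) = c"
      by (simp add: t_def)
  qed
  finally show ?thesis .
qed

subsection \<open>Lipschitz dependence on the correlation\<close>

text \<open>\<open>pair_weight c\<close> is the density, relative to \<open>std_normal_pair\<close>, of the law of two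
  independent centred normal variables with variances \<open>(1 + c) / 2\<close> and \<open>(1 - c) / 2\<close>.\<close>

definition pair_weight :: "real \<Rightarrow> real \<times> real \<Rightarrow> real" where
  "pair_weight c z = 2 / sqrt (1 - c\<^sup>2) *
     exp ((fst z)\<^sup>2 * (1 / 2 - 1 / (1 + c)) + (snd z)\<^sup>2 * (1 / 2 - 1 / (1 - c)))"

lemma pair_weight_eq:
  assumes "\<bar>c\<bar> < 1"
  shows "pair_weight c (x, y) * (std_normal_density x * std_normal_density y) =
    normal_density 0 (sqrt ((1 + c) / 2)) x * normal_density 0 (sqrt ((1 - c) / 2)) y"
proof -
  have c: "1 + c > 0" "1 - c > 0"
    using assms by (auto simp: abs_less_iff)
  have e: "exp (x\<^sup>2 * (1 / 2 - 1 / (1 + c)) + y\<^sup>2 * (1 / 2 - 1 / (1 - c))) * (exp (- x\<^sup>2 / 2) * exp (- y\<^sup>2 / 2))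
      = exp (- (x\<^sup>2 / (1 + c))) * exp (- (y\<^sup>2 / (1 - c)))"
    unfolding exp_add[symmetric] by (simp add: algebra_simps)
  have s: "2 / sqrt (1 - c\<^sup>2) * (1 / sqrt (2 * pi) * (1 / sqrt (2 * pi)))
      = 1 / sqrt (pi * (1 + c)) * (1 / sqrt (pi * (1 - c)))"
  proof -
    have "1 - c\<^sup>2 = (1 + c) * (1 - c)"
      by (simp add: power2_eq_square algebra_simps)
    moreover have "sqrt (pi * (1 + c)) * sqrt (pi * (1 - c)) = pi * (sqrt (1 + c) * sqrt (1 - c))"
      by (simp add: real_sqrt_mult)
    moreover have "1 / sqrt (2 * pi) * (1 / sqrt (2 * pi)) = 1 / (2 * pi)"
      by simp
    ultimately show ?thesis
      by (simp only: real_sqrt_mult times_divide_times_eq) simp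
  qed
  have "pair_weight c (x, y) * (std_normal_density x * std_normal_density y) =
     (2 / sqrt (1 - c\<^sup>2) * (1 / sqrt (2 * pi) * (1 / sqrt (2 * pi)))) *
     (exp (x\<^sup>2 * (1 / 2 - 1 / (1 + c)) + y\<^sup>2 * (1 / 2 - 1 / (1 - c))) * (exp (- x\<^sup>2 / 2) * exp (- y\<^sup>2 / 2)))"
    unfolding pair_weight_def std_normal_density_def by simp
  also have "\<dots> = 1 / sqrt (pi * (1 + c)) * (1 / sqrt (pi * (1 - c))) *
      (exp (- (x\<^sup>2 / (1 + c))) * exp (- (y\<^sup>2 / (1 - c))))"
    unfolding e s ..
  also have "\<dots> = normal_density 0 (sqrt ((1 + c) / 2)) x * normal_density 0 (sqrt ((1 - c) / 2)) y"
  proof -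
    have "normal_density 0 (sqrt (d / 2)) t = 1 / sqrt (pi * d) * exp (- (t\<^sup>2 / d))" if "d > 0" for d t
      using that unfolding normal_density_def by simp
    from this[OF c(1)] this[OF c(2)] show ?thesis
      by (simp only: mult_ac)
  qed
  finally show ?thesis .
qed

lemma pair_weight_nonneg: "\<bar>c\<bar> < 1 \<Longrightarrow> 0 \<le> pair_weight c z"
  by (simp add: pair_weight_def abs_square_le_1 less_imp_le)

lemma measurable_pair_weight [measurable]: "pair_weight c \<in> borel_measurable (borel \<Otimes>\<^sub>M borel)"
  unfolding pair_weight_def by measurable

lemma integral_std_normal_pair_scale:
  fixes f :: "real \<times> real \<Rightarrow> real"
  assumes "\<bar>c\<bar> < 1" and [measurable]: "f \<in> borel_measurable (borel \<Otimes>\<^sub>M borel)"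
  shows "(\<integral>z. f (sqrt ((1 + c) / 2) * fst z, sqrt ((1 - c) / 2) * snd z) \<partial>std_normal_pair) =
    (\<integral>z. pair_weight c z * f z \<partial>std_normal_pair)"
proof -
  define a where "a = (1 + c) / 2"
  define b where "b = (1 - c) / 2"
  have pos: "a > 0" "b > 0"
    using assms by (auto simp: a_def b_def abs_less_iff)
  have prob: "prob_space (gauss1 a)" "prob_space (gauss1 b)"
    unfolding gauss1_def by (intro std_normal.prob_space_distr; simp)+
  have dens: "(\<integral>z. g z \<partial>density (lborel \<Otimes>\<^sub>M lborel) (\<lambda>(x, y). ennreal (m x) * ennreal (n y)))
      = (\<integral>z. m (fst z) * n (snd z) * g z \<partial>(lborel \<Otimes>\<^sub>M lborel))"
    if [measurable]: "g \<in> borel_measurable (borel \<Otimes>\<^sub>M borel)" "m \<in> borel_measurable borel" "n \<in> borel_measurable borel"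
      and "\<And>x. 0 \<le> m x" "\<And>x. 0 \<le> n x"
    for m n :: "real \<Rightarrow> real" and g :: "real \<times> real \<Rightarrow> real"
  proof -
    have "(\<lambda>(x, y). ennreal (m x) * ennreal (n y)) = (\<lambda>z. ennreal (m (fst z) * n (snd z)))"
      using that by (auto simp: ennreal_mult')
    then show ?thesis
      using that by (simp add: integral_density)
  qed
  interpret G: prob_space "gauss1 b" by (rule prob)
  have "gauss1 a \<Otimes>\<^sub>M gauss1 b = distr std_normal_pair (borel \<Otimes>\<^sub>M borel) (\<lambda>(x, y). (sqrt a * x, sqrt b * y))"
    unfolding gauss1_def
    by (rule pair_measure_distr) (use G.sigma_finite_measure_axioms in \<open>auto simp: gauss1_def\<close>)
  then have "(\<integral>z. f (sqrt a * fst z, sqrt b * snd z) \<partial>std_normal_pair) = (\<integral>z. f z \<partial>(gauss1 a \<Otimes>\<^sub>M gauss1 b))"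
    by (simp add: integral_distr case_prod_beta')
  also have "gauss1 a \<Otimes>\<^sub>M gauss1 b = density (lborel \<Otimes>\<^sub>M lborel)
      (\<lambda>(x, y). ennreal (normal_density 0 (sqrt a) x) * ennreal (normal_density 0 (sqrt b) y))"
    unfolding gauss1_eq_normal_density[OF pos(1)] gauss1_eq_normal_density[OF pos(2)]
    by (rule pair_measure_density)
       (use G.sigma_finite_measure_axioms lborel.sigma_finite_measure_axioms
         in \<open>auto simp: gauss1_eq_normal_density[OF pos(2)]\<close>)
  also have "(\<integral>z. f z \<partial>\<dots>) = (\<integral>z. normal_density 0 (sqrt a) (fst z) * normal_density 0 (sqrt b) (snd z) * f z \<partial>(lborel \<Otimes>\<^sub>M lborel))"
    by (subst dens) auto
  also have "\<dots> = (\<integral>z. std_normal_density (fst z) * std_normal_density (snd z) * (pair_weight c z * f z) \<partial>(lborel \<Otimes>\<^sub>M lborel))"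
    using pair_weight_eq[OF assms(1)] unfolding a_def b_def
    by (intro Bochner_Integration.integral_cong refl) (auto simp: mult_ac split: prod.splits)
  also have "\<dots> = (\<integral>z. pair_weight c z * f z \<partial>density (lborel \<Otimes>\<^sub>M lborel)
      (\<lambda>(x, y). ennreal (std_normal_density x) * ennreal (std_normal_density y)))"
    by (subst dens) auto
  also have "density (lborel \<Otimes>\<^sub>M lborel) (\<lambda>(x, y). ennreal (std_normal_density x) * ennreal (std_normal_density y))
      = std_normal_pair"
    by (rule pair_measure_density[symmetric])
       (use std_normal.sigma_finite_measure_axioms lborel.sigma_finite_measure_axioms in auto)
  finally show ?thesis
    by (simp add: a_def b_def)
qed

text \<open>The variances (1 + t) / 2 and (1 - t) / 2 do not exceed the reference variance 1, so the
  exponent is nonpositive and the exponential at most 1. Differentiating in \<open>t\<close> then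
  costs only negative powers of \<open>\<eta>\<close> and a quadratic polynomial in
  \<open>z\<close>, which is integrable.\<close>

lemma pair_weight_lipschitz:
  assumes "0 < \<eta>"
  obtains C where "\<And>c d z. \<bar>c\<bar> \<le> 1 - \<eta> \<Longrightarrow> \<bar>d\<bar> \<le> 1 - \<eta> \<Longrightarrow>
    \<bar>pair_weight c z - pair_weight d z\<bar> \<le> C * (1 + (fst z)\<^sup>2 + (snd z)\<^sup>2) * \<bar>c - d\<bar>"
proof
  fix c d :: real and z :: "real \<times> real"
  assume cd: "\<bar>c\<bar> \<le> 1 - \<eta>" "\<bar>d\<bar> \<le> 1 - \<eta>"
  define x where "x = (fst z)\<^sup>2"
  define y where "y = (snd z)\<^sup>2"
  have xy: "x \<ge> 0" "y \<ge> 0"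
    by (auto simp: x_def y_def)
  define E where "E = (\<lambda>t. exp (x * (1 / 2 - 1 / (1 + t)) + y * (1 / 2 - 1 / (1 - t))))"
  define D where "D = (\<lambda>t. 2 * (t / (sqrt (1 - t\<^sup>2) * (1 - t\<^sup>2)) * E t
     + 1 / sqrt (1 - t\<^sup>2) * (E t * (x / (1 + t)\<^sup>2 - y / (1 - t)\<^sup>2))))"
  have pw: "pair_weight t z = 2 / sqrt (1 - t\<^sup>2) * E t" for t
    by (simp add: pair_weight_def E_def x_def y_def)
  have bounds: "\<eta> \<le> 1 + t" "\<eta> \<le> 1 - t" "1 + t \<le> 2" "1 - t \<le> 2" "\<eta> \<le> 1 - t\<^sup>2" "\<bar>t\<bar> \<le> 1"
    if "t \<in> {- (1 - \<eta>)..1 - \<eta>}" for t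
  proof -
    show b: "\<eta> \<le> 1 + t" "\<eta> \<le> 1 - t" "1 + t \<le> 2" "1 - t \<le> 2" "\<bar>t\<bar> \<le> 1"
      using that assms by auto
    have "t\<^sup>2 \<le> \<bar>t\<bar>"
      using b(5) mult_left_le[of "\<bar>t\<bar>" "\<bar>t\<bar>"] by (simp add: power2_eq_square)
    then show "\<eta> \<le> 1 - t\<^sup>2"
      using that by (auto simp: abs_if split: if_splits)
  qed
  have deriv: "((\<lambda>t. pair_weight t z) has_field_derivative D t) (at t within {- (1 - \<eta>)..1 - \<eta>})"
    if t: "t \<in> {- (1 - \<eta>)..1 - \<eta>}" for t
  proof -
    have pos: "1 + t > 0" "1 - t > 0" "1 - t\<^sup>2 > 0"
      using bounds[OF t] assms by auto
    have E: "(E has_field_derivative E t * (x / (1 + t)\<^sup>2 - y / (1 - t)\<^sup>2)) (at t within {- (1 - \<eta>)..1 - \<eta>})"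
      unfolding E_def using pos
      by (auto intro!: derivative_eq_intros simp: power2_eq_square algebra_simps)
    have R: "((\<lambda>t. 2 / sqrt (1 - t\<^sup>2)) has_field_derivative 2 * (t / (sqrt (1 - t\<^sup>2) * (1 - t\<^sup>2)))) (at t within {- (1 - \<eta>)..1 - \<eta>})"
      using pos
      by (auto intro!: derivative_eq_intros simp: power2_eq_square divide_simps)
    show ?thesis
      unfolding pw D_def using DERIV_mult[OF R E] by (simp add: algebra_simps)
  qed
  have bound: "norm (D t) \<le> 2 * (1 / (sqrt \<eta> * \<eta>) + 1 / sqrt \<eta> / \<eta>\<^sup>2) * (1 + x + y)"
    if t: "t \<in> {- (1 - \<eta>)..1 - \<eta>}" for t
  proof -
    note b = bounds[OF t]
    have E: "0 \<le> E t" "E t \<le> 1"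
    proof -
      have "1 / 2 \<le> 1 / (1 + t)" "1 / 2 \<le> 1 / (1 - t)"
        using b assms by (intro divide_left_mono; auto)+
      then show "E t \<le> 1"
        unfolding E_def using xy by (auto intro!: add_nonpos_nonpos mult_nonneg_nonpos)
    qed (simp add: E_def)
    have sq: "sqrt \<eta> \<le> sqrt (1 - t\<^sup>2)" "\<eta>\<^sup>2 \<le> (1 + t)\<^sup>2" "\<eta>\<^sup>2 \<le> (1 - t)\<^sup>2"
      using b assms by (auto intro!: power_mono)
    have p1: "\<bar>t / (sqrt (1 - t\<^sup>2) * (1 - t\<^sup>2)) * E t\<bar> \<le> 1 / (sqrt \<eta> * \<eta>) * 1"
      unfolding abs_mult abs_divide using b E sq assms
      by (intro mult_mono frac_le) auto
    have p2: "\<bar>x / (1 + t)\<^sup>2 - y / (1 - t)\<^sup>2\<bar> \<le> (x + y) / \<eta>\<^sup>2"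
    proof -
      have "0 \<le> x / (1 + t)\<^sup>2" "0 \<le> y / (1 - t)\<^sup>2"
        using xy by auto
      moreover have "x / (1 + t)\<^sup>2 \<le> x / \<eta>\<^sup>2" "y / (1 - t)\<^sup>2 \<le> y / \<eta>\<^sup>2"
        using xy sq assms by (intro frac_le; simp)+
      ultimately show ?thesis
        by (auto simp: add_divide_distrib)
    qed
    have p3: "\<bar>1 / sqrt (1 - t\<^sup>2) * (E t * (x / (1 + t)\<^sup>2 - y / (1 - t)\<^sup>2))\<bar> \<le> 1 / sqrt \<eta> * (1 * ((x + y) / \<eta>\<^sup>2))"
      unfolding abs_mult abs_divide using b E sq assms p2[unfolded abs_mult abs_divide]
      by (intro mult_mono frac_le) auto
    have "norm (D t) \<le> 2 * (1 / (sqrt \<eta> * \<eta>) + 1 / sqrt \<eta> / \<eta>\<^sup>2 * (x + y))"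
    proof -
      have "norm (2 * (P + Q)) \<le> 2 * (r + s)" if "\<bar>P\<bar> \<le> r" "\<bar>Q\<bar> \<le> s" for P Q r s :: real
        using that by auto
      moreover have "1 / sqrt \<eta> * (1 * ((x + y) / \<eta>\<^sup>2)) = 1 / sqrt \<eta> / \<eta>\<^sup>2 * (x + y)"
        by simp
      ultimately show ?thesis
        using p1 p3 unfolding D_def mult_1_right by metis
    qed
    also have "\<dots> \<le> 2 * (1 / (sqrt \<eta> * \<eta>) * (1 + x + y) + 1 / sqrt \<eta> / \<eta>\<^sup>2 * (1 + x + y))"
      using xy assms
      by (intro mult_left_mono add_mono) (auto simp: field_simps)
    finally show ?thesis
      by (simp add: distrib_right distrib_left)
  qed
  have "norm (pair_weight c z - pair_weight d z) \<le> 2 * (1 / (sqrt \<eta> * \<eta>) + 1 / sqrt \<eta> / \<eta>\<^sup>2) * (1 + x + y) * norm (c - d)"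
  proof (rule field_differentiable_bound[OF _ deriv bound])
    show "convex {- (1 - \<eta>)..1 - \<eta>}"
      by simp
    show "c \<in> {- (1 - \<eta>)..1 - \<eta>}" "d \<in> {- (1 - \<eta>)..1 - \<eta>}"
      using cd by (simp_all add: abs_le_iff)
  qed
  then show "\<bar>pair_weight c z - pair_weight d z\<bar> \<le> 2 * (1 / (sqrt \<eta> * \<eta>) + 1 / sqrt \<eta> / \<eta>\<^sup>2) * (1 + (fst z)\<^sup>2 + (snd z)\<^sup>2) * \<bar>c - d\<bar>"
    unfolding x_def y_def real_norm_def .
qed

lemma tanh_mult_at_top_tendsto_sgn:
  fixes r :: "nat \<Rightarrow> real"
  assumes "filterlim r at_top sequentially"
  shows "(\<lambda>l. tanh (r l * x)) \<longlonglongrightarrow> sgn x"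
proof (cases x "0 :: real" rule: linorder_cases)
  case less
  have "filterlim (\<lambda>l. r l * x) at_bot sequentially"
    using filterlim_tendsto_neg_mult_at_bot[OF tendsto_const less assms] by (simp add: mult.commute)
  from filterlim_compose[OF tanh_real_at_bot this] show ?thesis
    using less by simp
next
  case greater
  have "filterlim (\<lambda>l. r l * x) at_top sequentially"
    using filterlim_tendsto_pos_mult_at_top[OF tendsto_const greater assms] by (simp add: mult.commute)
  from filterlim_compose[OF tanh_real_at_top this] show ?thesis
    using greater by simp
qed simp

text \<open>After the change of variables only \<open>pair_weight\<close> depends on the correlation, so no derivative
  of \<open>tanh\<close>, whose rescaled slope at the origin blows up with \<open>q\<close>, is needed.\<close>

lemma Wt_tanh_minus_sgn_corr_lipschitz:
  fixes q :: "nat \<Rightarrow> real"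
  assumes "0 < \<eta>" and q: "filterlim q at_top sequentially" "\<And>l. 0 \<le> q l"
  obtains \<epsilon> where "\<epsilon> \<longlonglongrightarrow> 0"
    "\<And>l c d. \<bar>c\<bar> \<le> 1 - \<eta> \<Longrightarrow> \<bar>d\<bar> \<le> 1 - \<eta> \<Longrightarrow>
      \<bar>(Wt tanh (q l) (c * q l) - sgn_corr c) - (Wt tanh (q l) (d * q l) - sgn_corr d)\<bar> \<le> \<epsilon> l * \<bar>c - d\<bar>"
proof -
  obtain C where C: "\<And>c d z. \<bar>c\<bar> \<le> 1 - \<eta> \<Longrightarrow> \<bar>d\<bar> \<le> 1 - \<eta> \<Longrightarrow>
    \<bar>pair_weight c z - pair_weight d z\<bar> \<le> C * (1 + (fst z)\<^sup>2 + (snd z)\<^sup>2) * \<bar>c - d\<bar>"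
    using pair_weight_lipschitz[OF \<open>0 < \<eta>\<close>] by blast
  \<comment> \<open>The correlation has disappeared from \<open>F\<close>. It tends to 0 at every
    point, also on the two diagonals, where both products vanish; dominated convergence with
    majorant \<open>2 * \<bar>M z\<bar>\<close> makes the Lipschitz constant tend to 0.\<close>
  define F where "F = (\<lambda>l z. tanh (sqrt (q l) * (fst z + snd z)) * tanh (sqrt (q l) * (fst z - snd z))
    - sgn (fst z + snd z) * sgn (fst z - snd z))"
  have F_meas [measurable]: "F l \<in> borel_measurable (borel \<Otimes>\<^sub>M borel)" for l
    unfolding F_def by measurable
  have F_bound: "\<bar>F l z\<bar> \<le> 2" for l z
  proof -
    have "\<bar>sgn (fst z + snd z) * sgn (fst z - snd z)\<bar> \<le> 1"
      by (auto simp: sgn_real_def)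
    then show ?thesis
      unfolding F_def using abs_tanh_mult_tanh_le_1[of "sqrt (q l) * (fst z + snd z)" "sqrt (q l) * (fst z - snd z)"]
      by linarith
  qed
  have F_lim: "(\<lambda>l. F l z) \<longlonglongrightarrow> 0" for z
  proof -
    have "filterlim (\<lambda>l. sqrt (q l)) at_top sequentially"
      using filterlim_compose[OF sqrt_at_top q(1)] .
    from tendsto_mult[OF tanh_mult_at_top_tendsto_sgn[OF this] tanh_mult_at_top_tendsto_sgn[OF this]]
    show ?thesis
      unfolding F_def by (auto intro: LIM_zero)
  qed
  define M where "M = (\<lambda>z :: real \<times> real. C * (1 + (fst z)\<^sup>2 + (snd z)\<^sup>2))"
  have M_int: "integrable std_normal_pair M"
  proof -
    have "integrable std_normal_distribution (\<lambda>x. x\<^sup>2)"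
      using integrable_std_normal_distribution_moment[of 2] by simp
    then have "integrable std_normal_pair (\<lambda>z. (fst z)\<^sup>2)" "integrable std_normal_pair (\<lambda>z. (snd z)\<^sup>2)"
      using std_normal_pair.Fubini_integrable[of "\<lambda>z. (fst z)\<^sup>2"]
        std_normal_pair.Fubini_integrable[of "\<lambda>z. (snd z)\<^sup>2"] std_normal.prob_space
      by auto
    then show ?thesis
      unfolding M_def by auto
  qed
  have FM_int: "integrable std_normal_pair (\<lambda>z. \<bar>F l z\<bar> * M z)" for l
  proof (rule Bochner_Integration.integrable_bound[OF integrable_mult_right[OF M_int, of 2]])
    show "AE z in std_normal_pair. norm (\<bar>F l z\<bar> * M z) \<le> norm (2 * M z)"
      using F_bound by (auto simp: abs_mult intro!: mult_right_mono)
  qed (auto simp: M_def)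
  define \<epsilon> where "\<epsilon> = (\<lambda>l. \<integral>z. \<bar>F l z\<bar> * M z \<partial>std_normal_pair)"
  show thesis
  proof
    have "(\<lambda>l. \<integral>z. \<bar>F l z\<bar> * M z \<partial>std_normal_pair) \<longlonglongrightarrow> (\<integral>z. 0 \<partial>std_normal_pair)"
    proof (rule integral_dominated_convergence)
      show "integrable std_normal_pair (\<lambda>z. 2 * \<bar>M z\<bar>)"
        using M_int by auto
      have "(\<lambda>l. \<bar>F l z\<bar> * M z) \<longlonglongrightarrow> 0" for z
        using F_lim[of z] by (intro tendsto_mult_left_zero tendsto_rabs_zero)
      then show "AE z in std_normal_pair. (\<lambda>l. \<bar>F l z\<bar> * M z) \<longlonglongrightarrow> 0"
        by simp
      show "AE z in std_normal_pair. norm (\<bar>F l z\<bar> * M z) \<le> 2 * \<bar>M z\<bar>" for l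
        using F_bound by (auto simp: abs_mult intro!: mult_right_mono)
    qed (auto simp: M_def)
    then show "\<epsilon> \<longlonglongrightarrow> 0"
      by (simp add: \<epsilon>_def)
  next
    fix l c d
    assume c: "\<bar>c\<bar> \<le> 1 - \<eta>" and d: "\<bar>d\<bar> \<le> 1 - \<eta>"
    have int: "integrable std_normal_pair (\<lambda>z. pair_weight t z * F l z)" if "\<bar>t\<bar> < 1" for t
    proof -
      have "integrable std_normal_pair (pair_weight t)"
      proof (rule integrableI_bounded)
        show "pair_weight t \<in> borel_measurable std_normal_pair"
          by simp
        have "pair_weight t z \<le> 2 / sqrt (1 - t\<^sup>2)" for z
        proof -
          have "1 / 2 \<le> 1 / (1 + t)" "1 / 2 \<le> 1 / (1 - t)"
            using that by (intro divide_left_mono; auto simp: abs_less_iff)+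
          then have "(fst z)\<^sup>2 * (1 / 2 - 1 / (1 + t)) + (snd z)\<^sup>2 * (1 / 2 - 1 / (1 - t)) \<le> 0"
            by (intro add_nonpos_nonpos mult_nonneg_nonpos) auto
          then show ?thesis
            unfolding pair_weight_def using that
            by (intro mult_left_le) (auto simp: abs_square_le_1)
        qed
        then have "(\<integral>\<^sup>+z. norm (pair_weight t z) \<partial>std_normal_pair) \<le> (\<integral>\<^sup>+z. ennreal (2 / sqrt (1 - t\<^sup>2)) \<partial>std_normal_pair)"
          using pair_weight_nonneg[OF that] by (intro nn_integral_mono ennreal_leI) simp
        also have "\<dots> < \<infinity>"
          by (simp add: std_normal_pair.emeasure_space_1 ennreal_mult_less_top)
        finally show "(\<integral>\<^sup>+z. norm (pair_weight t z) \<partial>std_normal_pair) < \<infinity>" .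
      qed
      then have "integrable std_normal_pair (\<lambda>z. 2 * pair_weight t z)"
        by auto
      then show ?thesis
      proof (rule Bochner_Integration.integrable_bound)
        show "AE z in std_normal_pair. norm (pair_weight t z * F l z) \<le> norm (2 * pair_weight t z)"
          using F_bound pair_weight_nonneg[OF that]
          by (auto simp: abs_mult mult.commute[of 2] intro!: mult_left_mono)
      qed simp
    qed
    have eq: "Wt tanh (q l) (t * q l) - sgn_corr t = (\<integral>z. pair_weight t z * F l z \<partial>std_normal_pair)"
      if t: "\<bar>t\<bar> < 1" for t
    proof -
      have s: "sqrt ((q l + t * q l) / 2) = sqrt (q l) * sqrt ((1 + t) / 2)"
        "sqrt ((q l - t * q l) / 2) = sqrt (q l) * sqrt ((1 - t) / 2)"
        unfolding real_sqrt_mult[symmetric] by (simp_all add: algebra_simps)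
      have "(\<integral>z. pair_weight t z * F l z \<partial>std_normal_pair)
          = (\<integral>z. F l (sqrt ((1 + t) / 2) * fst z, sqrt ((1 - t) / 2) * snd z) \<partial>std_normal_pair)"
        by (rule integral_std_normal_pair_scale[symmetric]) (use t in auto)
      also have "\<dots> = (\<integral>z. tanh (sqrt ((q l + t * q l) / 2) * fst z + sqrt ((q l - t * q l) / 2) * snd z) *
            tanh (sqrt ((q l + t * q l) / 2) * fst z - sqrt ((q l - t * q l) / 2) * snd z)
          - sgn (sqrt ((1 + t) / 2) * fst z + sqrt ((1 - t) / 2) * snd z) *
            sgn (sqrt ((1 + t) / 2) * fst z - sqrt ((1 - t) / 2) * snd z) \<partial>std_normal_pair)"
        unfolding F_def s fst_conv snd_conv distrib_left right_diff_distrib mult.assoc ..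
      also have "\<dots> = Wt tanh (q l) (t * q l) - sgn_corr t"
        unfolding Wt_tanh_eq sgn_corr_def
        by (intro Bochner_Integration.integral_diff integrable_tanh_mult_tanh_diff
            std_normal_pair.integrable_const_bound[where B = 1]) (auto simp: abs_mult sgn_real_def)
      finally show ?thesis ..
    qed
    have lt: "\<bar>c\<bar> < 1" "\<bar>d\<bar> < 1"
      using c d \<open>0 < \<eta>\<close> by auto
    have "\<bar>(Wt tanh (q l) (c * q l) - sgn_corr c) - (Wt tanh (q l) (d * q l) - sgn_corr d)\<bar>
        = \<bar>\<integral>z. pair_weight c z * F l z - pair_weight d z * F l z \<partial>std_normal_pair\<bar>"
      using eq int lt by simp
    also have "\<dots> \<le> (\<integral>z. \<bar>F l z\<bar> * M z * \<bar>c - d\<bar> \<partial>std_normal_pair)"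
    proof (intro integral_abs_bound[THEN order.trans] integral_mono integrable_mult_left integrable_abs
        Bochner_Integration.integrable_diff FM_int int lt)
      fix z
      have "\<bar>pair_weight c z * F l z - pair_weight d z * F l z\<bar> = \<bar>F l z\<bar> * \<bar>pair_weight c z - pair_weight d z\<bar>"
        unfolding abs_mult[symmetric] by (simp add: right_diff_distrib mult.commute)
      also have "\<dots> \<le> \<bar>F l z\<bar> * (M z * \<bar>c - d\<bar>)"
        using C[OF c d, of z] by (intro mult_left_mono) (auto simp: M_def)
      finally show "\<bar>pair_weight c z * F l z - pair_weight d z * F l z\<bar> \<le> \<bar>F l z\<bar> * M z * \<bar>c - d\<bar>"
        by (simp add: mult.assoc)
    qed
    also have "\<dots> = \<epsilon> l * \<bar>c - d\<bar>"
      by (simp add: \<epsilon>_def)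
    finally show "\<bar>(Wt tanh (q l) (c * q l) - sgn_corr c) - (Wt tanh (q l) (d * q l) - sgn_corr d)\<bar>
      \<le> \<epsilon> l * \<bar>c - d\<bar>" .
  qed
qed

subsection \<open>The fixed point equation\<close>

text \<open>At the fixed angle \<theta>, 1 - \<delta> equals (1 - cos \<theta>) / (\<theta> sin
  \<theta>), so this is the bound \<delta> < 1 / 2.\<close>

lemma two_minus_two_cos_gt:
  fixes x :: real
  assumes "0 < x" "x \<le> pi / 2"
  shows "x * sin x < 2 * (1 - cos x)"
proof -
  have lt: "t * cos t < sin t" if "0 < t" "t \<le> x" for t :: real
  proof -
    have "0 * cos 0 - sin (0::real) > t * cos t - sin t"
    proof (rule DERIV_neg_imp_decreasing_open[OF that(1)])
      show "\<exists>y. ((\<lambda>x. x * cos x - sin x) has_real_derivative y) (at s) \<and> y < 0" if "0 < s" "s < t" for s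
        using that \<open>t \<le> x\<close> assms sin_gt_zero[of s]
        by (intro exI[of _ "- s * sin s"]) (auto intro!: derivative_eq_intros)
    qed (auto intro!: continuous_intros)
    then show ?thesis by simp
  qed
  have "2 * (1 - cos 0) - 0 * sin (0::real) < 2 * (1 - cos x) - x * sin x"
  proof (rule DERIV_pos_imp_increasing_open[OF assms(1)])
    show "\<exists>y. ((\<lambda>x. 2 * (1 - cos x) - x * sin x) has_real_derivative y) (at t) \<and> y > 0" if "0 < t" "t < x" for t
      using that lt[of t]
      by (intro exI[of _ "sin t - t * cos t"]) (auto intro!: derivative_eq_intros)
  qed (auto intro!: continuous_intros)
  then show ?thesis by simp
qed

lemma one_minus_cos_lt:
  fixes x :: real
  assumes "0 < x" "x \<le> pi / 2"
  shows "1 - cos x < x * sin x"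
proof -
  have "0 * sin 0 + cos (0::real) < x * sin x + cos x"
  proof (rule DERIV_pos_imp_increasing_open[OF assms(1)])
    show "\<exists>y. ((\<lambda>x. x * sin x + cos x) has_real_derivative y) (at t) \<and> y > 0" if "0 < t" "t < x" for t
      using that assms cos_gt_zero[of t]
      by (intro exI[of _ "t * cos t"]) (auto intro!: derivative_eq_intros)
  qed (auto intro!: continuous_intros)
  then show ?thesis by simp
qed

text \<open>The fixed point equation says that this quotient takes the value 2 \<alpha> / pi at the
  angle, so strict monotonicity is uniqueness among the angles up to pi / 2. The numerator of the
  derivative is positive by \<open>one_minus_cos_lt\<close>.\<close>

lemma one_minus_cos_quotient_strict_mono:
  fixes x y :: real
  assumes "0 < x" "x < y" "y \<le> pi / 2"
  shows "(1 - cos x) / x < (1 - cos y) / y"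
proof (rule DERIV_pos_imp_increasing_open[OF assms(2)])
  show "\<exists>d. ((\<lambda>x. (1 - cos x) / x) has_real_derivative d) (at t) \<and> d > 0" if "x < t" "t < y" for t
    using that assms one_minus_cos_lt[of t]
    by (intro exI[of _ "(t * sin t - (1 - cos t)) / (t * t)"])
       (auto intro!: derivative_eq_intros divide_pos_pos simp: mult.commute)
qed (use assms in \<open>auto intro!: continuous_intros\<close>)

text \<open>The quotient (1 - cos x) / x is not monotone on all of this range; the reflection at pi
  / 2 reduces the claim to the monotone part. It excludes fixed points in the open interval from -1
  to 0 even for \<alpha> = 1.\<close>

lemma one_minus_cos_gt_linear:
  fixes x :: real
  assumes "pi / 2 < x" "x < pi"
  shows "2 / pi * x < 1 - cos x"
proof -
  define y where "y = pi - x"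
  have y: "0 < y" "y < pi / 2" "cos x = - cos y" "x = pi - y"
    using assms by (auto simp: y_def cos_diff)
  have "(1 - cos y) / y < (1 - cos (pi / 2)) / (pi / 2)"
    using y by (intro one_minus_cos_quotient_strict_mono) auto
  then have "1 - cos y < 2 / pi * y"
    using y by (simp add: field_simps)
  then show ?thesis
    using y by (simp add: right_diff_distrib)
qed

text \<open>In terms of y = x / 2 this is tan y / y \<le> 4 / pi, and tan y / y increases up to y =
  pi / 4. At the fixed angle it reads \<alpha> \<le> sin \<theta>, which is the lower end 1 - 2 / pi
  of the range of \<delta>.\<close>

lemma pi_one_minus_cos_le:
  fixes x :: real
  assumes "0 < x" "x \<le> pi / 2"
  shows "pi * (1 - cos x) \<le> 2 * x * sin x"
proof -
  define y where "y = x / 2"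
  have y: "0 < y" "y \<le> pi / 4" "x = 2 * y"
    using assms by (auto simp: y_def)
  have "tan y / y \<le> tan (pi / 4) / (pi / 4)"
  proof (rule DERIV_nonneg_imp_nondecreasing[OF y(2)])
    fix t assume t: "y \<le> t" "t \<le> pi / 4"
    have c: "cos t > 0"
      using t y pi_gt_zero by (intro cos_gt_zero) linarith+
    have "sin t * cos t \<le> t * 1"
      using t y c sin_le_zero[of t] pi_gt_zero sin_x_le_x[of t] by (intro mult_mono) auto
    then have "0 \<le> (t - sin t * cos t) / (t * t * (cos t)\<^sup>2)"
      by simp
    moreover have "((\<lambda>y. tan y / y) has_real_derivative (t - sin t * cos t) / (t * t * (cos t)\<^sup>2)) (at t)"
    proof -
      have "t * (cos t * cos t) + t * (sin t * sin t) = t * ((cos t)\<^sup>2 + (sin t)\<^sup>2)"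
        by (simp only: power2_eq_square distrib_left)
      then have "t * (cos t * cos t) + t * (sin t * sin t) = t"
        by simp
      then show ?thesis
        using c t y
        by (auto intro!: derivative_eq_intros simp: tan_def field_simps power2_eq_square)
    qed
    ultimately show "\<exists>d. ((\<lambda>y. tan y / y) has_real_derivative d) (at t) \<and> 0 \<le> d"
      by blast
  qed
  then have "tan y * pi \<le> 4 * y"
    using y by (simp add: tan_45 field_simps)
  moreover have s: "sin y > 0" "cos y > 0"
    using y pi_gt_zero by (intro sin_gt_zero cos_gt_zero; linarith)+
  ultimately have "sin y * pi \<le> 4 * y * cos y"
    by (simp add: tan_def field_simps)
  then have "2 * sin y * (sin y * pi) \<le> 2 * sin y * (4 * y * cos y)"
    using s by (intro mult_left_mono) auto
  moreover have "1 - cos x = 2 * (sin y)\<^sup>2" "sin x = 2 * sin y * cos y"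
    by (simp_all add: y cos_double_sin sin_double)
  ultimately show ?thesis
    by (simp only: y(3) power2_eq_square mult_ac)
qed

text \<open>The mean-field drift of \<open>e\<close>; the angle \<open>arccos t\<close> turns its zeros into the solutions of
  \<open>1 - cos \<theta> = \<alpha> * (2 / pi) * \<theta>\<close>.\<close>

definition corr_drift :: "real \<Rightarrow> real \<Rightarrow> real" where
  "corr_drift \<alpha> t = \<alpha> * (2 / pi * arcsin t) + (1 - \<alpha>) - t"

lemma corr_drift_cos:
  assumes "0 \<le> \<theta>" "\<theta> \<le> pi"
  shows "corr_drift \<alpha> (cos \<theta>) = 1 - cos \<theta> - \<alpha> * (2 / pi * \<theta>)"
proof -
  have "arcsin (cos \<theta>) = pi / 2 - \<theta>"
    using assms by (intro arcsin_unique) (auto simp: sin_diff)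
  then show ?thesis
    by (simp add: corr_drift_def right_diff_distrib)
qed

text \<open>Since \<open>arccos\<close> reverses the order, the drift is positive below the root
  exactly because \<open>H\<close> is positive at angles beyond \<theta>, and negative above it
  because \<open>H\<close> is negative at smaller angles.\<close>

lemma corr_drift_root:
  assumes \<alpha>: "0 < \<alpha>" "\<alpha> \<le> 1"
  obtains e where "0 \<le> e" "e < 1" "corr_drift \<alpha> e = 0"
    "\<And>t. -1 < t \<Longrightarrow> t < e \<Longrightarrow> 0 < corr_drift \<alpha> t"
    "\<And>t. e < t \<Longrightarrow> t < 1 \<Longrightarrow> corr_drift \<alpha> t < 0"
    "1 - 2 / pi \<le> 1 - 2 / pi * (1 / sqrt (1 - e\<^sup>2)) * \<alpha>"
    "1 - 2 / pi * (1 / sqrt (1 - e\<^sup>2)) * \<alpha> < 1 / 2"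
proof -
  define H where "H = (\<lambda>\<theta>. 1 - cos \<theta> - \<alpha> * (2 / pi * \<theta>))"
  \<comment> \<open>A left end for the intermediate value theorem: at this angle the linear term of
    \<open>H\<close> equals \<open>\<theta>0 * \<theta>0\<close>, which exceeds
    \<open>1 - cos \<theta>0\<close>.\<close>
  define \<theta>0 where "\<theta>0 = 2 * \<alpha> / pi"
  have \<theta>0: "0 < \<theta>0" "\<theta>0 \<le> pi / 2"
  proof -
    have "2 * \<alpha> / pi \<le> 2 / 2"
      using \<alpha> pi_ge_two by (intro frac_le) auto
    then show "\<theta>0 \<le> pi / 2"
      using pi_ge_two unfolding \<theta>0_def by linarith
  qed (use \<alpha> in \<open>simp add: \<theta>0_def\<close>)
  have "1 - cos \<theta>0 < \<theta>0 * sin \<theta>0"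
    using \<theta>0 by (rule one_minus_cos_lt)
  also have "\<dots> \<le> \<theta>0 * \<theta>0"
    using \<theta>0 by (intro mult_left_mono sin_x_le_x) auto
  finally have "H \<theta>0 \<le> 0"
    by (simp add: H_def \<theta>0_def mult_ac)
  moreover have "0 \<le> H (pi / 2)"
    using \<alpha> by (simp add: H_def)
  moreover have "continuous_on {\<theta>0..pi / 2} H"
    unfolding H_def by (intro continuous_intros)
  ultimately obtain \<theta> where \<theta>: "\<theta>0 \<le> \<theta>" "\<theta> \<le> pi / 2" "H \<theta> = 0"
    using IVT'[of H \<theta>0 0 "pi / 2"] \<theta>0 by auto
  then have pos: "0 < \<theta>"
    using \<theta>0 by simp
  have quot: "(1 - cos \<theta>) / \<theta> = 2 * \<alpha> / pi"
    using \<theta>(3) pos by (simp add: H_def field_simps)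
  have neg: "H x < 0" if "0 < x" "x < \<theta>" for x
  proof -
    have "(1 - cos x) / x < 2 * \<alpha> / pi"
      using one_minus_cos_quotient_strict_mono[of x \<theta>] that \<theta> quot by simp
    then show ?thesis
      using that by (simp add: H_def field_simps)
  qed
  have posH: "0 < H x" if "\<theta> < x" "x < pi" for x
  proof (cases "x \<le> pi / 2")
    case True
    have "2 * \<alpha> / pi < (1 - cos x) / x"
      using one_minus_cos_quotient_strict_mono[of \<theta> x] that pos True quot by simp
    then show ?thesis
      using that pos by (simp add: H_def field_simps)
  next
    case False
    have "\<alpha> * (2 / pi * x) \<le> 1 * (2 / pi * x)"
      using \<alpha> that pos by (intro mult_right_mono) auto
    also have "\<dots> < 1 - cos x"
      using one_minus_cos_gt_linear[of x] that False by simp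
    finally show ?thesis
      by (simp add: H_def)
  qed
  define e where "e = cos \<theta>"
  have drift: "corr_drift \<alpha> t = H (arccos t)" if "-1 \<le> t" "t \<le> 1" for t
    using corr_drift_cos[of "arccos t" \<alpha>] that by (simp add: H_def arccos_lbound arccos_ubound)
  have arccos_e: "arccos e = \<theta>"
    unfolding e_def using pos \<theta> by (intro arccos_cos) auto
  show thesis
  proof
    show e: "0 \<le> e" "e < 1"
      using pos \<theta> cos_monotone_0_pi[of 0 \<theta>] by (auto simp: e_def intro!: cos_ge_zero)
    then show "corr_drift \<alpha> e = 0"
      using drift[of e] \<theta> arccos_e by simp
    show "0 < corr_drift \<alpha> t" if "-1 < t" "t < e" for t
    proof -
      have "arccos e < arccos t" "arccos t < pi"
        using that e arccos_less_arccos[of t e] arccos_less_arccos[of "-1" t] by auto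
      then show ?thesis
        using drift[of t] that e posH arccos_e by simp
    qed
    show "corr_drift \<alpha> t < 0" if "e < t" "t < 1" for t
    proof -
      have "arccos t < arccos e" "0 < arccos t"
        using that e arccos_less_arccos[of e t] arccos_less_arccos[of t 1] by auto
      then show ?thesis
        using drift[of t] that e neg arccos_e by simp
    qed
    have s: "sqrt (1 - e\<^sup>2) = sin \<theta>" "0 < sin \<theta>"
      using pos \<theta> sin_gt_zero[of \<theta>] by (auto simp: e_def sin_squared_eq[symmetric])
    have \<alpha>_eq: "\<alpha> = pi * (1 - cos \<theta>) / (2 * \<theta>)"
      using quot pos by (simp add: field_simps)
    have "\<alpha> \<le> sin \<theta>"
      using pi_one_minus_cos_le[OF pos \<theta>(2)] pos unfolding \<alpha>_eq by (simp add: field_simps)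
    then have "\<alpha> / sin \<theta> \<le> 1"
      using s by simp
    then have "2 / pi * (\<alpha> / sin \<theta>) \<le> 2 / pi * 1"
      by (intro mult_left_mono) auto
    then show "1 - 2 / pi \<le> 1 - 2 / pi * (1 / sqrt (1 - e\<^sup>2)) * \<alpha>"
      by (simp add: s)
    have "2 / pi * (1 / sin \<theta>) * \<alpha> = (1 - cos \<theta>) / (\<theta> * sin \<theta>)"
      unfolding \<alpha>_eq using pos s by (simp add: field_simps)
    also have "\<dots> > 1 / 2"
      using two_minus_two_cos_gt[OF pos \<theta>(2)] pos s by (simp add: field_simps)
    finally show "1 - 2 / pi * (1 / sqrt (1 - e\<^sup>2)) * \<alpha> < 1 / 2"
      by (simp add: s)
  qed
qed

lemma corr_drift_has_derivative:
  assumes "\<bar>t\<bar> < 1"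
  shows "(corr_drift \<alpha> has_real_derivative - (1 - 2 / pi * (1 / sqrt (1 - t\<^sup>2)) * \<alpha>)) (at t)"
  unfolding corr_drift_def using assms
  by (auto intro!: derivative_eq_intros simp: abs_less_iff divide_inverse mult_ac)

text \<open>Caratheodory's form of the derivative divides out the root. The quotient
  \<open>- g t\<close> is the contraction rate at correlation \<open>t\<close>: its minimum over a
  compact interval gives convergence, and its value at \<open>e\<close> the sharp exponent.\<close>

lemma corr_drift_factor:
  assumes "0 \<le> e" "e < 1" "corr_drift \<alpha> e = 0"
    and up: "\<And>t. -1 < t \<Longrightarrow> t < e \<Longrightarrow> 0 < corr_drift \<alpha> t"
    and down: "\<And>t. e < t \<Longrightarrow> t < 1 \<Longrightarrow> corr_drift \<alpha> t < 0"
    and \<delta>: "0 < 1 - 2 / pi * (1 / sqrt (1 - e\<^sup>2)) * \<alpha>"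
  obtains g where "\<And>t. corr_drift \<alpha> t = g t * (t - e)" "continuous_on {-1<..<1} g"
    "g e = - (1 - 2 / pi * (1 / sqrt (1 - e\<^sup>2)) * \<alpha>)" "\<And>t. \<bar>t\<bar> < 1 \<Longrightarrow> g t < 0"
proof -
  have "(corr_drift \<alpha> has_real_derivative - (1 - 2 / pi * (1 / sqrt (1 - e\<^sup>2)) * \<alpha>)) (at e)"
    using assms by (intro corr_drift_has_derivative) auto
  then obtain g where g: "\<And>t. corr_drift \<alpha> t - corr_drift \<alpha> e = g t * (t - e)" "isCont g e"
      "g e = - (1 - 2 / pi * (1 / sqrt (1 - e\<^sup>2)) * \<alpha>)"
    unfolding CARAT_DERIV by blast
  have eq: "corr_drift \<alpha> t = g t * (t - e)" for t
    using g(1)[of t] assms(3) by simp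
  show thesis
  proof
    show "continuous_on {-1<..<1} g"
    proof (intro continuous_at_imp_continuous_on ballI)
      fix t :: real
      assume t: "t \<in> {-1<..<1}"
      show "isCont g t"
      proof (cases "t = e")
        case False
        have "isCont (corr_drift \<alpha>) t"
          using t by (intro DERIV_isCont[OF corr_drift_has_derivative]) auto
        then have "isCont (\<lambda>s. corr_drift \<alpha> s / (s - e)) t"
          using False by (intro continuous_intros) auto
        moreover have "eventually (\<lambda>s. corr_drift \<alpha> s / (s - e) = g s) (nhds t)"
        proof -
          have "eventually (\<lambda>s. s \<in> - {e}) (nhds t)"
            using False by (intro eventually_nhds_in_open) auto
          then show ?thesis
            by eventually_elim (simp add: eq)
        qed
        ultimately show ?thesis
          by (simp add: isCont_cong)
      qed (use g in simp)
    qed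
    show "g t < 0" if "\<bar>t\<bar> < 1" for t
    proof (cases t e rule: linorder_cases)
      case less
      then show ?thesis
        using up[of t] that eq[of t] by (auto simp: zero_less_mult_iff)
    next
      case equal
      then show ?thesis
        using g(3) \<delta> by simp
    next
      case greater
      then show ?thesis
        using down[of t] that eq[of t] by (auto simp: mult_less_0_iff)
    qed
  qed (use eq g in auto)
qed

subsection \<open>Recurrences along a slowly increasing sequence\<close>

text \<open>Along an increasing sequence \<open>p\<close>, the relation \<open>x (Suc l) = (1 - k * rel_step p l) * x l\<close>
  is the discrete analogue of \<open>dx/dp = - k * x / p\<close>, whose solutions are multiples of \<open>p powr - k\<close>.\<close>

definition rel_step :: "(nat \<Rightarrow> real) \<Rightarrow> nat \<Rightarrow> real" where
  "rel_step p l = 1 - p l / p (Suc l)"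

locale slowly_increasing =
  fixes p :: "nat \<Rightarrow> real"
  assumes p_pos: "0 < p l"
    and p_incr: "p l \<le> p (Suc l)"
    and p_at_top: "filterlim p at_top sequentially"
    and rel_step_lim: "rel_step p \<longlonglongrightarrow> 0"
begin

lemma rel_step_bounds: "0 \<le> rel_step p l" "rel_step p l < 1"
  using p_pos[of l] p_pos[of "Suc l"] p_incr[of l] by (auto simp: rel_step_def)

lemma powr_Suc: "p (Suc l) powr - \<kappa> = (1 - rel_step p l) powr \<kappa> * p l powr - \<kappa>"
  using p_pos[of l] p_pos[of "Suc l"]
  by (simp add: rel_step_def powr_divide powr_minus divide_simps)

lemma powr_neg_tendsto_0: "0 < \<kappa> \<Longrightarrow> (\<lambda>l. p l powr - \<kappa>) \<longlonglongrightarrow> 0"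
  using tendsto_neg_powr[OF _ p_at_top] by simp

text \<open>To first order (1 - r) powr \<kappa> is 1 - \<kappa> r; as the relative steps tend to 0,
  a strictly larger linear rate \<open>k\<close> eventually absorbs the higher order terms.\<close>

lemma eventually_one_minus_le_powr:
  assumes "0 \<le> \<kappa>" "\<kappa> < k"
  shows "eventually (\<lambda>l. 1 - k * rel_step p l \<le> (1 - rel_step p l) powr \<kappa>) sequentially"
proof -
  have "(\<lambda>l. \<kappa> / (1 - rel_step p l)) \<longlonglongrightarrow> \<kappa> / (1 - 0)"
    by (intro tendsto_intros rel_step_lim) auto
  then have "eventually (\<lambda>l. \<kappa> / (1 - rel_step p l) < k) sequentially"
    using assms by (intro order_tendstoD) auto
  then show ?thesis
  proof eventually_elim
    case (elim l)
    define x where "x = rel_step p l"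
    have x: "0 \<le> x" "x < 1"
      using rel_step_bounds by (auto simp: x_def)
    have "ln (1 / (1 - x)) \<le> 1 / (1 - x) - 1"
      using x by (intro ln_le_minus_one) auto
    then have "- (x / (1 - x)) \<le> ln (1 - x)"
      using x by (simp add: ln_div field_simps)
    then have "\<kappa> * - (x / (1 - x)) \<le> \<kappa> * ln (1 - x)"
      using assms by (intro mult_left_mono) auto
    moreover have "\<kappa> / (1 - x) * x \<le> k * x"
      using elim x by (intro mult_right_mono) (auto simp: x_def)
    ultimately have "1 - k * x \<le> 1 + \<kappa> * ln (1 - x)"
      by simp
    also have "\<dots> \<le> exp (\<kappa> * ln (1 - x))"
      by (rule exp_ge_add_one_self)
    also have "\<dots> = (1 - x) powr \<kappa>"
      using x by (simp add: powr_def)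
    finally show ?case
      by (simp add: x_def)
  qed
qed

lemma eventually_powr_le_one_minus:
  assumes "0 \<le> k" "k < \<eta>"
  shows "eventually (\<lambda>l. (1 - rel_step p l) powr \<eta> \<le> 1 - k * rel_step p l) sequentially"
proof -
  have "(\<lambda>l. k * \<eta> * rel_step p l) \<longlonglongrightarrow> k * \<eta> * 0"
    by (intro tendsto_intros rel_step_lim)
  then have "eventually (\<lambda>l. k * \<eta> * rel_step p l < \<eta> - k) sequentially"
    using assms by (intro order_tendstoD) auto
  then show ?thesis
  proof eventually_elim
    case (elim l)
    define x where "x = rel_step p l"
    have x: "0 \<le> x" "x < 1"
      using rel_step_bounds by (auto simp: x_def)
    have "(1 - x) powr \<eta> = exp (\<eta> * ln (1 - x))"
      using x by (simp add: powr_def)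
    also have "\<dots> \<le> exp (- (\<eta> * x))"
      using ln_le_minus_one[of "1 - x"] x assms mult_left_mono[of "ln (1 - x)" "- x" \<eta>] by simp
    also have "\<dots> \<le> 1 / (1 + \<eta> * x)"
      using exp_ge_add_one_self[of "\<eta> * x"] x assms
      by (simp add: exp_minus inverse_eq_divide add_pos_nonneg frac_le)
    also have "\<dots> \<le> 1 - k * x"
    proof -
      have "k * \<eta> * x * x \<le> (\<eta> - k) * x"
        using elim x by (intro mult_right_mono) (auto simp: x_def)
      then have "1 \<le> (1 - k * x) * (1 + \<eta> * x)"
        by (simp add: algebra_simps)
      then show ?thesis
        using x assms by (simp add: divide_le_eq add_pos_nonneg)
    qed
    finally show ?case
      by (simp add: x_def)
  qed
qed

text \<open>\<open>M * p l powr - \<kappa>\<close> is a supersolution. Half of the gap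
  \<open>k - \<kappa>\<close> pays for the perturbation, which is negligible against
  \<open>p l powr - \<kappa>\<close> because \<kappa> < 1 / 2; the remaining rate \<open>k'\<close>
  still exceeds \<kappa> and pays for passing from the linear factor to the power.\<close>

lemma powr_decay:
  assumes "0 \<le> \<kappa>" "\<kappa> < k" "\<kappa> < 1 / 2" "0 \<le> C"
    and rec: "eventually (\<lambda>l. x (Suc l) \<le> (1 - k * rel_step p l) * x l
      + rel_step p l * (C * p l powr - (1 / 2))) sequentially"
  obtains M where "eventually (\<lambda>l. x l \<le> M * p l powr - \<kappa>) sequentially"
proof -
  define k' where "k' = (k + \<kappa>) / 2"
  have k': "\<kappa> < k'"
    using assms by (simp add: k'_def)
  have "eventually (\<lambda>l. k * rel_step p l < 1) sequentially"
  proof -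
    have "(\<lambda>l. k * rel_step p l) \<longlonglongrightarrow> k * 0"
      by (intro tendsto_intros rel_step_lim)
    then show ?thesis
      by (intro order_tendstoD) auto
  qed
  moreover have "eventually (\<lambda>l. C * p l powr - (1 / 2 - \<kappa>) < (k - \<kappa>) / 2) sequentially"
  proof -
    have "(\<lambda>l. C * p l powr - (1 / 2 - \<kappa>)) \<longlonglongrightarrow> C * 0"
      using assms by (intro tendsto_intros powr_neg_tendsto_0) auto
    then show ?thesis
      using assms by (intro order_tendstoD) auto
  qed
  ultimately have "eventually (\<lambda>l. k * rel_step p l < 1 \<and> C * p l powr - (1 / 2 - \<kappa>) < (k - \<kappa>) / 2
      \<and> 1 - k' * rel_step p l \<le> (1 - rel_step p l) powr \<kappa>
      \<and> x (Suc l) \<le> (1 - k * rel_step p l) * x l + rel_step p l * (C * p l powr - (1 / 2))) sequentially"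
    using rec eventually_one_minus_le_powr[OF assms(1) k'] by eventually_elim simp
  then obtain L where L: "\<And>l. L \<le> l \<Longrightarrow> k * rel_step p l < 1 \<and> C * p l powr - (1 / 2 - \<kappa>) < (k - \<kappa>) / 2
      \<and> 1 - k' * rel_step p l \<le> (1 - rel_step p l) powr \<kappa>
      \<and> x (Suc l) \<le> (1 - k * rel_step p l) * x l + rel_step p l * (C * p l powr - (1 / 2))"
    unfolding eventually_sequentially by blast
  \<comment> \<open>The second argument starts the induction; \<open>1 \<le> M\<close> lets the
    perturbation be absorbed by a multiple of \<open>M * P\<close>.\<close>
  define M where "M = max 1 (x L / p L powr - \<kappa>)"
  have "x l \<le> M * p l powr - \<kappa>" if "L \<le> l" for l
    using that
  proof (induction l rule: dec_induct)
    case base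
    have "x L = x L / p L powr - \<kappa> * p L powr - \<kappa>"
      using p_pos[of L] by simp
    also have "\<dots> \<le> M * p L powr - \<kappa>"
      by (intro mult_right_mono) (auto simp: M_def)
    finally show ?case .
  next
    case (step l)
    note l = L[OF step(1)]
    define r where "r = rel_step p l"
    define P where "P = p l powr - \<kappa>"
    have r: "0 \<le> r" and P: "0 \<le> P" and M: "1 \<le> M"
      using rel_step_bounds by (auto simp: r_def P_def M_def)
    have half: "p l powr - (1 / 2) = p l powr - (1 / 2 - \<kappa>) * P"
      unfolding P_def powr_add[symmetric] by simp
    have "x (Suc l) \<le> (1 - k * r) * x l + r * (C * p l powr - (1 / 2))"
      using l by (simp add: r_def)
    also have "\<dots> \<le> (1 - k * r) * (M * P) + r * ((k - \<kappa>) / 2 * (M * P))"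
    proof (intro add_mono mult_left_mono r)
      show "x l \<le> M * P"
        using step by (simp add: P_def)
      show "0 \<le> 1 - k * r"
        using l by (simp add: r_def)
      have "C * p l powr - (1 / 2 - \<kappa>) * (1 * P) \<le> (k - \<kappa>) / 2 * (M * P)"
        using l assms P M by (intro mult_mono) auto
      then show "C * p l powr - (1 / 2) \<le> (k - \<kappa>) / 2 * (M * P)"
        unfolding half by (simp only: mult.assoc mult_1_left)
    qed
    also have "\<dots> = (1 - k' * r) * (M * P)"
      by (simp add: k'_def field_simps)
    also have "\<dots> \<le> (1 - r) powr \<kappa> * (M * P)"
      using l P M by (intro mult_right_mono) (auto simp: r_def)
    also have "\<dots> = M * p (Suc l) powr - \<kappa>"
      by (simp add: powr_Suc r_def P_def)
    finally show ?case .
  qed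
  then show thesis
    by (intro that) (auto simp: eventually_sequentially)
qed

text \<open>The counterpart with a subsolution. \<open>L\<close> is fixed before \<open>x\<close>,
  \<open>m\<close> and \<open>n\<close>: the bound may then start at any late time at which it
  happens to hold, with a constant \<open>m\<close> that depends on this time.\<close>

lemma powr_lower_bound_propagates:
  assumes "0 \<le> k" "k < \<eta>"
  obtains L where "\<forall>x m. \<forall>n\<ge>L. 0 < m \<longrightarrow>
    (\<forall>l\<ge>n. (1 - k * rel_step p l) * x l
       - rel_step p l * ((\<eta> - k) / 2 * (m * p l powr - \<eta>)) \<le> x (Suc l)) \<longrightarrow>
    m * p n powr - \<eta> \<le> x n \<longrightarrow> (\<forall>l\<ge>n. m * p l powr - \<eta> \<le> x l)"
proof -
  define k' where "k' = (k + \<eta>) / 2"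
  have k': "0 \<le> k'" "k' < \<eta>"
    using assms by (auto simp: k'_def)
  have "(\<lambda>l. k * rel_step p l) \<longlonglongrightarrow> k * 0"
    by (intro tendsto_intros rel_step_lim)
  then have "eventually (\<lambda>l. k * rel_step p l < 1) sequentially"
    by (intro order_tendstoD) auto
  then have "eventually (\<lambda>l. k * rel_step p l < 1
      \<and> (1 - rel_step p l) powr \<eta> \<le> 1 - k' * rel_step p l) sequentially"
    using eventually_powr_le_one_minus[OF k'] by eventually_elim simp
  then obtain L where L: "\<And>l. L \<le> l \<Longrightarrow> k * rel_step p l < 1
      \<and> (1 - rel_step p l) powr \<eta> \<le> 1 - k' * rel_step p l"
    unfolding eventually_sequentially by blast
  show thesis
  proof (rule that, intro allI impI)
    fix x :: "nat \<Rightarrow> real" and m :: real and n l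
    assume n: "L \<le> n" and m: "0 < m"
      and rec: "\<forall>l\<ge>n. (1 - k * rel_step p l) * x l
       - rel_step p l * ((\<eta> - k) / 2 * (m * p l powr - \<eta>)) \<le> x (Suc l)"
      and base: "m * p n powr - \<eta> \<le> x n" and "n \<le> l"
    from \<open>n \<le> l\<close> show "m * p l powr - \<eta> \<le> x l"
    proof (induction l rule: dec_induct)
      case base
      then show ?case by (rule \<open>m * p n powr - \<eta> \<le> x n\<close>)
    next
      case (step l)
      define r where "r = rel_step p l"
      define P where "P = m * p l powr - \<eta>"
      have P: "0 \<le> P"
        using m by (simp add: P_def)
      have l: "k * r < 1" "(1 - r) powr \<eta> \<le> 1 - k' * r"
        using L[of l] n step by (auto simp: r_def)
      have "m * p (Suc l) powr - \<eta> = (1 - r) powr \<eta> * P"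
        by (simp add: powr_Suc r_def P_def)
      also have "\<dots> \<le> (1 - k' * r) * P"
        using l P by (intro mult_right_mono)
      also have "\<dots> = (1 - k * r) * P - r * ((\<eta> - k) / 2 * P)"
        by (simp add: k'_def field_simps)
      also have "\<dots> \<le> (1 - k * r) * x l - r * ((\<eta> - k) / 2 * P)"
        using step l by (intro diff_right_mono mult_left_mono) (auto simp: P_def)
      also have "\<dots> \<le> x (Suc l)"
        using rec step by (simp add: r_def P_def)
      finally show ?case .
    qed
  qed
qed

end

text \<open>The function m p is a subsolution: when s reaches m p, its increment is at least
  \<kappa> sqrt m, while m p grows by at most m M. The former wins as soon as sqrt m \<le> \<kappa>
  / M, so a small constant m always works; an increment linear in s / p would not allow
  this.\<close>

lemma linear_growth_of_sqrt_increments: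
  fixes p s :: "nat \<Rightarrow> real"
  assumes "0 < \<kappa>" "0 < M" "\<And>l. 0 < p l" "\<And>l. p (Suc l) \<le> p l + M" "0 < s L"
    and rec: "\<And>l. L \<le> l \<Longrightarrow> s l + \<kappa> * sqrt (s l / p l) \<le> s (Suc l)"
  obtains m where "0 < m" "\<And>l. L \<le> l \<Longrightarrow> m * p l \<le> s l"
proof
  define m where "m = min (s L / p L) ((\<kappa> / M)\<^sup>2)"
  show "0 < m"
    using assms by (simp add: m_def)
  have "sqrt m \<le> \<kappa> / M"
    using assms by (intro real_le_lsqrt) (auto simp: m_def)
  then have "sqrt m * (sqrt m * M) \<le> \<kappa> / M * (sqrt m * M)"
    using assms \<open>0 < m\<close> by (intro mult_right_mono) auto
  moreover have "sqrt m * (sqrt m * M) = m * M"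
    using \<open>0 < m\<close> by (simp flip: mult.assoc)
  ultimately have "m * M \<le> \<kappa> * sqrt m"
    using assms by simp
  fix l
  assume "L \<le> l"
  then show "m * p l \<le> s l"
  proof (induction l rule: dec_induct)
    case base
    have "m * p L \<le> s L / p L * p L"
      using assms(3)[of L] by (intro mult_right_mono) (auto simp: m_def)
    then show ?case
      using assms(3)[of L] by simp
  next
    case (step l)
    have "m * p (Suc l) \<le> m * p l + m * M"
      using assms(4)[of l] \<open>0 < m\<close> mult_left_mono[of "p (Suc l)" "p l + M" m] by (simp add: distrib_left)
    also have "\<dots> \<le> s l + \<kappa> * sqrt m"
      using step \<open>m * M \<le> \<kappa> * sqrt m\<close> by simp
    also have "\<dots> \<le> s l + \<kappa> * sqrt (s l / p l)"
      using step assms(1) assms(3)[of l] by (simp add: field_simps)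
    also have "\<dots> \<le> s (Suc l)"
      using rec step by simp
    finally show ?case .
  qed
qed

subsection \<open>The mean-field recurrences\<close>

locale tanh_frn =
  fixes \<sigma>\<^sub>v \<sigma>\<^sub>a \<sigma>\<^sub>w \<sigma>\<^sub>b p0 :: real
  assumes \<sigma>\<^sub>v_pos: "0 < \<sigma>\<^sub>v" and \<sigma>\<^sub>a_nonneg: "0 \<le> \<sigma>\<^sub>a" and \<sigma>\<^sub>w_pos: "0 < \<sigma>\<^sub>w"
    and \<sigma>\<^sub>b_nonneg: "0 \<le> \<sigma>\<^sub>b" and p0_pos: "0 < p0"
begin

definition p :: "nat \<Rightarrow> real" where
  "p = frn_p tanh \<sigma>\<^sub>v \<sigma>\<^sub>a \<sigma>\<^sub>w \<sigma>\<^sub>b p0"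

definition \<gamma> :: "real \<Rightarrow> nat \<Rightarrow> real" where
  "\<gamma> = frn_gamma tanh \<sigma>\<^sub>v \<sigma>\<^sub>a \<sigma>\<^sub>w \<sigma>\<^sub>b p0"

text \<open>\<open>q l\<close> and \<open>\<nu> x l\<close> are the paper's \<open>q\<close> and \<open>\<lambda>\<close> at layer \<open>l + 1\<close>.\<close>

definition q :: "nat \<Rightarrow> real" where
  "q l = \<sigma>\<^sub>w\<^sup>2 * p l + \<sigma>\<^sub>b\<^sup>2"

definition \<nu> :: "real \<Rightarrow> nat \<Rightarrow> real" where
  "\<nu> x l = \<sigma>\<^sub>w\<^sup>2 * \<gamma> x l + \<sigma>\<^sub>b\<^sup>2"

definition e :: "real \<Rightarrow> nat \<Rightarrow> real" where
  "e x l = \<gamma> x l / p l"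

definition c :: "real \<Rightarrow> nat \<Rightarrow> real" where
  "c x l = \<nu> x l / q l"

text \<open>The limit of the increments of \<open>p\<close>, because V tends to 1 along
  \<open>q\<close>.\<close>

definition p_slope :: real where
  "p_slope = \<sigma>\<^sub>v\<^sup>2 + \<sigma>\<^sub>a\<^sup>2"

definition q_ratio :: real where
  "q_ratio = \<sigma>\<^sub>w\<^sup>2 + \<sigma>\<^sub>b\<^sup>2 / p0"

lemma p_0: "p 0 = p0" and \<gamma>_0: "\<gamma> x 0 = x"
  by (simp_all add: p_def \<gamma>_def)

lemma p_Suc: "p (Suc l) = p l + (\<sigma>\<^sub>v\<^sup>2 * Vt tanh (q l) + \<sigma>\<^sub>a\<^sup>2)"
  and \<gamma>_Suc: "\<gamma> x (Suc l) = \<gamma> x l + (\<sigma>\<^sub>v\<^sup>2 * Wt tanh (q l) (\<nu> x l) + \<sigma>\<^sub>a\<^sup>2)"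
  by (simp_all add: p_def \<gamma>_def q_def \<nu>_def frn_q_def)

lemma Vt_nonneg: "0 \<le> Vt tanh x"
  by (simp add: Vt_def)

lemma p_mono: "p l \<le> p (Suc l)"
  using Vt_nonneg[of "q l"] by (simp add: p_Suc)

lemma p_ge: "p0 \<le> p l"
proof (induction l)
  case (Suc l)
  then show ?case
    using p_mono[of l] by simp
qed (simp add: p_0)

lemma p_gt_0: "0 < p l"
  using p_ge[of l] p0_pos by simp

lemma p_slope_pos: "0 < p_slope" and q_ratio_pos: "0 < q_ratio"
  using \<sigma>\<^sub>v_pos \<sigma>\<^sub>w_pos p0_pos by (auto simp: p_slope_def q_ratio_def intro: add_pos_nonneg)

lemma p_Suc_le: "p (Suc l) \<le> p l + p_slope"
  using Vt_tanh_le_1[of "q l"] mult_left_mono[of "Vt tanh (q l)" 1 "\<sigma>\<^sub>v\<^sup>2"]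
  by (simp add: p_Suc p_slope_def)

lemma q_ge: "\<sigma>\<^sub>w\<^sup>2 * p l \<le> q l"
  by (simp add: q_def)

lemma q_gt_0: "0 < q l"
  using p_gt_0[of l] \<sigma>\<^sub>w_pos by (auto simp: q_def intro: add_pos_nonneg)

lemma q_le: "q l \<le> q_ratio * p l"
proof -
  have "\<sigma>\<^sub>b\<^sup>2 / p0 * p0 \<le> \<sigma>\<^sub>b\<^sup>2 / p0 * p l"
    using p_ge[of l] p0_pos by (intro mult_left_mono) auto
  then show ?thesis
    using p0_pos by (simp add: q_def q_ratio_def distrib_right)
qed

text \<open>A gap that stays above \<open>r\<^sub>0\<close> keeps the factor \<open>tanh\<close>
  bounded below, and only the square root survives. The free covariance \<open>x\<close> allows
  three uses: \<open>\<nu>\<close> for p - \<gamma>, its negative for p + \<gamma>, and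
  \<open>- q l\<close> for the growth of \<open>p\<close> itself.\<close>

lemma Wt_gap:
  assumes "0 < r\<^sub>0"
  obtains \<kappa> where "0 < \<kappa>"
    "\<And>l x r. \<bar>x\<bar> \<le> q l \<Longrightarrow> r\<^sub>0 \<le> r \<Longrightarrow> \<sigma>\<^sub>w\<^sup>2 * r \<le> q l - x \<Longrightarrow>
      \<kappa> * sqrt (r / p l) \<le> \<sigma>\<^sub>v\<^sup>2 * (Vt tanh (q l) - Wt tanh (q l) x)"
proof -
  obtain \<kappa>\<^sub>0 where \<kappa>\<^sub>0: "0 < \<kappa>\<^sub>0" "\<And>q \<nu>. \<bar>\<nu>\<bar> \<le> q \<Longrightarrow> 0 < q \<Longrightarrow>
      \<kappa>\<^sub>0 * (tanh (sqrt ((q - \<nu>) / 2) / 2))\<^sup>2 * sqrt ((q - \<nu>) / q) \<le> Vt tanh q - Wt tanh q \<nu>"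
    using Vt_minus_Wt_tanh_ge by blast
  define T where "T = (tanh (sqrt (\<sigma>\<^sub>w\<^sup>2 * r\<^sub>0 / 2) / 2))\<^sup>2"
  have T: "0 < T"
    using assms \<sigma>\<^sub>w_pos by (simp add: T_def)
  show thesis
  proof
    show "0 < \<sigma>\<^sub>v\<^sup>2 * (\<kappa>\<^sub>0 * T * sqrt (\<sigma>\<^sub>w\<^sup>2 / q_ratio))"
      using \<kappa>\<^sub>0 T \<sigma>\<^sub>v_pos \<sigma>\<^sub>w_pos q_ratio_pos by simp
    fix l x r
    assume x: "\<bar>x\<bar> \<le> q l" and r: "r\<^sub>0 \<le> r" and le: "\<sigma>\<^sub>w\<^sup>2 * r \<le> q l - x"
    have "\<sigma>\<^sub>w\<^sup>2 * r\<^sub>0 \<le> \<sigma>\<^sub>w\<^sup>2 * r"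
      using r by (intro mult_left_mono) auto
    then have "T \<le> (tanh (sqrt ((q l - x) / 2) / 2))\<^sup>2"
      unfolding T_def using le assms by (intro power_mono) auto
    moreover have "sqrt (\<sigma>\<^sub>w\<^sup>2 / q_ratio) * sqrt (r / p l) \<le> sqrt ((q l - x) / q l)"
    proof -
      have "\<sigma>\<^sub>w\<^sup>2 * r / (q_ratio * p l) \<le> (q l - x) / q l"
        using abs_le_D1[OF x] le q_le[of l] q_gt_0[of l]
        by (intro frac_le) simp_all
      then show ?thesis
        by (simp flip: real_sqrt_mult)
    qed
    ultimately have "\<kappa>\<^sub>0 * T * (sqrt (\<sigma>\<^sub>w\<^sup>2 / q_ratio) * sqrt (r / p l))
        \<le> \<kappa>\<^sub>0 * (tanh (sqrt ((q l - x) / 2) / 2))\<^sup>2 * sqrt ((q l - x) / q l)"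
      using \<kappa>\<^sub>0 T r assms p_gt_0[of l] q_ratio_pos
      by (intro mult_mono) auto
    also have "\<dots> \<le> Vt tanh (q l) - Wt tanh (q l) x"
      using \<kappa>\<^sub>0(2) x q_gt_0 by blast
    finally have "\<sigma>\<^sub>v\<^sup>2 * (\<kappa>\<^sub>0 * T * (sqrt (\<sigma>\<^sub>w\<^sup>2 / q_ratio) * sqrt (r / p l)))
        \<le> \<sigma>\<^sub>v\<^sup>2 * (Vt tanh (q l) - Wt tanh (q l) x)"
      by (intro mult_left_mono) auto
    then show "\<sigma>\<^sub>v\<^sup>2 * (\<kappa>\<^sub>0 * T * sqrt (\<sigma>\<^sub>w\<^sup>2 / q_ratio)) * sqrt (r / p l)
        \<le> \<sigma>\<^sub>v\<^sup>2 * (Vt tanh (q l) - Wt tanh (q l) x)"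
      by (simp only: mult.assoc)
  qed
qed

text \<open>By oddness V (q) - W (q, -q) is twice V (q), so the gap estimate at the opposite extreme
  bounds V itself from below.\<close>

lemma p_Suc_ge:
  obtains k where "0 < k" "\<And>l. p l + k \<le> p (Suc l)"
proof -
  obtain \<kappa> where \<kappa>: "0 < \<kappa>" "\<And>l x r. \<bar>x\<bar> \<le> q l \<Longrightarrow> p0 \<le> r \<Longrightarrow> \<sigma>\<^sub>w\<^sup>2 * r \<le> q l - x \<Longrightarrow>
      \<kappa> * sqrt (r / p l) \<le> \<sigma>\<^sub>v\<^sup>2 * (Vt tanh (q l) - Wt tanh (q l) x)"
    using Wt_gap[OF p0_pos] by blast
  show thesis
  proof
    show "0 < \<kappa> / 2"
      using \<kappa> by simp
    fix l
    have "\<kappa> \<le> \<sigma>\<^sub>v\<^sup>2 * (Vt tanh (q l) - Wt tanh (q l) (- q l))"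
      using \<kappa>(2)[of "- q l" l "p l"] p_ge[of l] q_ge[of l] q_gt_0[of l] p_gt_0[of l] by simp
    also have "\<dots> = 2 * (\<sigma>\<^sub>v\<^sup>2 * Vt tanh (q l))"
      by (simp add: Wt_tanh_minus Wt_tanh_diag_eq_Vt)
    finally have "\<kappa> / 2 \<le> \<sigma>\<^sub>v\<^sup>2 * Vt tanh (q l)" by simp
    then show "p l + \<kappa> / 2 \<le> p (Suc l)"
      unfolding p_Suc using zero_le_power2[of \<sigma>\<^sub>a] by linarith
  qed
qed

lemma p_linear: obtains k where "0 < k" "\<And>l. k * real l \<le> p l"
proof -
  obtain k where k: "0 < k" "\<And>l. p l + k \<le> p (Suc l)"
    using p_Suc_ge by blast
  have "k * real l \<le> p l" for l
  proof (induction l)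
    case (Suc l)
    then show ?case
      using k(2)[of l] by (simp add: distrib_left)
  qed (use p_gt_0[of 0] in simp)
  then show thesis
    using k that by blast
qed

lemma p_le_linear: "p l \<le> p0 + p_slope * real l"
proof (induction l)
  case (Suc l)
  then show ?case
    using p_Suc_le[of l] by (simp add: distrib_left)
qed (simp add: p_0)

lemma p_bigtheta: "p \<in> \<Theta>(\<lambda>l. real l)"
proof -
  obtain k where k: "0 < k" "\<And>l. k * real l \<le> p l"
    using p_linear by blast
  have "eventually (\<lambda>l. k * norm (real l) \<le> norm (p l) \<and> norm (p l) \<le> (p0 + p_slope) * norm (real l)) sequentially"
    using eventually_ge_at_top[of 1]
  proof eventually_elim
    case (elim l)
    have "p0 * 1 \<le> p0 * real l"
      using elim p0_pos by (intro mult_left_mono) auto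
    then show ?case
      using k(2)[of l] p_le_linear[of l] p_gt_0[of l] by (simp add: distrib_right)
  qed
  then show ?thesis
    using k p_slope_pos p0_pos by (intro bigthetaI'[of k "p0 + p_slope"]) auto
qed

lemma p_filterlim: "filterlim p at_top sequentially"
proof -
  obtain k where k: "0 < k" "\<And>l. k * real l \<le> p l"
    using p_linear by blast
  have "filterlim (\<lambda>l. k * real l) at_top sequentially"
    using k by (intro filterlim_tendsto_pos_mult_at_top[OF tendsto_const _ filterlim_real_sequentially])
  then show ?thesis
    by (rule filterlim_at_top_mono) (use k in auto)
qed

lemma rel_step_p_eq: "rel_step p l = (p (Suc l) - p l) / p (Suc l)"
  using p_gt_0[of "Suc l"] by (simp add: rel_step_def diff_divide_distrib)

lemma rel_step_p_tendsto_0: "rel_step p \<longlonglongrightarrow> 0"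
proof (rule tendsto_sandwich[of "\<lambda>_. 0" _ _ "\<lambda>l. p_slope / p l"])
  show "(\<lambda>l. p_slope / p l) \<longlonglongrightarrow> 0"
    using p_filterlim by (intro tendsto_divide_0[OF tendsto_const] filterlim_at_top_imp_at_infinity)
  show "eventually (\<lambda>l. 0 \<le> rel_step p l) sequentially"
    using p_mono p_gt_0 by (simp add: rel_step_def)
  have "rel_step p l \<le> p_slope / p l" for l
    unfolding rel_step_p_eq
    using p_mono[of l] p_gt_0[of l] p_Suc_le[of l] p_slope_pos by (intro frac_le) auto
  then show "eventually (\<lambda>l. rel_step p l \<le> p_slope / p l) sequentially"
    by simp
qed auto

sublocale slowly_increasing p
  by (rule slowly_increasing.intro[OF p_gt_0 p_mono p_filterlim rel_step_p_tendsto_0])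

lemma q_at_top: "filterlim q at_top sequentially"
proof -
  have "filterlim (\<lambda>l. \<sigma>\<^sub>w\<^sup>2 * p l) at_top sequentially"
    using \<sigma>\<^sub>w_pos by (intro filterlim_tendsto_pos_mult_at_top[OF tendsto_const _ p_at_top]) auto
  then show ?thesis
    by (rule filterlim_at_top_mono) (auto simp: q_ge)
qed

lemma abs_\<nu>_le_of_abs_\<gamma>_le:
  assumes "\<bar>\<gamma> x l\<bar> \<le> p l"
  shows "\<bar>\<nu> x l\<bar> \<le> q l"
proof -
  have "\<bar>\<nu> x l\<bar> \<le> \<sigma>\<^sub>w\<^sup>2 * \<bar>\<gamma> x l\<bar> + \<sigma>\<^sub>b\<^sup>2"
    unfolding \<nu>_def by (metis abs_mult abs_power2 abs_triangle_ineq)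
  also have "\<dots> \<le> q l"
    using assms by (simp add: q_def mult_left_mono)
  finally show ?thesis .
qed

lemma abs_\<gamma>_le:
  assumes "\<bar>x\<bar> \<le> p0"
  shows "\<bar>\<gamma> x l\<bar> \<le> p l"
proof (induction l)
  case (Suc l)
  have "\<bar>\<gamma> x (Suc l)\<bar> \<le> \<bar>\<gamma> x l\<bar> + (\<sigma>\<^sub>v\<^sup>2 * \<bar>Wt tanh (q l) (\<nu> x l)\<bar> + \<sigma>\<^sub>a\<^sup>2)"
    unfolding \<gamma>_Suc
    by (intro order.trans[OF abs_triangle_ineq] add_mono order_refl) (simp_all add: abs_mult)
  also have "\<dots> \<le> p l + (\<sigma>\<^sub>v\<^sup>2 * Vt tanh (q l) + \<sigma>\<^sub>a\<^sup>2)"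
    using Suc Wt_tanh_le_Vt[OF abs_\<nu>_le_of_abs_\<gamma>_le[OF Suc]] by (intro add_mono mult_left_mono) auto
  finally show ?case
    by (simp add: p_Suc)
qed (use assms in \<open>simp add: p_0 \<gamma>_0\<close>)

lemma abs_\<nu>_le: "\<bar>x\<bar> \<le> p0 \<Longrightarrow> \<bar>\<nu> x l\<bar> \<le> q l"
  by (rule abs_\<nu>_le_of_abs_\<gamma>_le[OF abs_\<gamma>_le])

lemma p_minus_\<gamma>_ge:
  assumes "\<bar>x\<bar> \<le> p0" "x < p0"
  obtains m where "0 < m" "\<And>l. m * p l \<le> p l - \<gamma> x l"
proof -
  define s where "s = (\<lambda>l. p l - \<gamma> x l)"
  have Suc: "s (Suc l) = s l + \<sigma>\<^sub>v\<^sup>2 * (Vt tanh (q l) - Wt tanh (q l) (\<nu> x l))" for l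
    by (simp add: s_def p_Suc \<gamma>_Suc algebra_simps)
  have mono: "s l \<le> s (Suc l)" for l
    unfolding Suc using abs_le_D1[OF Wt_tanh_le_Vt[OF abs_\<nu>_le[OF assms(1)]], of l] by simp
  \<comment> \<open>Monotonicity provides the constant lower bound that \<open>Wt_gap\<close> asks
    for.\<close>
  have ge: "s 0 \<le> s l" for l
    by (rule lift_Suc_mono_le[of s, OF mono]) simp
  have s0: "0 < s 0"
    using assms by (simp add: s_def p_0 \<gamma>_0)
  obtain \<kappa> where \<kappa>: "0 < \<kappa>" "\<And>l x r. \<bar>x\<bar> \<le> q l \<Longrightarrow> s 0 \<le> r \<Longrightarrow> \<sigma>\<^sub>w\<^sup>2 * r \<le> q l - x \<Longrightarrow>
      \<kappa> * sqrt (r / p l) \<le> \<sigma>\<^sub>v\<^sup>2 * (Vt tanh (q l) - Wt tanh (q l) x)"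
    using Wt_gap[OF s0] by blast
  have rec: "s l + \<kappa> * sqrt (s l / p l) \<le> s (Suc l)" for l
  proof -
    have "\<sigma>\<^sub>w\<^sup>2 * s l \<le> q l - \<nu> x l"
      by (simp add: s_def q_def \<nu>_def right_diff_distrib)
    from \<kappa>(2)[OF abs_\<nu>_le[OF assms(1)] ge this] show ?thesis
      unfolding Suc by simp
  qed
  from linear_growth_of_sqrt_increments[of \<kappa> p_slope p s 0, OF \<kappa>(1) p_slope_pos p_gt_0 p_Suc_le s0 rec]
  obtain m where "0 < m" "\<And>l. m * p l \<le> s l"
    by auto
  then show thesis
    using that by (simp add: s_def)
qed

text \<open>The argument for p - \<gamma> with the covariance negated, except at the start: for
  antipodal inputs p + \<gamma> vanishes at index 0, and one layer with a nonzero bias has to make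
  it positive. Hence the bound begins at index 1.\<close>

lemma p_plus_\<gamma>_ge:
  assumes "\<bar>x\<bar> \<le> p0" "\<not> (\<sigma>\<^sub>a = 0 \<and> \<sigma>\<^sub>b = 0 \<and> x = - p0)"
  obtains m where "0 < m" "\<And>l. 1 \<le> l \<Longrightarrow> m * p l \<le> p l + \<gamma> x l"
proof -
  define t where "t = (\<lambda>l. p l + \<gamma> x l)"
  have Suc: "t (Suc l) = t l + \<sigma>\<^sub>v\<^sup>2 * (Vt tanh (q l) - Wt tanh (q l) (- \<nu> x l)) + 2 * \<sigma>\<^sub>a\<^sup>2" for l
    by (simp add: t_def p_Suc \<gamma>_Suc Wt_tanh_minus algebra_simps)
  have gap_nonneg: "0 \<le> \<sigma>\<^sub>v\<^sup>2 * (Vt tanh (q l) - Wt tanh (q l) (- \<nu> x l))" for l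
    using abs_le_D2[OF Wt_tanh_le_Vt[OF abs_\<nu>_le[OF assms(1)]], of l] by (simp add: Wt_tanh_minus)
  have mono: "t l \<le> t (Suc l)" for l
    unfolding Suc using gap_nonneg[of l] by simp
  have ge: "t 1 \<le> t l" if "1 \<le> l" for l
    using mono that by (rule lift_Suc_mono_le)
  have t0: "0 \<le> t 0"
    using assms by (simp add: t_def p_0 \<gamma>_0)
  have t1: "0 < t 1"
  proof (cases "0 < t 0 \<or> 0 < \<sigma>\<^sub>a")
    case True
    then have "0 < t 0 + 2 * \<sigma>\<^sub>a\<^sup>2"
      using t0 by (auto intro: add_nonneg_pos add_pos_nonneg)
    then show ?thesis
      using Suc[of 0] gap_nonneg[of 0] by simp
  next
    case False
    then have "x = - p0" "0 < \<sigma>\<^sub>b\<^sup>2"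
      using assms t0 \<sigma>\<^sub>a_nonneg by (auto simp: t_def p_0 \<gamma>_0)
    \<comment> \<open>For antipodal inputs \<open>q 0 + \<nu> x 0\<close> is twice the squared bias
      deviation \<open>\<sigma>\<^sub>b\<close>; \<open>r\<close> expresses this gap in the units
      used by \<open>Wt_gap\<close>.\<close>
    define r where "r = 2 * \<sigma>\<^sub>b\<^sup>2 / \<sigma>\<^sub>w\<^sup>2"
    have r: "0 < r" "\<sigma>\<^sub>w\<^sup>2 * r = 2 * \<sigma>\<^sub>b\<^sup>2"
      using \<open>0 < \<sigma>\<^sub>b\<^sup>2\<close> \<sigma>\<^sub>w_pos by (auto simp: r_def)
    obtain \<kappa> where \<kappa>: "0 < \<kappa>" "\<And>l x r'. \<bar>x\<bar> \<le> q l \<Longrightarrow> r \<le> r' \<Longrightarrow> \<sigma>\<^sub>w\<^sup>2 * r' \<le> q l - x \<Longrightarrow>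
        \<kappa> * sqrt (r' / p l) \<le> \<sigma>\<^sub>v\<^sup>2 * (Vt tanh (q l) - Wt tanh (q l) x)"
      using Wt_gap[OF r(1)] by blast
    have "\<sigma>\<^sub>w\<^sup>2 * r \<le> q 0 - - \<nu> x 0"
      using r \<open>x = - p0\<close> by (simp add: q_def \<nu>_def p_0 \<gamma>_0)
    then have "\<kappa> * sqrt (r / p 0) \<le> \<sigma>\<^sub>v\<^sup>2 * (Vt tanh (q 0) - Wt tanh (q 0) (- \<nu> x 0))"
      using abs_\<nu>_le[OF assms(1), of 0] by (intro \<kappa>(2)) auto
    moreover have "0 < \<kappa> * sqrt (r / p 0)"
      using \<kappa> r p_gt_0 by simp
    ultimately show ?thesis
      using Suc[of 0] t0 by (simp add: add_nonneg_pos add_pos_nonneg)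
  qed
  obtain \<kappa> where \<kappa>: "0 < \<kappa>" "\<And>l x r. \<bar>x\<bar> \<le> q l \<Longrightarrow> t 1 \<le> r \<Longrightarrow> \<sigma>\<^sub>w\<^sup>2 * r \<le> q l - x \<Longrightarrow>
      \<kappa> * sqrt (r / p l) \<le> \<sigma>\<^sub>v\<^sup>2 * (Vt tanh (q l) - Wt tanh (q l) x)"
    using Wt_gap[OF t1] by blast
  have rec: "t l + \<kappa> * sqrt (t l / p l) \<le> t (Suc l)" if "1 \<le> l" for l
  proof -
    have "\<sigma>\<^sub>w\<^sup>2 * t l \<le> q l - - \<nu> x l"
      by (simp add: t_def q_def \<nu>_def distrib_left)
    then have "\<kappa> * sqrt (t l / p l) \<le> \<sigma>\<^sub>v\<^sup>2 * (Vt tanh (q l) - Wt tanh (q l) (- \<nu> x l))"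
      using abs_\<nu>_le[OF assms(1), of l] ge[OF that] by (intro \<kappa>(2)) simp_all
    then show ?thesis
      unfolding Suc using zero_le_power2[of \<sigma>\<^sub>a] by linarith
  qed
  from linear_growth_of_sqrt_increments[of \<kappa> p_slope p t 1, OF \<kappa>(1) p_slope_pos p_gt_0 p_Suc_le t1 rec]
  obtain m where "0 < m" "\<And>l. 1 \<le> l \<Longrightarrow> m * p l \<le> t l"
    by auto
  then show thesis
    using that by (simp add: t_def)
qed

text \<open>What is left out at the lower end is the bias-free antipodal pair, whose correlation is
  -1 at all layers.\<close>

definition admissible :: "real \<Rightarrow> bool" where
  "admissible x \<longleftrightarrow> \<bar>x\<bar> \<le> p0 \<and> x < p0 \<and> \<not> (\<sigma>\<^sub>a = 0 \<and> \<sigma>\<^sub>b = 0 \<and> x = - p0)"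

lemma correlations_bounded_away:
  assumes "admissible x"
  obtains \<eta> where "0 < \<eta>" "\<And>l. 1 \<le> l \<Longrightarrow> \<bar>e x l\<bar> \<le> 1 - \<eta>" "\<And>l. 1 \<le> l \<Longrightarrow> \<bar>c x l\<bar> \<le> 1 - \<eta>"
proof -
  have x: "\<bar>x\<bar> \<le> p0" "x < p0" "\<not> (\<sigma>\<^sub>a = 0 \<and> \<sigma>\<^sub>b = 0 \<and> x = - p0)"
    using assms by (auto simp: admissible_def)
  obtain m1 where m1: "0 < m1" "\<And>l. m1 * p l \<le> p l - \<gamma> x l"
    using p_minus_\<gamma>_ge[OF x(1,2)] by blast
  obtain m2 where m2: "0 < m2" "\<And>l. 1 \<le> l \<Longrightarrow> m2 * p l \<le> p l + \<gamma> x l"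
    using p_plus_\<gamma>_ge[OF x(1,3)] by blast
  define m where "m = min m1 m2"
  have m: "0 < m" "m * p l \<le> p l - \<gamma> x l" "1 \<le> l \<Longrightarrow> m * p l \<le> p l + \<gamma> x l" for l
  proof -
    show "0 < m"
      using m1 m2 by (simp add: m_def)
    have "m * p l \<le> m1 * p l" "m * p l \<le> m2 * p l"
      using p_gt_0[of l] by (intro mult_right_mono; simp add: m_def)+
    then show "m * p l \<le> p l - \<gamma> x l" "1 \<le> l \<Longrightarrow> m * p l \<le> p l + \<gamma> x l"
      using m1(2)[of l] m2(2)[of l] by auto
  qed
  \<comment> \<open>Transfers the bound from \<open>e\<close> to \<open>c\<close>: the gaps q -
    \<nu> and q + \<nu> are at least \<open>\<sigma>\<^sub>w\<^sup>2 * (m * p l)\<close>, and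
    \<open>q l\<close> is at most \<open>q_ratio * p l\<close>.\<close>
  define m' where "m' = m * \<sigma>\<^sub>w\<^sup>2 / q_ratio"
  have m': "0 < m'" "m' * q l \<le> \<sigma>\<^sub>w\<^sup>2 * (m * p l)" for l
  proof -
    show "0 < m'"
      using m(1) \<sigma>\<^sub>w_pos q_ratio_pos by (simp add: m'_def)
    have "m' * q l \<le> m' * (q_ratio * p l)"
      using \<open>0 < m'\<close> q_le[of l] by (intro mult_left_mono) auto
    then show "m' * q l \<le> \<sigma>\<^sub>w\<^sup>2 * (m * p l)"
      using q_ratio_pos by (simp add: m'_def mult_ac)
  qed
  show thesis
  proof
    show "0 < min m m'"
      using m m' by simp
    fix l :: nat
    assume l: "1 \<le> l"
    have "m \<le> 1 - e x l" "m \<le> 1 + e x l"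
      using m(2)[of l] m(3)[OF l] p_gt_0[of l] by (simp_all add: e_def field_simps)
    then show "\<bar>e x l\<bar> \<le> 1 - min m m'"
      by (auto simp: min_def abs_if)
    have "\<sigma>\<^sub>w\<^sup>2 * (m * p l) \<le> \<sigma>\<^sub>w\<^sup>2 * (p l - \<gamma> x l)" "\<sigma>\<^sub>w\<^sup>2 * (m * p l) \<le> \<sigma>\<^sub>w\<^sup>2 * (p l + \<gamma> x l)"
      using m(2)[of l] m(3)[OF l] by (intro mult_left_mono; simp)+
    then have "m' * q l \<le> q l - \<nu> x l" "m' * q l \<le> q l + \<nu> x l"
      using m'(2)[of l] zero_le_power2[of \<sigma>\<^sub>b]
      unfolding q_def[of l] \<nu>_def distrib_left right_diff_distrib by linarith+
    then have "m' \<le> 1 - c x l" "m' \<le> 1 + c x l"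
      using q_gt_0[of l] by (simp_all add: c_def field_simps)
    then show "\<bar>c x l\<bar> \<le> 1 - min m m'"
      by (auto simp: min_def abs_if)
  qed
qed

end

section \<open>The correlation as a perturbed Euler scheme\<close>

lemma one_minus_square_ge:
  fixes t :: real
  assumes "\<bar>t\<bar> \<le> 1 - \<eta>" "0 \<le> \<eta>"
  shows "\<eta> \<le> 1 - t\<^sup>2"
proof -
  have "\<bar>t\<bar> * \<bar>t\<bar> \<le> \<bar>t\<bar> * 1"
    using assms by (intro mult_left_mono) auto
  then show ?thesis
    using assms by (simp add: power2_eq_square)
qed

lemma arcsin_lipschitz:
  assumes "0 < \<eta>" "\<bar>c\<bar> \<le> 1 - \<eta>" "\<bar>d\<bar> \<le> 1 - \<eta>"
  shows "\<bar>arcsin c - arcsin d\<bar> \<le> 1 / sqrt \<eta> * \<bar>c - d\<bar>"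
proof -
  have "norm (arcsin c - arcsin d) \<le> 1 / sqrt \<eta> * norm (c - d)"
  proof (rule field_differentiable_bound)
    show "convex {- (1 - \<eta>)..1 - \<eta>}"
      by simp
    fix t assume t: "t \<in> {- (1 - \<eta>)..1 - \<eta>}"
    then have t1: "- 1 < t" "t < 1" "\<bar>t\<bar> \<le> 1 - \<eta>"
      using assms by auto
    then show "(arcsin has_field_derivative inverse (sqrt (1 - t\<^sup>2))) (at t within {- (1 - \<eta>)..1 - \<eta>})"
      by (intro DERIV_subset[OF DERIV_arcsin]) auto
    have "sqrt \<eta> \<le> sqrt (1 - t\<^sup>2)"
      using one_minus_square_ge[OF t1(3)] assms by simp
    then show "norm (inverse (sqrt (1 - t\<^sup>2))) \<le> 1 / sqrt \<eta>"
      using assms by (simp add: inverse_eq_divide frac_le abs_of_nonneg)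
  next
    show "c \<in> {- (1 - \<eta>)..1 - \<eta>}" "d \<in> {- (1 - \<eta>)..1 - \<eta>}"
      using assms by (simp_all add: abs_le_iff)
  qed
  then show ?thesis
    by simp
qed

context tanh_frn
begin

definition \<alpha> :: real where
  "\<alpha> = \<sigma>\<^sub>v\<^sup>2 / p_slope"

lemma \<alpha>_bounds: "0 < \<alpha>" "\<alpha> \<le> 1"
  using p_slope_pos \<sigma>\<^sub>v_pos by (auto simp: \<alpha>_def p_slope_def)

lemma corr_drift_eq: "corr_drift \<alpha> t = (\<sigma>\<^sub>v\<^sup>2 * (2 / pi * arcsin t) + \<sigma>\<^sub>a\<^sup>2) / p_slope - t"
proof -
  have "1 - \<alpha> = \<sigma>\<^sub>a\<^sup>2 / p_slope"
    using p_slope_pos by (simp add: \<alpha>_def eq_divide_eq left_diff_distrib) (simp add: p_slope_def)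
  then show ?thesis
    by (simp add: corr_drift_def \<alpha>_def add_divide_distrib)
qed

lemma inverse_sqrt_q_le: "1 / sqrt (q l) \<le> p l powr - (1 / 2) / \<sigma>\<^sub>w"
proof -
  have "\<sigma>\<^sub>w * sqrt (p l) \<le> sqrt (q l)"
    using q_ge[of l] \<sigma>\<^sub>w_pos by (metis real_sqrt_le_iff real_sqrt_mult real_sqrt_unique less_imp_le)
  then have "1 / sqrt (q l) \<le> 1 / (\<sigma>\<^sub>w * sqrt (p l))"
    using \<sigma>\<^sub>w_pos p_gt_0[of l] by (intro divide_left_mono) (auto intro!: mult_pos_pos q_gt_0)
  then show ?thesis
    using p_gt_0[of l] by (simp add: powr_minus powr_half_sqrt divide_simps mult.commute)
qed

lemma inverse_p_le: "1 / p l \<le> p l powr - (1 / 2) / sqrt p0"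
proof -
  have "1 / p l = 1 / sqrt (p l) * (1 / sqrt (p l))"
    using p_gt_0[of l] by simp
  also have "\<dots> \<le> 1 / sqrt (p l) * (1 / sqrt p0)"
    using p_ge[of l] p0_pos p_gt_0[of l] by (intro mult_left_mono divide_left_mono) auto
  also have "\<dots> = p l powr - (1 / 2) / sqrt p0"
    using p_gt_0[of l] by (simp add: powr_minus powr_half_sqrt divide_simps)
  finally show ?thesis .
qed

lemma p_increment_approx:
  "\<bar>p_slope - (p (Suc l) - p l)\<bar> \<le> \<sigma>\<^sub>v\<^sup>2 * (2 * tanh_defect / \<sigma>\<^sub>w) * p l powr - (1 / 2)"
proof -
  have "1 - Vt tanh (q l) \<le> 2 * tanh_defect * (1 / sqrt (q l))"
    using Vt_tanh_ge[OF q_gt_0, of l] by simp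
  also have "\<dots> \<le> 2 * tanh_defect * (p l powr - (1 / 2) / \<sigma>\<^sub>w)"
    using tanh_defect_nonneg by (intro mult_left_mono inverse_sqrt_q_le) auto
  finally have "\<sigma>\<^sub>v\<^sup>2 * (1 - Vt tanh (q l)) \<le> \<sigma>\<^sub>v\<^sup>2 * (2 * tanh_defect * (p l powr - (1 / 2) / \<sigma>\<^sub>w))"
    by (intro mult_left_mono) auto
  moreover have "p_slope - (p (Suc l) - p l) = \<sigma>\<^sub>v\<^sup>2 * (1 - Vt tanh (q l))"
    by (simp add: p_Suc p_slope_def algebra_simps)
  moreover have "0 \<le> \<sigma>\<^sub>v\<^sup>2 * (1 - Vt tanh (q l))"
    using Vt_tanh_le_1 by simp
  ultimately show ?thesis
    by simp
qed

lemma admissible_abs_le: "admissible x \<Longrightarrow> \<bar>x\<bar> \<le> p0"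
  by (simp add: admissible_def)

lemma abs_c_minus_e_le:
  assumes "admissible x"
  shows "\<bar>c x l - e x l\<bar> \<le> 2 * \<sigma>\<^sub>b\<^sup>2 / \<sigma>\<^sub>w\<^sup>2 * (1 / p l)"
proof -
  have \<gamma>: "\<bar>\<gamma> x l\<bar> \<le> p l"
    using assms by (intro abs_\<gamma>_le admissible_abs_le)
  have "c x l - e x l = (\<sigma>\<^sub>b\<^sup>2 * (p l - \<gamma> x l)) / (q l * p l)"
    using q_gt_0[of l] p_gt_0[of l] unfolding c_def e_def
    by (simp add: divide_simps) (simp add: q_def \<nu>_def algebra_simps)
  moreover have "\<bar>(\<sigma>\<^sub>b\<^sup>2 * (p l - \<gamma> x l)) / (q l * p l)\<bar> \<le> (\<sigma>\<^sub>b\<^sup>2 * (2 * p l)) / (\<sigma>\<^sub>w\<^sup>2 * p l * p l)"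
    unfolding abs_divide abs_mult using \<gamma> q_ge[of l] q_gt_0[of l] p_gt_0[of l] \<sigma>\<^sub>w_pos
    by (intro frac_le mult_mono) auto
  moreover have "(\<sigma>\<^sub>b\<^sup>2 * (2 * p l)) / (\<sigma>\<^sub>w\<^sup>2 * p l * p l) = 2 * \<sigma>\<^sub>b\<^sup>2 / \<sigma>\<^sub>w\<^sup>2 * (1 / p l)"
    using p_gt_0[of l] by simp
  ultimately show ?thesis
    by simp
qed

text \<open>The deviation from the Euler step is exactly
  \<open>(d\<gamma> - dp * (X / p_slope)) / p (Suc l)\<close>, where \<open>X\<close> is the
  limiting increment of \<gamma>. As \<open>dp\<close> is bounded below by \<open>k\<close>, an
  error of size p powr - (1 / 2) in the numerator is a multiple of \<open>dp\<close>, and dividing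
  by \<open>p (Suc l)\<close> turns this into a multiple of \<open>rel_step p l\<close>.\<close>

lemma e_Suc_approx:
  assumes "admissible x"
  obtains K where "0 \<le> K" "eventually (\<lambda>l. \<bar>e x (Suc l) - (e x l + rel_step p l * corr_drift \<alpha> (e x l))\<bar>
      \<le> rel_step p l * (K * p l powr - (1 / 2))) sequentially"
proof -
  obtain \<eta> where \<eta>: "0 < \<eta>" "\<And>l. 1 \<le> l \<Longrightarrow> \<bar>e x l\<bar> \<le> 1 - \<eta>" "\<And>l. 1 \<le> l \<Longrightarrow> \<bar>c x l\<bar> \<le> 1 - \<eta>"
    using correlations_bounded_away[OF assms] by blast
  obtain k where k: "0 < k" "\<And>l. p l + k \<le> p (Suc l)"
    using p_Suc_ge by blast
  \<comment> \<open>The three sources of error: \<open>K1\<close> for replacing \<open>tanh\<close>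
    by \<open>sgn\<close>, \<open>K2\<close> for replacing \<open>c\<close> by \<open>e\<close>, and
    \<open>K3\<close> for replacing \<open>dp\<close> by its limit \<open>p_slope\<close>.\<close>
  define K1 where "K1 = 2 * sqrt 2 * tanh_defect / \<sigma>\<^sub>w"
  define K2 where "K2 = 2 / pi * (1 / sqrt \<eta> * (2 * \<sigma>\<^sub>b\<^sup>2 / \<sigma>\<^sub>w\<^sup>2 / sqrt p0))"
  define K3 where "K3 = \<sigma>\<^sub>v\<^sup>2 * (2 * tanh_defect / \<sigma>\<^sub>w)"
  define K where "K = (\<sigma>\<^sub>v\<^sup>2 * (K1 + K2) + K3) / k"
  have K_nonneg: "0 \<le> K1" "0 \<le> K2" "0 \<le> K3" "0 \<le> K"
    using tanh_defect_nonneg \<eta> k \<sigma>\<^sub>w_pos p0_pos by (auto simp: K1_def K2_def K3_def K_def)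
  have "\<bar>e x (Suc l) - (e x l + rel_step p l * corr_drift \<alpha> (e x l))\<bar>
      \<le> rel_step p l * (K * p l powr - (1 / 2))" if l: "1 \<le> l" for l
  proof -
    define P where "P = p l powr - (1 / 2)"
    define S where "S = (\<lambda>t. 2 / pi * arcsin t)"
    define X where "X = \<sigma>\<^sub>v\<^sup>2 * S (e x l) + \<sigma>\<^sub>a\<^sup>2"
    define dp where "dp = p (Suc l) - p l"
    define d\<gamma> where "d\<gamma> = \<gamma> x (Suc l) - \<gamma> x l"
    have P: "0 \<le> P"
      by (simp add: P_def)
    have dp: "k \<le> dp" "0 < dp"
      using k(1) k(2)[of l] by (auto simp: dp_def)
    have cl: "\<nu> x l = c x l * q l"
      using q_gt_0[of l] by (simp add: c_def)
    have "\<bar>Wt tanh (q l) (\<nu> x l) - S (c x l)\<bar> \<le> 2 * sqrt 2 * tanh_defect * (1 / sqrt (q l))"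
      using Wt_tanh_approx[OF q_gt_0, of "c x l" l] sgn_corr_eq_arcsin[of "c x l"] \<eta>(1) \<eta>(3)[OF l]
      by (simp add: S_def cl)
    also have "\<dots> \<le> 2 * sqrt 2 * tanh_defect * (P / \<sigma>\<^sub>w)"
      unfolding P_def using tanh_defect_nonneg by (intro mult_left_mono inverse_sqrt_q_le) auto
    finally have W: "\<bar>Wt tanh (q l) (\<nu> x l) - S (c x l)\<bar> \<le> K1 * P"
      by (simp add: K1_def)
    have "\<bar>c x l - e x l\<bar> \<le> 2 * \<sigma>\<^sub>b\<^sup>2 / \<sigma>\<^sub>w\<^sup>2 * (P / sqrt p0)"
      unfolding P_def
      by (intro order.trans[OF abs_c_minus_e_le[OF assms]] mult_left_mono inverse_p_le) auto
    then have "1 / sqrt \<eta> * \<bar>c x l - e x l\<bar> \<le> 1 / sqrt \<eta> * (2 * \<sigma>\<^sub>b\<^sup>2 / \<sigma>\<^sub>w\<^sup>2 * (P / sqrt p0))"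
      using \<eta> by (intro mult_left_mono) auto
    with arcsin_lipschitz[OF \<eta>(1) \<eta>(3)[OF l] \<eta>(2)[OF l]]
    have "\<bar>arcsin (c x l) - arcsin (e x l)\<bar> \<le> 1 / sqrt \<eta> * (2 * \<sigma>\<^sub>b\<^sup>2 / \<sigma>\<^sub>w\<^sup>2 * (P / sqrt p0))"
      by (rule order.trans)
    then have "2 / pi * \<bar>arcsin (c x l) - arcsin (e x l)\<bar> \<le> 2 / pi * (1 / sqrt \<eta> * (2 * \<sigma>\<^sub>b\<^sup>2 / \<sigma>\<^sub>w\<^sup>2 * (P / sqrt p0)))"
      by (intro mult_left_mono) auto
    moreover have "\<bar>S (c x l) - S (e x l)\<bar> = 2 / pi * \<bar>arcsin (c x l) - arcsin (e x l)\<bar>"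
      unfolding S_def right_diff_distrib[symmetric] abs_mult by simp
    ultimately have C: "\<bar>S (c x l) - S (e x l)\<bar> \<le> K2 * P"
      by (simp add: K2_def)
    have "\<bar>Wt tanh (q l) (\<nu> x l) - S (e x l)\<bar> \<le> (K1 + K2) * P"
      using W C unfolding distrib_right by linarith
    then have "\<sigma>\<^sub>v\<^sup>2 * \<bar>Wt tanh (q l) (\<nu> x l) - S (e x l)\<bar> \<le> \<sigma>\<^sub>v\<^sup>2 * ((K1 + K2) * P)"
      by (intro mult_left_mono) auto
    moreover have "d\<gamma> - X = \<sigma>\<^sub>v\<^sup>2 * (Wt tanh (q l) (\<nu> x l) - S (e x l))"
      by (simp add: d\<gamma>_def X_def \<gamma>_Suc right_diff_distrib)
    ultimately have dX: "\<bar>d\<gamma> - X\<bar> \<le> \<sigma>\<^sub>v\<^sup>2 * ((K1 + K2) * P)"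
      by (simp add: abs_mult)
    have "\<bar>arcsin (e x l)\<bar> \<le> pi / 2"
      using \<eta>(1) \<eta>(2)[OF l] arcsin_bounded[of "e x l"] by (auto simp: abs_le_iff)
    then have "\<bar>S (e x l)\<bar> \<le> 1"
      by (simp add: S_def abs_mult field_simps)
    then have "\<sigma>\<^sub>v\<^sup>2 * \<bar>S (e x l)\<bar> \<le> \<sigma>\<^sub>v\<^sup>2 * 1"
      by (intro mult_left_mono) auto
    moreover have "\<bar>X\<bar> \<le> \<sigma>\<^sub>v\<^sup>2 * \<bar>S (e x l)\<bar> + \<sigma>\<^sub>a\<^sup>2"
      unfolding X_def by (metis abs_mult abs_power2 abs_triangle_ineq)
    ultimately have "\<bar>X\<bar> \<le> p_slope"
      by (simp add: p_slope_def)
    then have X: "\<bar>X / p_slope\<bar> \<le> 1"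
      using p_slope_pos by (simp add: abs_divide)
    have "\<bar>(p_slope - dp) * (X / p_slope)\<bar> \<le> K3 * P * 1"
      unfolding abs_mult[of "p_slope - dp"] using p_increment_approx[of l] X K_nonneg P
      by (intro mult_mono) (auto simp: K3_def P_def dp_def)
    moreover have "d\<gamma> - dp * (X / p_slope) = (d\<gamma> - X) + (p_slope - dp) * (X / p_slope)"
      using p_slope_pos by (simp add: field_simps)
    moreover have "\<bar>z\<bar> \<le> r + r'" if "\<bar>u\<bar> \<le> r" "\<bar>v\<bar> \<le> r' * 1" "z = u + v" for u v z r r' :: real
      using that by simp
    ultimately have "\<bar>d\<gamma> - dp * (X / p_slope)\<bar> \<le> \<sigma>\<^sub>v\<^sup>2 * ((K1 + K2) * P) + K3 * P"
      using dX by blast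
    also have "\<dots> = k * (K * P)"
      using k by (simp add: K_def distrib_right mult.assoc)
    also have "\<dots> \<le> dp * (K * P)"
      using dp K_nonneg P by (intro mult_right_mono) auto
    finally have main: "\<bar>d\<gamma> - dp * (X / p_slope)\<bar> \<le> dp * (K * P)" .
    have "e x (Suc l) - (e x l + rel_step p l * corr_drift \<alpha> (e x l)) = (d\<gamma> - dp * (X / p_slope)) / p (Suc l)"
    proof -
      have "corr_drift \<alpha> (e x l) = X / p_slope - e x l"
        by (simp add: corr_drift_eq X_def S_def)
      then have "e x l + rel_step p l * corr_drift \<alpha> (e x l) = e x l * (1 - rel_step p l) + rel_step p l * (X / p_slope)"
        by (simp only: right_diff_distrib mult.commute[of "rel_step p l" "e x l"] mult_1_right)
      moreover have "e x l * (1 - rel_step p l) = \<gamma> x l / p (Suc l)"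
        using p_gt_0[of l] by (simp add: rel_step_def e_def)
      moreover have "e x (Suc l) = \<gamma> x l / p (Suc l) + d\<gamma> / p (Suc l)"
        by (simp add: e_def d\<gamma>_def diff_divide_distrib)
      moreover have "rel_step p l = dp / p (Suc l)"
        by (simp add: rel_step_p_eq dp_def)
      ultimately show ?thesis
        by (simp add: diff_divide_distrib)
    qed
    also have "\<bar>\<dots>\<bar> = \<bar>d\<gamma> - dp * (X / p_slope)\<bar> / p (Suc l)"
      using p_gt_0[of "Suc l"] by (simp add: abs_divide)
    also have "\<dots> \<le> dp * (K * P) / p (Suc l)"
      using p_gt_0[of "Suc l"] main by (intro divide_right_mono) auto
    also have "\<dots> = rel_step p l * (K * p l powr - (1 / 2))"
      by (simp add: rel_step_p_eq dp_def P_def)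
    finally show ?thesis .
  qed
  from eventually_sequentiallyI[OF this] show thesis
    by (rule that[OF K_nonneg(4)])
qed

end

section \<open>Convergence to the fixed point and the upper rate\<close>

locale tanh_frn_root = tanh_frn +
  fixes estar \<delta> :: real and g :: "real \<Rightarrow> real"
  assumes estar_bounds: "0 \<le> estar" "estar < 1"
    and drift_factor: "corr_drift \<alpha> t = g t * (t - estar)"
    and g_cont: "continuous_on {-1<..<1} g"
    and g_estar: "g estar = - \<delta>"
    and g_neg: "\<bar>t\<bar> < 1 \<Longrightarrow> g t < 0"
    and \<delta>_pos: "0 < \<delta>" and \<delta>_lt: "\<delta> < 1 / 2"
    and \<delta>_eq: "\<delta> = 1 - 2 / pi * (1 / sqrt (1 - estar\<^sup>2)) * \<alpha>"
begin

text \<open>The Euler map multiplies \<open>e - estar\<close> by a factor that is eventually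
  nonnegative, since \<open>g\<close> is bounded on the compact range of \<open>e\<close>; absolute
  values then pass through. The estimate is two-sided because the lower bound needs it too.\<close>

lemma dist_Suc_approx:
  assumes "admissible x"
  obtains K where "0 \<le> K"
    "eventually (\<lambda>l. \<bar>\<bar>e x (Suc l) - estar\<bar> - (1 + g (e x l) * rel_step p l) * \<bar>e x l - estar\<bar>\<bar>
      \<le> rel_step p l * (K * p l powr - (1 / 2))) sequentially"
proof -
  obtain K where K: "0 \<le> K" "eventually (\<lambda>l. \<bar>e x (Suc l) - (e x l + rel_step p l * corr_drift \<alpha> (e x l))\<bar>
      \<le> rel_step p l * (K * p l powr - (1 / 2))) sequentially"
    using e_Suc_approx[OF assms] by blast
  obtain \<eta> where \<eta>: "0 < \<eta>" "\<And>l. 1 \<le> l \<Longrightarrow> \<bar>e x l\<bar> \<le> 1 - \<eta>" "\<And>l. 1 \<le> l \<Longrightarrow> \<bar>c x l\<bar> \<le> 1 - \<eta>"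
    using correlations_bounded_away[OF assms] by blast
  have "compact (g ` {- (1 - \<eta>)..1 - \<eta>})"
    using \<eta>(1) by (intro compact_continuous_image continuous_on_subset[OF g_cont]) auto
  then obtain B where "\<forall>y \<in> g ` {- (1 - \<eta>)..1 - \<eta>}. norm y \<le> B"
    using compact_imp_bounded bounded_iff by metis
  then have B: "\<bar>g t\<bar> \<le> B" if "t \<in> {- (1 - \<eta>)..1 - \<eta>}" for t
    using that by simp
  have "(\<lambda>l. B * rel_step p l) \<longlonglongrightarrow> B * 0"
    by (intro tendsto_intros rel_step_lim)
  then have "eventually (\<lambda>l. B * rel_step p l < 1) sequentially"
    by (intro order_tendstoD) auto
  then have "eventually (\<lambda>l. \<bar>\<bar>e x (Suc l) - estar\<bar> - (1 + g (e x l) * rel_step p l) * \<bar>e x l - estar\<bar>\<bar>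
      \<le> rel_step p l * (K * p l powr - (1 / 2))) sequentially"
    using K(2) eventually_ge_at_top[of 1]
  proof eventually_elim
    case (elim l)
    have "e x l \<in> {- (1 - \<eta>)..1 - \<eta>}"
      using \<eta>(2)[OF elim(3)] by (auto simp: abs_le_iff)
    then have "- g (e x l) \<le> B"
      by (intro abs_le_D2 B)
    then have "- g (e x l) * rel_step p l \<le> B * rel_step p l"
      using rel_step_bounds[of l] by (intro mult_right_mono) auto
    then have "0 \<le> 1 + g (e x l) * rel_step p l"
      using elim(1) by simp
    then have "(1 + g (e x l) * rel_step p l) * \<bar>e x l - estar\<bar> = \<bar>(1 + g (e x l) * rel_step p l) * (e x l - estar)\<bar>"
      by (simp add: abs_mult)
    also have "(1 + g (e x l) * rel_step p l) * (e x l - estar) = e x l + rel_step p l * corr_drift \<alpha> (e x l) - estar"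
      unfolding drift_factor by (simp add: algebra_simps)
    finally have eq: "(1 + g (e x l) * rel_step p l) * \<bar>e x l - estar\<bar> =
        \<bar>e x l + rel_step p l * corr_drift \<alpha> (e x l) - estar\<bar>" .
    have "\<bar>\<bar>y - z\<bar> - \<bar>u - z\<bar>\<bar> \<le> r" if "\<bar>y - u\<bar> \<le> r" for y z u r :: real
      using that by linarith
    from this[OF elim(2)] show ?case
      unfolding eq .
  qed
  then show thesis
    by (rule that[OF K(1)])
qed

lemma dist_upper_rec:
  assumes "admissible x" "eventually (\<lambda>l. g (e x l) \<le> - k) sequentially"
  obtains K where "0 \<le> K" "eventually (\<lambda>l. \<bar>e x (Suc l) - estar\<bar>
     \<le> (1 - k * rel_step p l) * \<bar>e x l - estar\<bar> + rel_step p l * (K * p l powr - (1 / 2))) sequentially"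
proof -
  obtain K where K: "0 \<le> K"
    "eventually (\<lambda>l. \<bar>\<bar>e x (Suc l) - estar\<bar> - (1 + g (e x l) * rel_step p l) * \<bar>e x l - estar\<bar>\<bar>
      \<le> rel_step p l * (K * p l powr - (1 / 2))) sequentially"
    using dist_Suc_approx[OF assms(1)] by blast
  have "eventually (\<lambda>l. \<bar>e x (Suc l) - estar\<bar>
     \<le> (1 - k * rel_step p l) * \<bar>e x l - estar\<bar> + rel_step p l * (K * p l powr - (1 / 2))) sequentially"
    using K(2) assms(2)
  proof eventually_elim
    case (elim l)
    have trans: "y \<le> v + r" if "u \<le> v" "\<bar>y - u\<bar> \<le> r" for u v y r :: real
      using that by linarith
    have "g (e x l) * rel_step p l \<le> - k * rel_step p l"
      using elim(2) rel_step_bounds[of l] by (intro mult_right_mono) auto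
    then have "(1 + g (e x l) * rel_step p l) * \<bar>e x l - estar\<bar> \<le> (1 - k * rel_step p l) * \<bar>e x l - estar\<bar>"
      by (intro mult_right_mono) auto
    then show ?case
      using elim(1) by (rule trans)
  qed
  then show thesis
    by (rule that[OF K(1)])
qed

text \<open>The maximum of \<open>g\<close> over the compact interval \<open>J\<close> is negative,
  which gives decay at some crude power. Once \<open>e\<close> converges, \<open>g (e x l)\<close>
  tends to \<open>- \<delta>\<close>, and the same recurrence can be run again with a rate close to
  \<delta>.\<close>

lemma e_tendsto:
  assumes "admissible x"
  shows "e x \<longlonglongrightarrow> estar"
proof -
  obtain \<eta> where \<eta>: "0 < \<eta>" "\<And>l. 1 \<le> l \<Longrightarrow> \<bar>e x l\<bar> \<le> 1 - \<eta>" "\<And>l. 1 \<le> l \<Longrightarrow> \<bar>c x l\<bar> \<le> 1 - \<eta>"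
    using correlations_bounded_away[OF assms] by blast
  define J where "J = {- (1 - \<eta>)..1 - \<eta>}"
  have J: "e x l \<in> J" if "1 \<le> l" for l
    using \<eta>(2)[OF that] by (auto simp: J_def abs_le_iff)
  have "continuous_on J g"
    using \<eta>(1) by (intro continuous_on_subset[OF g_cont]) (auto simp: J_def)
  moreover have "compact J" "J \<noteq> {}"
    using J[of 1] by (auto simp: J_def)
  ultimately obtain t where t: "t \<in> J" "\<forall>s\<in>J. g s \<le> g t"
    using continuous_attains_sup by blast
  define k where "k = - g t"
  have k: "0 < k"
    using g_neg[of t] t(1) \<eta>(1) by (auto simp: k_def J_def)
  have "eventually (\<lambda>l. g (e x l) \<le> - k) sequentially"
    using eventually_ge_at_top[of 1] by eventually_elim (use t J in \<open>auto simp: k_def\<close>)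
  from dist_upper_rec[OF assms this]
  obtain K where K: "0 \<le> K" "eventually (\<lambda>l. \<bar>e x (Suc l) - estar\<bar>
     \<le> (1 - k * rel_step p l) * \<bar>e x l - estar\<bar> + rel_step p l * (K * p l powr - (1 / 2))) sequentially" .
  \<comment> \<open>Any positive exponent below both the contraction rate and that of the
    perturbation would do.\<close>
  define \<kappa> where "\<kappa> = min k (1 / 2) / 2"
  have \<kappa>: "0 < \<kappa>" "\<kappa> < k" "\<kappa> < 1 / 2"
    using k by (auto simp: \<kappa>_def)
  from powr_decay[OF less_imp_le[OF \<kappa>(1)] \<kappa>(2,3) K]
  obtain M where M: "eventually (\<lambda>l. \<bar>e x l - estar\<bar> \<le> M * p l powr - \<kappa>) sequentially" .
  have "(\<lambda>l. M * p l powr - \<kappa>) \<longlonglongrightarrow> M * 0"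
    by (intro tendsto_intros powr_neg_tendsto_0 \<kappa>)
  then have "(\<lambda>l. M * p l powr - \<kappa>) \<longlonglongrightarrow> 0"
    by simp
  then have "(\<lambda>l. e x l - estar) \<longlonglongrightarrow> 0"
    by (rule Lim_null_comparison[rotated]) (use M in \<open>simp only: real_norm_def\<close>)
  then show ?thesis
    by (simp add: LIM_zero_iff)
qed

lemma g_e_tendsto:
  assumes "admissible x"
  shows "(\<lambda>l. g (e x l)) \<longlonglongrightarrow> - \<delta>"
proof -
  have "isCont g estar"
    using continuous_on_eq_continuous_at[of "{-1<..<1}" g] g_cont estar_bounds by simp
  from isCont_tendsto_compose[OF this e_tendsto[OF assms]] show ?thesis
    by (simp add: g_estar)
qed

lemma dist_upper:
  assumes "admissible x" "0 < \<epsilon>" "\<epsilon> \<le> \<delta>"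
  obtains M where "eventually (\<lambda>l. \<bar>e x l - estar\<bar> \<le> M * p l powr - (\<delta> - \<epsilon>)) sequentially"
proof -
  have "eventually (\<lambda>l. g (e x l) < - (\<delta> - \<epsilon> / 2)) sequentially"
    using g_e_tendsto[OF assms(1)] assms by (intro order_tendstoD) auto
  then have "eventually (\<lambda>l. g (e x l) \<le> - (\<delta> - \<epsilon> / 2)) sequentially"
    by eventually_elim simp
  from dist_upper_rec[OF assms(1) this]
  obtain K where K: "0 \<le> K" "eventually (\<lambda>l. \<bar>e x (Suc l) - estar\<bar>
     \<le> (1 - (\<delta> - \<epsilon> / 2) * rel_step p l) * \<bar>e x l - estar\<bar> + rel_step p l * (K * p l powr - (1 / 2))) sequentially" .
  have "0 \<le> \<delta> - \<epsilon>" "\<delta> - \<epsilon> < \<delta> - \<epsilon> / 2" "\<delta> - \<epsilon> < 1 / 2"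
    using assms \<delta>_lt by auto
  from powr_decay[OF this K]
  obtain M where "eventually (\<lambda>l. \<bar>e x l - estar\<bar> \<le> M * p l powr - (\<delta> - \<epsilon>)) sequentially" .
  then show thesis
    by (rule that)
qed

text \<open>The error term of \<open>dist_Suc_approx\<close> is negligible against \<open>p l powr - \<eta>\<close>, so once the
  distance reaches this size, it never falls below it again.\<close>

lemma dist_dichotomy:
  assumes "admissible x" "\<delta> < \<eta>" "\<eta> < 1 / 2"
  shows "eventually (\<lambda>l. \<bar>e x l - estar\<bar> < p l powr - \<eta>) sequentially \<or>
    eventually (\<lambda>l. p l powr - \<eta> \<le> \<bar>e x l - estar\<bar>) sequentially"
proof -
  define k where "k = (\<delta> + \<eta>) / 2"
  have k: "0 \<le> k" "\<delta> < k" "k < \<eta>"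
    using assms \<delta>_pos by (auto simp: k_def)
  obtain K where K: "0 \<le> K"
    "eventually (\<lambda>l. \<bar>\<bar>e x (Suc l) - estar\<bar> - (1 + g (e x l) * rel_step p l) * \<bar>e x l - estar\<bar>\<bar>
      \<le> rel_step p l * (K * p l powr - (1 / 2))) sequentially"
    using dist_Suc_approx[OF assms(1)] by blast
  have g: "eventually (\<lambda>l. - k < g (e x l)) sequentially"
    using g_e_tendsto[OF assms(1)] k by (intro order_tendstoD) auto
  have small: "eventually (\<lambda>l. K * p l powr - (1 / 2 - \<eta>) < (\<eta> - k) / 2) sequentially"
  proof -
    have "(\<lambda>l. K * p l powr - (1 / 2 - \<eta>)) \<longlonglongrightarrow> K * 0"
      using assms by (intro tendsto_intros powr_neg_tendsto_0) auto
    then show ?thesis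
      using k by (intro order_tendstoD) auto
  qed
  have "eventually (\<lambda>l. (1 - k * rel_step p l) * \<bar>e x l - estar\<bar>
       - rel_step p l * ((\<eta> - k) / 2 * (1 * p l powr - \<eta>)) \<le> \<bar>e x (Suc l) - estar\<bar>) sequentially"
    using K(2) g small
  proof eventually_elim
    case (elim l)
    have gap: "v - r' \<le> y" if "v \<le> u" "r \<le> r'" "\<bar>y - u\<bar> \<le> r" for u v y r r' :: real
      using that by linarith
    have "- k * rel_step p l \<le> g (e x l) * rel_step p l"
      using elim(2) rel_step_bounds[of l] by (intro mult_right_mono) auto
    then have "(1 - k * rel_step p l) * \<bar>e x l - estar\<bar> \<le> (1 + g (e x l) * rel_step p l) * \<bar>e x l - estar\<bar>"
      by (intro mult_right_mono) auto
    moreover have "K * p l powr - (1 / 2) \<le> (\<eta> - k) / 2 * (1 * p l powr - \<eta>)"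
    proof -
      have "K * p l powr - (1 / 2 - \<eta>) * p l powr - \<eta> \<le> (\<eta> - k) / 2 * p l powr - \<eta>"
        using elim(3) by (intro mult_right_mono) auto
      then show ?thesis
        by (simp add: mult.assoc flip: powr_add)
    qed
    then have "rel_step p l * (K * p l powr - (1 / 2)) \<le> rel_step p l * ((\<eta> - k) / 2 * (1 * p l powr - \<eta>))"
      using rel_step_bounds[of l] by (intro mult_left_mono) auto
    ultimately show ?case
      using elim(1) by (rule gap)
  qed
  then obtain L1 where L1: "\<And>l. L1 \<le> l \<Longrightarrow> (1 - k * rel_step p l) * \<bar>e x l - estar\<bar>
       - rel_step p l * ((\<eta> - k) / 2 * (1 * p l powr - \<eta>)) \<le> \<bar>e x (Suc l) - estar\<bar>"
    unfolding eventually_sequentially by blast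
  from powr_lower_bound_propagates[OF k(1,3)] obtain L2 where L2: "\<forall>x m. \<forall>n\<ge>L2. 0 < m \<longrightarrow>
    (\<forall>l\<ge>n. (1 - k * rel_step p l) * x l
       - rel_step p l * ((\<eta> - k) / 2 * (m * p l powr - \<eta>)) \<le> x (Suc l)) \<longrightarrow>
    m * p n powr - \<eta> \<le> x n \<longrightarrow> (\<forall>l\<ge>n. m * p l powr - \<eta> \<le> x l)" .
  show ?thesis
  proof (cases "\<exists>n\<ge>max L1 L2. p n powr - \<eta> \<le> \<bar>e x n - estar\<bar>")
    case True
    then obtain n where n: "L1 \<le> n" "L2 \<le> n" "p n powr - \<eta> \<le> \<bar>e x n - estar\<bar>"
      by auto
    have "p l powr - \<eta> \<le> \<bar>e x l - estar\<bar>" if "n \<le> l" for l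
      using L2[THEN spec[of _ "\<lambda>l. \<bar>e x l - estar\<bar>"], THEN spec[of _ 1]] n that L1 by simp
    then show ?thesis
      unfolding eventually_sequentially by blast
  next
    case False
    then show ?thesis
      unfolding eventually_sequentially by (meson linorder_not_le)
  qed
qed

end

section \<open>Separation of trajectories and the lower rate\<close>

context tanh_frn_root
begin

lemma estar_sq_lt: "estar\<^sup>2 < 1"
  using estar_bounds by (simp add: abs_square_less_1)

lemma c_tendsto:
  assumes "admissible x"
  shows "c x \<longlonglongrightarrow> estar"
proof -
  have "(\<lambda>l. 2 * \<sigma>\<^sub>b\<^sup>2 / \<sigma>\<^sub>w\<^sup>2 * (1 / p l)) \<longlonglongrightarrow> 2 * \<sigma>\<^sub>b\<^sup>2 / \<sigma>\<^sub>w\<^sup>2 * 0"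
    by (intro tendsto_mult tendsto_const tendsto_divide_0[OF tendsto_const]
        filterlim_at_top_imp_at_infinity p_at_top)
  then have "(\<lambda>l. 2 * \<sigma>\<^sub>b\<^sup>2 / \<sigma>\<^sub>w\<^sup>2 * (1 / p l)) \<longlonglongrightarrow> 0"
    by (simp only: mult_zero_right)
  then have "(\<lambda>l. c x l - e x l) \<longlonglongrightarrow> 0"
    by (rule Lim_null_comparison[rotated])
      (simp only: real_norm_def abs_c_minus_e_le[OF assms] eventually_True)
  from tendsto_add[OF this e_tendsto[OF assms]] show ?thesis
    by simp
qed

lemma p_increment_tendsto: "(\<lambda>l. p (Suc l) - p l) \<longlonglongrightarrow> p_slope"
proof -
  have "(\<lambda>l. \<sigma>\<^sub>v\<^sup>2 * (2 * tanh_defect / \<sigma>\<^sub>w) * p l powr - (1 / 2)) \<longlonglongrightarrow> \<sigma>\<^sub>v\<^sup>2 * (2 * tanh_defect / \<sigma>\<^sub>w) * 0"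
    by (intro tendsto_mult tendsto_const powr_neg_tendsto_0) simp
  then have "(\<lambda>l. \<sigma>\<^sub>v\<^sup>2 * (2 * tanh_defect / \<sigma>\<^sub>w) * p l powr - (1 / 2)) \<longlonglongrightarrow> 0"
    by (simp only: mult_zero_right)
  then have "(\<lambda>l. p_slope - (p (Suc l) - p l)) \<longlonglongrightarrow> 0"
    by (rule Lim_null_comparison[rotated])
      (simp only: real_norm_def p_increment_approx eventually_True)
  from tendsto_diff[OF tendsto_const[of p_slope] this] show ?thesis
    by simp
qed

lemma q_ratio_tendsto: "(\<lambda>l. \<sigma>\<^sub>w\<^sup>2 * p l / q l) \<longlonglongrightarrow> 1"
proof -
  have "\<sigma>\<^sub>w\<^sup>2 * p l / q l = 1 - \<sigma>\<^sub>b\<^sup>2 / q l" for l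
    using q_gt_0[of l] by (simp add: divide_simps) (simp add: q_def)
  moreover have "(\<lambda>l. 1 - \<sigma>\<^sub>b\<^sup>2 / q l) \<longlonglongrightarrow> 1 - 0"
    by (intro tendsto_diff tendsto_const tendsto_divide_0[OF tendsto_const]
        filterlim_at_top_imp_at_infinity q_at_top)
  ultimately show ?thesis
    by simp
qed

text \<open>The number (1 - \<delta>) / \<alpha> is the derivative of \<open>2 / pi * arcsin\<close>
  at \<open>estar\<close>; by continuity and the mean value theorem any smaller slope is a lower
  bound nearby.\<close>

lemma arcsin_slope_near_estar:
  assumes "\<rho> < (1 - \<delta>) / \<alpha>"
  obtains r where "0 < r" "\<And>s t. \<bar>s - estar\<bar> < r \<Longrightarrow> \<bar>t - estar\<bar> < r \<Longrightarrow> s < t \<Longrightarrow>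
    \<rho> * (t - s) \<le> 2 / pi * arcsin t - 2 / pi * arcsin s"
proof -
  define D where "D = (\<lambda>t :: real. 2 / pi * inverse (sqrt (1 - t\<^sup>2)))"
  have "1 - \<delta> = D estar * \<alpha>"
    by (simp add: \<delta>_eq D_def inverse_eq_divide)
  then have "\<rho> < D estar"
    using assms \<alpha>_bounds by simp
  moreover have "isCont D estar"
    unfolding D_def using estar_sq_lt by (intro continuous_intros) auto
  ultimately have "eventually (\<lambda>t. \<rho> < D t) (at estar)"
    by (intro order_tendstoD(1)[of D "D estar"]) (simp_all add: isCont_def)
  then have "eventually (\<lambda>t. t \<noteq> estar \<longrightarrow> \<rho> < D t) (nhds estar)"
    by (simp only: eventually_at_filter UNIV_I simp_thms)
  then have "eventually (\<lambda>t. \<rho> < D t) (nhds estar)"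
    by (rule eventually_mono) (use \<open>\<rho> < D estar\<close> in blast)
  then obtain d where "0 < d" "\<forall>t. dist t estar < d \<longrightarrow> \<rho> < D t"
    unfolding eventually_nhds_metric by blast
  then have d: "0 < d" "\<bar>t - estar\<bar> < d \<Longrightarrow> \<rho> < D t" for t
    by (simp_all add: dist_real_def)
  define r where "r = min d (1 - estar)"
  have r: "0 < r" "r \<le> d" "r \<le> 1 - estar"
    using d estar_bounds by (auto simp: r_def)
  show thesis
  proof (rule that[OF r(1)])
    fix s t
    assume s: "\<bar>s - estar\<bar> < r" and t: "\<bar>t - estar\<bar> < r" and "s < t"
    have st: "- 1 < s" "t < 1"
      using s t r estar_bounds by linarith+
    have "\<exists>z>s. z < t \<and> 2 / pi * arcsin t - 2 / pi * arcsin s = (t - s) * D z"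
    proof (rule MVT2[OF \<open>s < t\<close>])
      fix z assume "s \<le> z" "z \<le> t"
      then show "((\<lambda>t. 2 / pi * arcsin t) has_real_derivative D z) (at z)"
        unfolding D_def using st by (intro DERIV_cmult DERIV_arcsin) auto
    qed
    then obtain z where z: "s < z" "z < t" "2 / pi * arcsin t - 2 / pi * arcsin s = (t - s) * D z"
      by blast
    have "\<bar>z - estar\<bar> < d"
      using z s t r by linarith
    then have "(t - s) * \<rho> \<le> (t - s) * D z"
      using d(2)[of z] \<open>s < t\<close> by (intro mult_left_mono) auto
    then show "\<rho> * (t - s) \<le> 2 / pi * arcsin t - 2 / pi * arcsin s"
      using z(3) by (simp add: mult.commute)
  qed
qed

text \<open>Both trajectories have the same \<open>q\<close>, and W is monotone in the covariance,
  so the order of the initial values is preserved.\<close>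

lemma \<gamma>_diff_pos:
  assumes "\<bar>x\<bar> \<le> p0" "\<bar>y\<bar> \<le> p0" "y < x"
  shows "\<gamma> y l < \<gamma> x l"
proof (induction l)
  case (Suc l)
  have "\<nu> y l \<le> \<nu> x l"
    using Suc by (simp add: \<nu>_def mult_left_mono)
  then have "Wt tanh (q l) (\<nu> y l) \<le> Wt tanh (q l) (\<nu> x l)"
    using abs_\<nu>_le[OF assms(1), of l] abs_\<nu>_le[OF assms(2), of l]
    by (intro Wt_tanh_mono) (simp_all add: abs_le_iff)
  then have "\<sigma>\<^sub>v\<^sup>2 * Wt tanh (q l) (\<nu> y l) \<le> \<sigma>\<^sub>v\<^sup>2 * Wt tanh (q l) (\<nu> x l)"
    by (intro mult_left_mono) auto
  then show ?case
    using Suc by (simp add: \<gamma>_Suc)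
qed (use assms in \<open>simp add: \<gamma>_0\<close>)

text \<open>\<open>p\<close> and \<open>q\<close> are shared and the bias cancels in
  \<open>c x l - c y l\<close>, so the difference satisfies a homogeneous recurrence: no term p powr
  - (1 / 2) remains, and the approximation error only changes the rate by an amount tending to
  0.\<close>

lemma trajectories_separate:
  assumes x: "admissible x" and y: "admissible y" and "y < x" "\<delta> < \<eta>"
  obtains m where "0 < m" "eventually (\<lambda>l. m * p l powr - \<eta> \<le> e x l - e y l) sequentially"
proof -
  define z where "z = (\<lambda>l. e x l - e y l)"
  have z_pos: "0 < z l" for l
    using \<gamma>_diff_pos[OF admissible_abs_le[OF x] admissible_abs_le[OF y] \<open>y < x\<close>, of l] p_gt_0[of l]
    by (simp add: z_def e_def divide_strict_right_mono)
  define k where "k = (\<delta> + \<eta>) / 2"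
  have k: "0 \<le> k" "\<delta> < k" "k < \<eta>"
    using assms \<delta>_pos by (auto simp: k_def)
  \<comment> \<open>A slope slightly below the one at \<open>estar\<close>, such that the limit
    \<open>1 - (\<delta> + k) / 2\<close> of \<open>G\<close> is still above
    \<open>1 - k\<close>.\<close>
  define \<rho> where "\<rho> = (1 - (\<delta> + k) / 2) / \<alpha>"
  have "\<rho> < (1 - \<delta>) / \<alpha>"
    unfolding \<rho>_def using k \<alpha>_bounds by (intro divide_strict_right_mono) auto
  then obtain r where r: "0 < r" "\<And>s t. \<bar>s - estar\<bar> < r \<Longrightarrow> \<bar>t - estar\<bar> < r \<Longrightarrow> s < t \<Longrightarrow>
    \<rho> * (t - s) \<le> 2 / pi * arcsin t - 2 / pi * arcsin s"
    by (rule arcsin_slope_near_estar) (rule that; blast)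
  \<comment> \<open>Half the distance from \<open>estar\<close> to 1, so that both correlations
    eventually lie in the range of the Lipschitz estimate.\<close>
  define \<eta>0 where "\<eta>0 = (1 - estar) / 2"
  have \<eta>0: "0 < \<eta>0" "estar < 1 - \<eta>0"
    using estar_bounds by (simp_all add: \<eta>0_def field_simps)
  obtain \<epsilon> where \<epsilon>: "\<epsilon> \<longlonglongrightarrow> 0"
    "\<And>l c d. \<bar>c\<bar> \<le> 1 - \<eta>0 \<Longrightarrow> \<bar>d\<bar> \<le> 1 - \<eta>0 \<Longrightarrow>
      \<bar>(Wt tanh (q l) (c * q l) - sgn_corr c) - (Wt tanh (q l) (d * q l) - sgn_corr d)\<bar> \<le> \<epsilon> l * \<bar>c - d\<bar>"
    by (rule Wt_tanh_minus_sgn_corr_lipschitz[OF \<eta>0(1) q_at_top less_imp_le[OF q_gt_0]]) (rule that; blast)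
  \<comment> \<open>A lower bound for the increment of \<gamma> x - \<gamma> y divided by
    \<open>dp * z l\<close>: the ratio before \<rho> converts \<open>z\<close> into the difference
    of the \<open>c\<close>, and \<open>\<rho> - \<epsilon> l\<close> bounds the slope of W in this
    difference.\<close>
  define G where "G = (\<lambda>l. \<sigma>\<^sub>v\<^sup>2 / (p (Suc l) - p l) * (\<sigma>\<^sub>w\<^sup>2 * p l / q l) * (\<rho> - \<epsilon> l))"
  have "G \<longlonglongrightarrow> \<sigma>\<^sub>v\<^sup>2 / p_slope * 1 * (\<rho> - 0)"
    unfolding G_def using p_slope_pos
    by (intro tendsto_mult tendsto_divide tendsto_diff tendsto_const q_ratio_tendsto p_increment_tendsto \<epsilon>(1)) auto
  moreover have "\<sigma>\<^sub>v\<^sup>2 / p_slope * 1 * (\<rho> - 0) = 1 - (\<delta> + k) / 2"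
    using \<alpha>_bounds by (simp add: \<rho>_def flip: \<alpha>_def)
  ultimately have ev_G: "eventually (\<lambda>l. 1 - k < G l) sequentially"
    using k by (intro order_tendstoD(1)) auto
  have near: "eventually (\<lambda>l. \<bar>c u l - estar\<bar> < r \<and> \<bar>c u l\<bar> \<le> 1 - \<eta>0) sequentially" if u: "admissible u" for u
  proof -
    have "eventually (\<lambda>l. \<bar>c u l - estar\<bar> < min r (1 - \<eta>0 - estar)) sequentially"
      using tendstoD[OF c_tendsto[OF u], of "min r (1 - \<eta>0 - estar)"] r \<eta>0 by (simp add: dist_real_def)
    then show ?thesis
    proof eventually_elim
      case (elim l)
      then show ?case
        using \<eta>0 estar_bounds unfolding min_less_iff_conj by linarith
    qed
  qed
  have "eventually (\<lambda>l. (1 - k * rel_step p l) * z l \<le> z (Suc l)) sequentially"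
    using ev_G near[OF x] near[OF y]
  proof eventually_elim
    case (elim l)
    define dp where "dp = p (Suc l) - p l"
    define W where "W = (\<lambda>u. Wt tanh (q l) (\<nu> u l))"
    have dp: "0 < dp"
    proof -
      obtain k' where k': "0 < k'" "\<And>l. p l + k' \<le> p (Suc l)"
        using p_Suc_ge by blast
      then show ?thesis
        using k'(1) k'(2)[of l] unfolding dp_def by linarith
    qed
    have cq: "\<nu> u l = c u l * q l" for u
      using q_gt_0[of l] by (simp add: c_def)
    have sgn: "sgn_corr (c u l) = 2 / pi * arcsin (c u l)" if "\<bar>c u l\<bar> \<le> 1 - \<eta>0" for u
      using that \<eta>0 by (intro sgn_corr_eq_arcsin) auto
    have c_diff: "c x l - c y l = \<sigma>\<^sub>w\<^sup>2 * p l / q l * z l"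
      using p_gt_0[of l] by (simp add: c_def \<nu>_def z_def e_def add_divide_distrib diff_divide_distrib right_diff_distrib)
    have "0 < \<sigma>\<^sub>w\<^sup>2 * p l / q l * z l"
      using \<sigma>\<^sub>w_pos p_gt_0[of l] q_gt_0[of l] z_pos[of l] by simp
    then have c_less: "c y l < c x l"
      using c_diff by simp
    have "\<rho> * (c x l - c y l) \<le> sgn_corr (c x l) - sgn_corr (c y l)"
      using r(2)[OF _ _ c_less] elim sgn by simp
    moreover have "\<bar>(W x - sgn_corr (c x l)) - (W y - sgn_corr (c y l))\<bar> \<le> \<epsilon> l * \<bar>c x l - c y l\<bar>"
      using \<epsilon>(2)[of "c x l" "c y l" l] elim by (simp add: W_def cq)
    ultimately have W: "(\<rho> - \<epsilon> l) * (c x l - c y l) \<le> W x - W y"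
      using c_less by (simp add: left_diff_distrib abs_le_iff)
    have "(1 - k) * z l \<le> G l * z l"
      using elim(1) z_pos[of l] by (intro mult_right_mono) auto
    also have "\<dots> = \<sigma>\<^sub>v\<^sup>2 / dp * ((\<rho> - \<epsilon> l) * (c x l - c y l))"
      unfolding c_diff by (simp add: G_def dp_def)
    also have "\<dots> \<le> \<sigma>\<^sub>v\<^sup>2 / dp * (W x - W y)"
      using W dp by (intro mult_left_mono) auto
    finally have "rel_step p l * ((1 - k) * z l) \<le> rel_step p l * (\<sigma>\<^sub>v\<^sup>2 / dp * (W x - W y))"
      using rel_step_bounds[of l] by (intro mult_left_mono) auto
    moreover have "rel_step p l * (\<sigma>\<^sub>v\<^sup>2 / dp * (W x - W y)) = \<sigma>\<^sub>v\<^sup>2 * (W x - W y) / p (Suc l)"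
      using dp by (simp add: rel_step_p_eq flip: dp_def)
    moreover have "z (Suc l) = (1 - rel_step p l) * z l + \<sigma>\<^sub>v\<^sup>2 * (W x - W y) / p (Suc l)"
    proof -
      have "z (Suc l) = (\<gamma> x l - \<gamma> y l) / p (Suc l) + \<sigma>\<^sub>v\<^sup>2 * (W x - W y) / p (Suc l)"
        by (simp add: z_def e_def \<gamma>_Suc W_def add_divide_distrib diff_divide_distrib right_diff_distrib)
      moreover have "(1 - rel_step p l) * z l = (\<gamma> x l - \<gamma> y l) / p (Suc l)"
        using p_gt_0[of l] by (simp add: rel_step_def z_def e_def diff_divide_distrib right_diff_distrib)
      ultimately show ?thesis
        by simp
    qed
    moreover have "(1 - k * rel_step p l) * z l = (1 - rel_step p l) * z l + rel_step p l * ((1 - k) * z l)"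
      by (simp add: algebra_simps)
    ultimately show ?case
      by simp
  qed
  then obtain L1 where L1: "\<And>l. L1 \<le> l \<Longrightarrow> (1 - k * rel_step p l) * z l \<le> z (Suc l)"
    unfolding eventually_sequentially by blast
  from powr_lower_bound_propagates[OF k(1,3)] obtain L2 where L2: "\<forall>x m. \<forall>n\<ge>L2. 0 < m \<longrightarrow>
    (\<forall>l\<ge>n. (1 - k * rel_step p l) * x l
       - rel_step p l * ((\<eta> - k) / 2 * (m * p l powr - \<eta>)) \<le> x (Suc l)) \<longrightarrow>
    m * p n powr - \<eta> \<le> x n \<longrightarrow> (\<forall>l\<ge>n. m * p l powr - \<eta> \<le> x l)" .
  define n where "n = max L1 L2"
  define m where "m = z n / p n powr - \<eta>"
  have m: "0 < m" "m * p n powr - \<eta> \<le> z n"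
    using z_pos[of n] p_gt_0[of n] by (simp_all add: m_def)
  have "(1 - k * rel_step p l) * z l - rel_step p l * ((\<eta> - k) / 2 * (m * p l powr - \<eta>)) \<le> z (Suc l)"
    if "n \<le> l" for l
  proof -
    have "0 \<le> rel_step p l * ((\<eta> - k) / 2 * (m * p l powr - \<eta>))"
      using rel_step_bounds[of l] k m by (intro mult_nonneg_nonneg) auto
    then show ?thesis
      using L1[of l] that by (simp add: n_def)
  qed
  moreover have "L2 \<le> n"
    by (simp add: n_def)
  ultimately have "\<forall>l\<ge>n. m * p l powr - \<eta> \<le> z l"
    using L2[THEN spec[of _ z], THEN spec[of _ m]] m by blast
  then have "eventually (\<lambda>l. m * p l powr - \<eta> \<le> e x l - e y l) sequentially"
    unfolding eventually_sequentially z_def by blast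
  then show thesis
    by (rule that[OF m(1)])
qed

text \<open>At an exponent strictly between \<delta> and \<eta> the trajectories separate, whereas
  the triangle inequality keeps them within \<open>2 * p l powr - \<eta>\<close> of each
  other.\<close>

lemma not_both_fast:
  assumes "admissible x" "admissible y" "y < x" "\<delta> < \<eta>"
    and fx: "eventually (\<lambda>l. \<bar>e x l - estar\<bar> < p l powr - \<eta>) sequentially"
    and fy: "eventually (\<lambda>l. \<bar>e y l - estar\<bar> < p l powr - \<eta>) sequentially"
  shows False
proof -
  define \<eta>' where "\<eta>' = (\<delta> + \<eta>) / 2"
  have \<eta>': "\<delta> < \<eta>'" "\<eta>' < \<eta>"
    using assms by (auto simp: \<eta>'_def)
  from trajectories_separate[OF assms(1-3) \<eta>'(1)]
  obtain m where m: "0 < m" "eventually (\<lambda>l. m * p l powr - \<eta>' \<le> e x l - e y l) sequentially" .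
  have "(\<lambda>l. p l powr - (\<eta> - \<eta>')) \<longlonglongrightarrow> 0"
    using \<eta>' by (intro powr_neg_tendsto_0) auto
  then have "eventually (\<lambda>l. p l powr - (\<eta> - \<eta>') < m / 2) sequentially"
    using m by (intro order_tendstoD(2)) auto
  then have "eventually (\<lambda>l. False) sequentially"
    using fx fy m(2)
  proof eventually_elim
    case (elim l)
    have "p l powr - \<eta> = p l powr - (\<eta> - \<eta>') * p l powr - \<eta>'"
      by (simp flip: powr_add)
    also have "\<dots> \<le> m / 2 * p l powr - \<eta>'"
      using elim(1) by (intro mult_right_mono) auto
    finally have "2 * p l powr - \<eta> \<le> m * p l powr - \<eta>'"
      by simp
    then show ?case
      using elim by linarith
  qed
  then show False
    by simp
qed

lemma p_powr_bigtheta: "(\<lambda>l. p l powr a) \<in> \<Theta>(\<lambda>l. real l powr a)"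
  using bigtheta_powr[OF p_bigtheta, of a] less_imp_le[OF p_gt_0] by simp

lemma real_powr_bigo: "a \<le> b \<Longrightarrow> (\<lambda>l. real l powr a) \<in> O(\<lambda>l. real l powr b)"
  by (intro bigoI[of _ 1] eventually_sequentiallyI[of 1]) (auto intro: powr_mono)

lemma check_O_dist:
  assumes "admissible x"
  shows "check_O (\<lambda>l. \<bar>e x l - estar\<bar>) (\<lambda>l. real l powr - \<delta>)"
  unfolding check_O_def
proof (intro allI impI)
  fix \<epsilon> :: real
  assume "0 < \<epsilon>"
  define \<epsilon>' where "\<epsilon>' = min \<epsilon> \<delta>"
  have \<epsilon>': "0 < \<epsilon>'" "\<epsilon>' \<le> \<delta>" "\<epsilon>' \<le> \<epsilon>"
    using \<open>0 < \<epsilon>\<close> \<delta>_pos by (auto simp: \<epsilon>'_def)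
  from dist_upper[OF assms \<epsilon>'(1,2)]
  obtain M where "eventually (\<lambda>l. \<bar>e x l - estar\<bar> \<le> M * p l powr - (\<delta> - \<epsilon>')) sequentially" .
  then have "(\<lambda>l. \<bar>e x l - estar\<bar>) \<in> O(\<lambda>l. p l powr - (\<delta> - \<epsilon>'))"
    by (intro bigoI[of _ M]) simp
  also have "(\<lambda>l. p l powr - (\<delta> - \<epsilon>')) \<in> \<Theta>(\<lambda>l. real l powr - (\<delta> - \<epsilon>'))"
    by (rule p_powr_bigtheta)
  also have "(\<lambda>l. real l powr - (\<delta> - \<epsilon>')) \<in> O(\<lambda>l. real l powr (- \<delta> + \<epsilon>))"
    using \<epsilon>' by (intro real_powr_bigo) auto
  finally show "(\<lambda>l. \<bar>e x l - estar\<bar>) \<in> O(\<lambda>l. real l powr - \<delta> * real l powr \<epsilon>)"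
    by (simp only: powr_add)
qed

text \<open>Failure of the lower bound is a priori only a statement about a subsequence; the
  dichotomy upgrades it to a faster power at all late layers.\<close>

lemma fast_if_not_check_Omega:
  assumes x: "admissible x" and "\<not> check_Omega (\<lambda>l. \<bar>e x l - estar\<bar>) (\<lambda>l. real l powr - \<delta>)"
  obtains \<eta> where "\<delta> < \<eta>" "eventually (\<lambda>l. \<bar>e x l - estar\<bar> < p l powr - \<eta>) sequentially"
proof -
  obtain \<epsilon> where \<epsilon>: "0 < \<epsilon>"
    "(\<lambda>l. \<bar>e x l - estar\<bar>) \<notin> \<Omega>(\<lambda>l. real l powr - \<delta> * real l powr - \<epsilon>)"
    using assms(2) unfolding check_Omega_def by blast
  \<comment> \<open>At most \<open>\<delta> + \<epsilon>\<close> to contradict the assumed failure,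
    and below 1 / 2 because the dichotomy requires it.\<close>
  define \<eta> where "\<eta> = min (\<delta> + \<epsilon>) ((\<delta> + 1 / 2) / 2)"
  have \<eta>: "\<delta> < \<eta>" "\<eta> < 1 / 2" "\<eta> \<le> \<delta> + \<epsilon>"
    using \<epsilon>(1) \<delta>_lt by (auto simp: \<eta>_def min_def)
  have "\<not> eventually (\<lambda>l. p l powr - \<eta> \<le> \<bar>e x l - estar\<bar>) sequentially"
  proof
    assume "eventually (\<lambda>l. p l powr - \<eta> \<le> \<bar>e x l - estar\<bar>) sequentially"
    then have p_le: "(\<lambda>l. p l powr - \<eta>) \<in> O(\<lambda>l. \<bar>e x l - estar\<bar>)"
      by (intro bigoI[of _ 1]) simp
    have "(\<lambda>l. real l powr (- \<delta> + - \<epsilon>)) \<in> O(\<lambda>l. real l powr - \<eta>)"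
      using \<eta> by (intro real_powr_bigo) auto
    also have "(\<lambda>l. real l powr - \<eta>) \<in> \<Theta>(\<lambda>l. p l powr - \<eta>)"
      using p_powr_bigtheta by (simp only: bigtheta_sym)
    also note p_le
    finally have "(\<lambda>l. \<bar>e x l - estar\<bar>) \<in> \<Omega>(\<lambda>l. real l powr - \<delta> * real l powr - \<epsilon>)"
      by (simp only: bigomega_iff_bigo powr_add)
    then show False
      using \<epsilon>(2) by contradiction
  qed
  then have "eventually (\<lambda>l. \<bar>e x l - estar\<bar> < p l powr - \<eta>) sequentially"
    using dist_dichotomy[OF x \<eta>(1,2)] by blast
  then show thesis
    by (rule that[OF \<eta>(1)])
qed

lemma check_Omega_except_one:
  "\<exists>exc. \<forall>x. admissible x \<and> x \<noteq> exc \<longrightarrow> check_Omega (\<lambda>l. \<bar>e x l - estar\<bar>) (\<lambda>l. real l powr - \<delta>)"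
proof -
  have unique: "\<not> x < y"
    if x: "admissible x" "\<not> check_Omega (\<lambda>l. \<bar>e x l - estar\<bar>) (\<lambda>l. real l powr - \<delta>)"
      and y: "admissible y" "\<not> check_Omega (\<lambda>l. \<bar>e y l - estar\<bar>) (\<lambda>l. real l powr - \<delta>)" for x y
  proof
    assume "x < y"
    from fast_if_not_check_Omega[OF x]
    obtain \<eta>x where \<eta>x: "\<delta> < \<eta>x" "eventually (\<lambda>l. \<bar>e x l - estar\<bar> < p l powr - \<eta>x) sequentially" .
    from fast_if_not_check_Omega[OF y]
    obtain \<eta>y where \<eta>y: "\<delta> < \<eta>y" "eventually (\<lambda>l. \<bar>e y l - estar\<bar> < p l powr - \<eta>y) sequentially" .
    define \<eta> where "\<eta> = min \<eta>x \<eta>y"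
    have p1: "eventually (\<lambda>l. 1 \<le> p l) sequentially"
      using p_at_top by (simp add: filterlim_at_top)
    have "eventually (\<lambda>l. \<bar>e x l - estar\<bar> < p l powr - \<eta>) sequentially"
      using p1 \<eta>x(2)
    proof eventually_elim
      case (elim l)
      have "p l powr - \<eta>x \<le> p l powr - \<eta>"
        using elim by (intro powr_mono) (auto simp: \<eta>_def)
      then show ?case
        using elim by linarith
    qed
    moreover have "eventually (\<lambda>l. \<bar>e y l - estar\<bar> < p l powr - \<eta>) sequentially"
      using p1 \<eta>y(2)
    proof eventually_elim
      case (elim l)
      have "p l powr - \<eta>y \<le> p l powr - \<eta>"
        using elim by (intro powr_mono) (auto simp: \<eta>_def)
      then show ?case
        using elim by linarith
    qed
    moreover have "\<delta> < \<eta>"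
      using \<eta>x \<eta>y by (simp add: \<eta>_def)
    ultimately show False
      using not_both_fast[OF y(1) x(1) \<open>x < y\<close>] by blast
  qed
  show ?thesis
  proof (cases "\<exists>x. admissible x \<and> \<not> check_Omega (\<lambda>l. \<bar>e x l - estar\<bar>) (\<lambda>l. real l powr - \<delta>)")
    case True
    then obtain exc where exc: "admissible exc" "\<not> check_Omega (\<lambda>l. \<bar>e exc l - estar\<bar>) (\<lambda>l. real l powr - \<delta>)"
      by blast
    then have "check_Omega (\<lambda>l. \<bar>e x l - estar\<bar>) (\<lambda>l. real l powr - \<delta>)" if "admissible x" "x \<noteq> exc" for x
      using unique[OF exc that(1)] unique[OF that(1) _ exc] that(2) by (cases x exc rule: linorder_cases) auto
    then show ?thesis
      by blast
  qed blast
qed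

end

section \<open>The case of zero weights and the assembly\<close>

lemma frn_inputs_bounds:
  fixes x x' :: "real ^ 'n"
  assumes "frn_inputs x x' p0 \<gamma>0"
  shows "\<bar>\<gamma>0\<bar> \<le> p0"
proof -
  let ?n = "real CARD('n)"
  have h: "p0 = (norm x)\<^sup>2 / ?n" "p0 = (norm x')\<^sup>2 / ?n" "\<gamma>0 = (x \<bullet> x') / ?n"
    using assms by (auto simp: frn_inputs_def)
  then have "(norm x)\<^sup>2 = (norm x')\<^sup>2"
    by simp
  then have "norm x = norm x'"
    by simp
  then have "\<bar>x \<bullet> x'\<bar> \<le> (norm x)\<^sup>2"
    using Cauchy_Schwarz_ineq2[of x x'] by (simp add: power2_eq_square)
  then show ?thesis
    unfolding h(1,3) by (simp add: abs_divide divide_right_mono)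
qed

lemma frn_closed_forms_of_zero_weight:
  "frn_p \<phi> \<sigma>\<^sub>v \<sigma>\<^sub>a 0 \<sigma>\<^sub>b p0 l = real l * (\<sigma>\<^sub>v\<^sup>2 * Vt \<phi> (\<sigma>\<^sub>b\<^sup>2) + \<sigma>\<^sub>a\<^sup>2) + p0"
  "frn_gamma \<phi> \<sigma>\<^sub>v \<sigma>\<^sub>a 0 \<sigma>\<^sub>b p0 \<gamma>0 l = real l * (\<sigma>\<^sub>v\<^sup>2 * Wt \<phi> (\<sigma>\<^sub>b\<^sup>2) (\<sigma>\<^sub>b\<^sup>2) + \<sigma>\<^sub>a\<^sup>2) + \<gamma>0"
  by (induction l) (simp_all add: frn_q_def algebra_simps)

lemma Vt_tanh_pos:
  assumes "0 < q"
  shows "0 < Vt tanh q"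
proof -
  obtain \<kappa> where \<kappa>: "\<kappa> > 0"
    "\<And>q \<nu>. \<bar>\<nu>\<bar> \<le> q \<Longrightarrow> 0 < q \<Longrightarrow> \<kappa> * (tanh (sqrt ((q - \<nu>) / 2) / 2))\<^sup>2 * sqrt ((q - \<nu>) / q)
       \<le> Vt tanh q - Wt tanh q \<nu>"
    by (rule Vt_minus_Wt_tanh_ge) (rule that; blast)
  have "0 < \<kappa> * (tanh (sqrt ((q - - q) / 2) / 2))\<^sup>2 * sqrt ((q - - q) / q)"
    using \<kappa>(1) assms by simp
  also have "\<dots> \<le> Vt tanh q - Wt tanh q (- q)"
    using assms by (intro \<kappa>(2)) auto
  also have "\<dots> = 2 * Vt tanh q"
    by (simp add: Wt_tanh_minus Wt_tanh_diag_eq_Vt)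
  finally show ?thesis
    by simp
qed

text \<open>Without weights the preactivations of both inputs are the common bias, so
  \<open>p\<close> and \<gamma> grow by the same constant \<open>C\<close> and their difference
  never changes. The side condition on the deviations amounts to \<open>0 < C\<close>; if
  \<open>C\<close> vanishes, the correlation is constant.\<close>

lemma zero_weight_case:
  fixes \<sigma>\<^sub>v \<sigma>\<^sub>a \<sigma>\<^sub>b p0 \<gamma>0 :: real
  defines "p \<equiv> frn_p tanh \<sigma>\<^sub>v \<sigma>\<^sub>a 0 \<sigma>\<^sub>b p0"
    and "e \<equiv> frn_e tanh \<sigma>\<^sub>v \<sigma>\<^sub>a 0 \<sigma>\<^sub>b p0 \<gamma>0"
    and "s \<equiv> frn_s tanh \<sigma>\<^sub>v \<sigma>\<^sub>a 0 \<sigma>\<^sub>b p0 \<gamma>0"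
  assumes "0 \<le> \<sigma>\<^sub>v" "0 \<le> \<sigma>\<^sub>a" "0 \<le> \<sigma>\<^sub>b" "0 < p0" "e 0 < 1"
  shows "\<sigma>\<^sub>a > 0 \<or> (\<sigma>\<^sub>v > 0 \<and> \<sigma>\<^sub>b > 0) \<Longrightarrow>
      e \<longlonglongrightarrow> 1 \<and> (\<lambda>l. 1 - e l) \<in> \<Theta>(\<lambda>l. 1 / real l)"
    and "s l = p l * (1 - e l)"
    and "s \<in> \<Theta>(\<lambda>l. 1)"
proof -
  define C where "C = \<sigma>\<^sub>v\<^sup>2 * Vt tanh (\<sigma>\<^sub>b\<^sup>2) + \<sigma>\<^sub>a\<^sup>2"
  have V: "0 \<le> Vt tanh (\<sigma>\<^sub>b\<^sup>2)"
    by (simp add: Vt_def)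
  have C: "0 \<le> C"
    using V by (simp add: C_def)
  have p: "p l = real l * C + p0" for l
    by (simp add: p_def C_def frn_closed_forms_of_zero_weight)
  have p_pos: "0 < p l" for l
    using C \<open>0 < p0\<close> unfolding p by (intro add_nonneg_pos) simp_all
  have s: "s l = p0 - \<gamma>0" for l
    by (simp add: s_def frn_s_def frn_closed_forms_of_zero_weight Wt_tanh_diag_eq_Vt)
  have "\<gamma>0 < p0"
    using assms by (simp add: e_def frn_e_def)
  show se: "s l = p l * (1 - e l)" for l
    using p_pos[of l] by (simp add: s_def frn_s_def e_def frn_e_def p_def right_diff_distrib)
  have one_minus_e: "1 - e l = (p0 - \<gamma>0) / p l" for l
    using se[of l] p_pos[of l] by (simp add: s)
  show "s \<in> \<Theta>(\<lambda>l. 1)"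
    using \<open>\<gamma>0 < p0\<close> by (intro bigthetaI'[of "p0 - \<gamma>0" "p0 - \<gamma>0"]) (auto simp: s)
  assume "\<sigma>\<^sub>a > 0 \<or> (\<sigma>\<^sub>v > 0 \<and> \<sigma>\<^sub>b > 0)"
  then have "0 < C"
    using V Vt_tanh_pos[of "\<sigma>\<^sub>b\<^sup>2"] by (auto simp: C_def intro: add_nonneg_pos add_pos_nonneg)
  have theta: "(\<lambda>l. 1 - e l) \<in> \<Theta>(\<lambda>l. 1 / real l)"
  proof (rule bigthetaI')
    show "0 < (p0 - \<gamma>0) / (C + p0)" "0 < (p0 - \<gamma>0) / C"
      using \<open>\<gamma>0 < p0\<close> \<open>0 < C\<close> assms by auto
    show "eventually (\<lambda>l. (p0 - \<gamma>0) / (C + p0) * norm (1 / real l) \<le> norm (1 - e l) \<and>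
        norm (1 - e l) \<le> (p0 - \<gamma>0) / C * norm (1 / real l)) sequentially"
      using eventually_ge_at_top[of 1]
    proof eventually_elim
      case (elim l)
      have "C * real l \<le> p l"
        using \<open>0 < p0\<close> by (simp add: p mult.commute)
      moreover have "p l \<le> (C + p0) * real l"
      proof -
        have "p0 * 1 \<le> p0 * real l"
          using elim \<open>0 < p0\<close> by (intro mult_left_mono) auto
        then show ?thesis
          unfolding p distrib_right mult.commute[of C] by linarith
      qed
      ultimately have "(p0 - \<gamma>0) / ((C + p0) * real l) \<le> (p0 - \<gamma>0) / p l"
        "(p0 - \<gamma>0) / p l \<le> (p0 - \<gamma>0) / (C * real l)"
        using \<open>\<gamma>0 < p0\<close> \<open>0 < C\<close> \<open>0 < p0\<close> p_pos[of l] elim by (intro divide_left_mono mult_pos_pos; simp)+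
      moreover have "norm (1 - e l) = (p0 - \<gamma>0) / p l"
        unfolding one_minus_e using p_pos[of l] \<open>\<gamma>0 < p0\<close> by simp
      ultimately show ?case
        by simp
    qed
  qed
  have "(\<lambda>l. 1 - e l) \<in> o(\<lambda>l. 1 :: real)"
  proof (rule landau_o.big_small_trans)
    show "(\<lambda>l. 1 - e l) \<in> O(\<lambda>l. 1 / real l)"
      using theta by blast
    show "(\<lambda>l. 1 / real l) \<in> o(\<lambda>l. 1 :: real)"
      using lim_1_over_n by (intro smalloI_tendsto) auto
  qed
  from smalloD_tendsto[OF this] have "(\<lambda>l. 1 - e l) \<longlonglongrightarrow> 0"
    by simp
  from tendsto_diff[OF tendsto_const[of 1] this]
  have "e \<longlonglongrightarrow> 1"
    by simp
  with theta show "e \<longlonglongrightarrow> 1 \<and> (\<lambda>l. 1 - e l) \<in> \<Theta>(\<lambda>l. 1 / real l)"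
    by simp
qed

lemma (in tanh_frn) estar_exists:
  obtains estar g where "tanh_frn_root \<sigma>\<^sub>v \<sigma>\<^sub>a \<sigma>\<^sub>w \<sigma>\<^sub>b p0 estar (frn_delta \<sigma>\<^sub>v \<sigma>\<^sub>a estar) g"
    "\<forall>t. (-1 \<le> t \<and> t \<le> 1 \<and> t \<noteq> 1 \<and> (\<sigma>\<^sub>a = 0 \<longrightarrow> t \<noteq> -1) \<and> frn_fixpoint \<sigma>\<^sub>v \<sigma>\<^sub>a t) \<longleftrightarrow> t = estar"
    "frn_delta \<sigma>\<^sub>v \<sigma>\<^sub>a estar \<in> {1 - 2 / pi ..< 1 / 2}"
proof -
  obtain estar where root: "0 \<le> estar" "estar < 1" "corr_drift \<alpha> estar = 0"
    and up: "\<And>t. -1 < t \<Longrightarrow> t < estar \<Longrightarrow> 0 < corr_drift \<alpha> t"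
    and down: "\<And>t. estar < t \<Longrightarrow> t < 1 \<Longrightarrow> corr_drift \<alpha> t < 0"
    and \<delta>: "1 - 2 / pi \<le> 1 - 2 / pi * (1 / sqrt (1 - estar\<^sup>2)) * \<alpha>"
      "1 - 2 / pi * (1 / sqrt (1 - estar\<^sup>2)) * \<alpha> < 1 / 2"
  proof (rule corr_drift_root[OF \<alpha>_bounds])
    fix estar
    assume "0 \<le> estar" "estar < 1" "corr_drift \<alpha> estar = 0"
      and "\<And>t. -1 < t \<Longrightarrow> t < estar \<Longrightarrow> 0 < corr_drift \<alpha> t"
      and "\<And>t. estar < t \<Longrightarrow> t < 1 \<Longrightarrow> corr_drift \<alpha> t < 0"
      and "1 - 2 / pi \<le> 1 - 2 / pi * (1 / sqrt (1 - estar\<^sup>2)) * \<alpha>"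
        "1 - 2 / pi * (1 / sqrt (1 - estar\<^sup>2)) * \<alpha> < 1 / 2"
    then show thesis
      by (rule that)
  qed
  define \<delta> where "\<delta> = frn_delta \<sigma>\<^sub>v \<sigma>\<^sub>a estar"
  have \<delta>_eq: "\<delta> = 1 - 2 / pi * (1 / sqrt (1 - estar\<^sup>2)) * \<alpha>"
    by (simp add: \<delta>_def frn_delta_def \<alpha>_def p_slope_def)
  have "2 / pi < 1"
    using pi_gt3 by simp
  then have \<delta>_bounds: "0 < \<delta>" "\<delta> < 1 / 2" "1 - 2 / pi \<le> \<delta>"
    using \<delta> unfolding \<delta>_eq by linarith+
  obtain g where g: "\<And>t. corr_drift \<alpha> t = g t * (t - estar)" "continuous_on {-1<..<1} g"
      "g estar = - \<delta>" "\<And>t. \<bar>t\<bar> < 1 \<Longrightarrow> g t < 0"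
  proof (rule corr_drift_factor[OF root])
    show "0 < corr_drift \<alpha> t" if "-1 < t" "t < estar" for t
      using that by (rule up)
    show "corr_drift \<alpha> t < 0" if "estar < t" "t < 1" for t
      using that by (rule down)
    show "0 < 1 - 2 / pi * (1 / sqrt (1 - estar\<^sup>2)) * \<alpha>"
      using \<delta>_bounds(1) unfolding \<delta>_eq .
    fix g
    assume "\<And>t. corr_drift \<alpha> t = g t * (t - estar)" "continuous_on {-1<..<1} g"
      "g estar = - (1 - 2 / pi * (1 / sqrt (1 - estar\<^sup>2)) * \<alpha>)" "\<And>t. \<bar>t\<bar> < 1 \<Longrightarrow> g t < 0"
    then show thesis
      by (rule that[unfolded \<delta>_eq])
  qed
  have fix_iff: "frn_fixpoint \<sigma>\<^sub>v \<sigma>\<^sub>a t \<longleftrightarrow> corr_drift \<alpha> t = 0" for t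
  proof -
    have "1 / (\<sigma>\<^sub>v\<^sup>2 + \<sigma>\<^sub>a\<^sup>2) * (\<sigma>\<^sub>v\<^sup>2 * (2 / pi) * arcsin t + \<sigma>\<^sub>a\<^sup>2) =
        (\<sigma>\<^sub>v\<^sup>2 * (2 / pi * arcsin t) + \<sigma>\<^sub>a\<^sup>2) / (\<sigma>\<^sub>v\<^sup>2 + \<sigma>\<^sub>a\<^sup>2)"
      by simp
    then show ?thesis
      unfolding frn_fixpoint_def corr_drift_eq p_slope_def right_minus_eq by (simp only: eq_commute[of t])
  qed
  \<comment> \<open>The drift at -1 equals 2 - 2 \<alpha>, so -1 solves the equation only if
    \<open>\<sigma>\<^sub>a\<close> vanishes; this is the case in which the uniqueness claim leaves
    it out.\<close>
  have at_minus_1: "\<sigma>\<^sub>a = 0" if "corr_drift \<alpha> (- 1) = 0"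
  proof -
    have "\<alpha> = 1"
      using that by (simp add: corr_drift_def)
    then have "\<sigma>\<^sub>v\<^sup>2 = p_slope"
      using p_slope_pos by (simp add: \<alpha>_def)
    then show ?thesis
      by (simp add: p_slope_def)
  qed
  show thesis
  proof (rule that)
    show "tanh_frn_root \<sigma>\<^sub>v \<sigma>\<^sub>a \<sigma>\<^sub>w \<sigma>\<^sub>b p0 estar (frn_delta \<sigma>\<^sub>v \<sigma>\<^sub>a estar) g"
      unfolding \<delta>_def[symmetric]
      by (intro tanh_frn_root.intro tanh_frn_root_axioms.intro tanh_frn_axioms root(1,2) g \<delta>_bounds(1,2) \<delta>_eq)
    show "frn_delta \<sigma>\<^sub>v \<sigma>\<^sub>a estar \<in> {1 - 2 / pi ..< 1 / 2}"
      using \<delta>_bounds by (simp add: \<delta>_def)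
    show "\<forall>t. (-1 \<le> t \<and> t \<le> 1 \<and> t \<noteq> 1 \<and> (\<sigma>\<^sub>a = 0 \<longrightarrow> t \<noteq> -1) \<and> frn_fixpoint \<sigma>\<^sub>v \<sigma>\<^sub>a t) \<longleftrightarrow> t = estar"
    proof (intro allI iffI)
      fix t
      assume t: "-1 \<le> t \<and> t \<le> 1 \<and> t \<noteq> 1 \<and> (\<sigma>\<^sub>a = 0 \<longrightarrow> t \<noteq> -1) \<and> frn_fixpoint \<sigma>\<^sub>v \<sigma>\<^sub>a t"
      then have zero: "corr_drift \<alpha> t = 0"
        by (simp add: fix_iff)
      then have "t \<noteq> -1"
        using at_minus_1 t by auto
      then show "t = estar"
        using up[of t] down[of t] zero t by (cases t estar rule: linorder_cases) auto
    next
      fix t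
      assume "t = estar"
      then show "-1 \<le> t \<and> t \<le> 1 \<and> t \<noteq> 1 \<and> (\<sigma>\<^sub>a = 0 \<longrightarrow> t \<noteq> -1) \<and> frn_fixpoint \<sigma>\<^sub>v \<sigma>\<^sub>a t"
        using root by (simp add: fix_iff)
    qed
  qed
qed

lemma (in tanh_frn) s_bigtheta:
  assumes "\<bar>x\<bar> \<le> p0" "x < p0"
  shows "(\<lambda>l. p l - \<gamma> x l) \<in> \<Theta>(p)"
proof -
  obtain m where m: "0 < m" "\<And>l. m * p l \<le> p l - \<gamma> x l"
    using p_minus_\<gamma>_ge[OF assms] by blast
  have "m * norm (p l) \<le> norm (p l - \<gamma> x l) \<and> norm (p l - \<gamma> x l) \<le> 2 * norm (p l)" for l
    using m(2)[of l] abs_\<gamma>_le[OF assms(1), of l] p_gt_0[of l] by (simp add: abs_le_iff)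
  then show ?thesis
    using m(1) by (intro bigthetaI'[of m 2]) auto
qed

theorem theoremB11:
  fixes \<sigma>\<^sub>v \<sigma>\<^sub>a \<sigma>\<^sub>w \<sigma>\<^sub>b p0 :: real
    and p :: "nat \<Rightarrow> real"
    and \<gamma> lam e s :: "real \<Rightarrow> nat \<Rightarrow> real"
  defines "p \<equiv> frn_p tanh \<sigma>\<^sub>v \<sigma>\<^sub>a \<sigma>\<^sub>w \<sigma>\<^sub>b p0"
    and "\<gamma> \<equiv> frn_gamma tanh \<sigma>\<^sub>v \<sigma>\<^sub>a \<sigma>\<^sub>w \<sigma>\<^sub>b p0"
    and "lam \<equiv> frn_lambda tanh \<sigma>\<^sub>v \<sigma>\<^sub>a \<sigma>\<^sub>w \<sigma>\<^sub>b p0"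
    and "e \<equiv> frn_e tanh \<sigma>\<^sub>v \<sigma>\<^sub>a \<sigma>\<^sub>w \<sigma>\<^sub>b p0"
    and "s \<equiv> frn_s tanh \<sigma>\<^sub>v \<sigma>\<^sub>a \<sigma>\<^sub>w \<sigma>\<^sub>b p0"
  assumes "\<sigma>\<^sub>v \<ge> 0" "\<sigma>\<^sub>a \<ge> 0" "\<sigma>\<^sub>w \<ge> 0" "\<sigma>\<^sub>b \<ge> 0" "p0 > 0"
  shows
    "(\<sigma>\<^sub>w = 0 \<longrightarrow>
       (\<forall>(x :: real ^ 'n) x' \<gamma>0. frn_inputs x x' p0 \<gamma>0 \<and> e \<gamma>0 0 < 1 \<longrightarrow>
          (\<forall>l\<ge>1. lam \<gamma>0 l = \<sigma>\<^sub>b\<^sup>2) \<and>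
          (\<forall>l. \<gamma> \<gamma>0 l = real l * (\<sigma>\<^sub>v\<^sup>2 * Wt tanh (\<sigma>\<^sub>b\<^sup>2) (\<sigma>\<^sub>b\<^sup>2) + \<sigma>\<^sub>a\<^sup>2) + \<gamma>0) \<and>
          (\<forall>l. \<gamma> \<gamma>0 l = real l * (\<sigma>\<^sub>v\<^sup>2 * Vt tanh (\<sigma>\<^sub>b\<^sup>2) + \<sigma>\<^sub>a\<^sup>2) + \<gamma>0) \<and>
          (\<sigma>\<^sub>a > 0 \<or> (\<sigma>\<^sub>v > 0 \<and> \<sigma>\<^sub>b > 0) \<longrightarrow>
             e \<gamma>0 \<longlonglongrightarrow> 1 \<and> (\<lambda>l. 1 - e \<gamma>0 l) \<in> \<Theta>(\<lambda>l. 1 / real l)) \<and>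
          (\<forall>l. s \<gamma>0 l = p l * (1 - e \<gamma>0 l)) \<and>
          s \<gamma>0 \<in> \<Theta>(\<lambda>l. 1)))
     \<and>
     (\<sigma>\<^sub>w > 0 \<and> \<sigma>\<^sub>v > 0 \<longrightarrow>
       (\<exists>estar.
          (\<forall>t. (-1 \<le> t \<and> t \<le> 1 \<and> t \<noteq> 1 \<and> (\<sigma>\<^sub>a = 0 \<longrightarrow> t \<noteq> -1) \<and> frn_fixpoint \<sigma>\<^sub>v \<sigma>\<^sub>a t)
                 \<longleftrightarrow> t = estar) \<and>
          frn_delta \<sigma>\<^sub>v \<sigma>\<^sub>a estar \<in> {1 - 2 / pi ..< 1 / 2} \<and>
          (\<forall>(x :: real ^ 'n) x' \<gamma>0. frn_inputs x x' p0 \<gamma>0 \<and> e \<gamma>0 0 < 1 \<longrightarrow>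
             (\<not> (\<sigma>\<^sub>a = 0 \<and> \<sigma>\<^sub>b = 0 \<and> e \<gamma>0 0 = -1) \<longrightarrow>
                e \<gamma>0 \<longlonglongrightarrow> estar \<and>
                check_O (\<lambda>l. \<bar>e \<gamma>0 l - estar\<bar>) (\<lambda>l. real l powr (- frn_delta \<sigma>\<^sub>v \<sigma>\<^sub>a estar))) \<and>
             s \<gamma>0 \<in> \<Theta>(p) \<and> p \<in> \<Theta>(\<lambda>l. real l) \<and> s \<gamma>0 \<in> \<Theta>(\<lambda>l. real l)) \<and>
          (\<exists>\<gamma>exc. \<forall>(x :: real ^ 'n) x' \<gamma>0. frn_inputs x x' p0 \<gamma>0 \<and> e \<gamma>0 0 < 1 \<and>
             \<not> (\<sigma>\<^sub>a = 0 \<and> \<sigma>\<^sub>b = 0 \<and> e \<gamma>0 0 = -1) \<and> \<gamma>0 \<noteq> \<gamma>exc \<longrightarrow>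
             check_Theta (\<lambda>l. \<bar>e \<gamma>0 l - estar\<bar>) (\<lambda>l. real l powr (- frn_delta \<sigma>\<^sub>v \<sigma>\<^sub>a estar)))))"
proof -
  have p0: "0 < p0"
    by fact
  show ?thesis
  proof (intro conjI impI)
    assume "\<sigma>\<^sub>w = 0"
    note defs = p_def[unfolded \<open>\<sigma>\<^sub>w = 0\<close>] \<gamma>_def[unfolded \<open>\<sigma>\<^sub>w = 0\<close>] lam_def[unfolded \<open>\<sigma>\<^sub>w = 0\<close>]
      e_def[unfolded \<open>\<sigma>\<^sub>w = 0\<close>] s_def[unfolded \<open>\<sigma>\<^sub>w = 0\<close>]
    show "\<forall>(x :: real ^ 'n) x' \<gamma>0. frn_inputs x x' p0 \<gamma>0 \<and> e \<gamma>0 0 < 1 \<longrightarrow>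
          (\<forall>l\<ge>1. lam \<gamma>0 l = \<sigma>\<^sub>b\<^sup>2) \<and>
          (\<forall>l. \<gamma> \<gamma>0 l = real l * (\<sigma>\<^sub>v\<^sup>2 * Wt tanh (\<sigma>\<^sub>b\<^sup>2) (\<sigma>\<^sub>b\<^sup>2) + \<sigma>\<^sub>a\<^sup>2) + \<gamma>0) \<and>
          (\<forall>l. \<gamma> \<gamma>0 l = real l * (\<sigma>\<^sub>v\<^sup>2 * Vt tanh (\<sigma>\<^sub>b\<^sup>2) + \<sigma>\<^sub>a\<^sup>2) + \<gamma>0) \<and>
          (\<sigma>\<^sub>a > 0 \<or> (\<sigma>\<^sub>v > 0 \<and> \<sigma>\<^sub>b > 0) \<longrightarrow>
             e \<gamma>0 \<longlonglongrightarrow> 1 \<and> (\<lambda>l. 1 - e \<gamma>0 l) \<in> \<Theta>(\<lambda>l. 1 / real l)) \<and>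
          (\<forall>l. s \<gamma>0 l = p l * (1 - e \<gamma>0 l)) \<and>
          s \<gamma>0 \<in> \<Theta>(\<lambda>l. 1)"
    proof (intro allI impI)
      fix x x' :: "real ^ 'n" and \<gamma>0
      assume "frn_inputs x x' p0 \<gamma>0 \<and> e \<gamma>0 0 < 1"
      then have e0: "frn_e tanh \<sigma>\<^sub>v \<sigma>\<^sub>a 0 \<sigma>\<^sub>b p0 \<gamma>0 0 < 1"
        by (simp add: defs)
      note * = zero_weight_case[OF \<open>\<sigma>\<^sub>v \<ge> 0\<close> \<open>\<sigma>\<^sub>a \<ge> 0\<close> \<open>\<sigma>\<^sub>b \<ge> 0\<close> p0 e0]
      show "(\<forall>l\<ge>1. lam \<gamma>0 l = \<sigma>\<^sub>b\<^sup>2) \<and>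
          (\<forall>l. \<gamma> \<gamma>0 l = real l * (\<sigma>\<^sub>v\<^sup>2 * Wt tanh (\<sigma>\<^sub>b\<^sup>2) (\<sigma>\<^sub>b\<^sup>2) + \<sigma>\<^sub>a\<^sup>2) + \<gamma>0) \<and>
          (\<forall>l. \<gamma> \<gamma>0 l = real l * (\<sigma>\<^sub>v\<^sup>2 * Vt tanh (\<sigma>\<^sub>b\<^sup>2) + \<sigma>\<^sub>a\<^sup>2) + \<gamma>0) \<and>
          (\<sigma>\<^sub>a > 0 \<or> (\<sigma>\<^sub>v > 0 \<and> \<sigma>\<^sub>b > 0) \<longrightarrow>
             e \<gamma>0 \<longlonglongrightarrow> 1 \<and> (\<lambda>l. 1 - e \<gamma>0 l) \<in> \<Theta>(\<lambda>l. 1 / real l)) \<and>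
          (\<forall>l. s \<gamma>0 l = p l * (1 - e \<gamma>0 l)) \<and>
          s \<gamma>0 \<in> \<Theta>(\<lambda>l. 1)"
      proof (intro conjI allI impI)
        show "lam \<gamma>0 l = \<sigma>\<^sub>b\<^sup>2" for l
          by (simp add: defs frn_lambda_def)
        show "\<gamma> \<gamma>0 l = real l * (\<sigma>\<^sub>v\<^sup>2 * Wt tanh (\<sigma>\<^sub>b\<^sup>2) (\<sigma>\<^sub>b\<^sup>2) + \<sigma>\<^sub>a\<^sup>2) + \<gamma>0"
          "\<gamma> \<gamma>0 l = real l * (\<sigma>\<^sub>v\<^sup>2 * Vt tanh (\<sigma>\<^sub>b\<^sup>2) + \<sigma>\<^sub>a\<^sup>2) + \<gamma>0" for l
          by (simp_all add: defs frn_closed_forms_of_zero_weight Wt_tanh_diag_eq_Vt)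
        show "s \<gamma>0 l = p l * (1 - e \<gamma>0 l)" for l
          unfolding defs by (rule *(2))
        show "s \<gamma>0 \<in> \<Theta>(\<lambda>l. 1)"
          unfolding defs by (rule *(3))
        assume "\<sigma>\<^sub>a > 0 \<or> (\<sigma>\<^sub>v > 0 \<and> \<sigma>\<^sub>b > 0)"
        from *(1)[OF this] show "e \<gamma>0 \<longlonglongrightarrow> 1" "(\<lambda>l. 1 - e \<gamma>0 l) \<in> \<Theta>(\<lambda>l. 1 / real l)"
          unfolding defs by blast+
      qed
    qed
  next
    assume "\<sigma>\<^sub>w > 0 \<and> \<sigma>\<^sub>v > 0"
    then interpret N: tanh_frn \<sigma>\<^sub>v \<sigma>\<^sub>a \<sigma>\<^sub>w \<sigma>\<^sub>b p0
      using assms by unfold_locales auto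
    obtain estar g where root: "tanh_frn_root \<sigma>\<^sub>v \<sigma>\<^sub>a \<sigma>\<^sub>w \<sigma>\<^sub>b p0 estar (frn_delta \<sigma>\<^sub>v \<sigma>\<^sub>a estar) g"
      and unique: "\<forall>t. (-1 \<le> t \<and> t \<le> 1 \<and> t \<noteq> 1 \<and> (\<sigma>\<^sub>a = 0 \<longrightarrow> t \<noteq> -1) \<and> frn_fixpoint \<sigma>\<^sub>v \<sigma>\<^sub>a t) \<longleftrightarrow> t = estar"
      and \<delta>: "frn_delta \<sigma>\<^sub>v \<sigma>\<^sub>a estar \<in> {1 - 2 / pi ..< 1 / 2}"
      by (rule N.estar_exists)
    interpret R: tanh_frn_root \<sigma>\<^sub>v \<sigma>\<^sub>a \<sigma>\<^sub>w \<sigma>\<^sub>b p0 estar "frn_delta \<sigma>\<^sub>v \<sigma>\<^sub>a estar" g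
      by (rule root)
    have eqs: "p = N.p" "\<gamma> = N.\<gamma>" "e = N.e" "s \<gamma>0 = (\<lambda>l. N.p l - N.\<gamma> \<gamma>0 l)" for \<gamma>0
      by (auto simp: p_def \<gamma>_def e_def s_def N.p_def N.\<gamma>_def N.e_def frn_e_def frn_s_def fun_eq_iff)
    have e0: "N.e \<gamma>0 0 = \<gamma>0 / p0" for \<gamma>0
      by (simp add: N.e_def N.p_0 N.\<gamma>_0)
    have inputs: "\<bar>\<gamma>0\<bar> \<le> p0" "\<gamma>0 < p0"
      if "frn_inputs x x' p0 \<gamma>0 \<and> N.e \<gamma>0 0 < 1" for x x' :: "real ^ 'n" and \<gamma>0
      using that frn_inputs_bounds p0 by (auto simp: e0)
    have admissible: "N.admissible \<gamma>0"
      if "frn_inputs x x' p0 \<gamma>0 \<and> N.e \<gamma>0 0 < 1" "\<not> (\<sigma>\<^sub>a = 0 \<and> \<sigma>\<^sub>b = 0 \<and> N.e \<gamma>0 0 = -1)"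
      for x x' :: "real ^ 'n" and \<gamma>0
      using inputs[OF that(1)] that(2) p0 by (auto simp: N.admissible_def e0)
    \<comment> \<open>Chosen before the inputs: it depends only on the deviations and on
      \<open>p0\<close>.\<close>
    obtain exc where exc: "\<forall>x. N.admissible x \<and> x \<noteq> exc \<longrightarrow>
        check_Omega (\<lambda>l. \<bar>N.e x l - estar\<bar>) (\<lambda>l. real l powr - frn_delta \<sigma>\<^sub>v \<sigma>\<^sub>a estar)"
      using R.check_Omega_except_one by blast
    show "\<exists>estar.
          (\<forall>t. (-1 \<le> t \<and> t \<le> 1 \<and> t \<noteq> 1 \<and> (\<sigma>\<^sub>a = 0 \<longrightarrow> t \<noteq> -1) \<and> frn_fixpoint \<sigma>\<^sub>v \<sigma>\<^sub>a t)
                 \<longleftrightarrow> t = estar) \<and>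
          frn_delta \<sigma>\<^sub>v \<sigma>\<^sub>a estar \<in> {1 - 2 / pi ..< 1 / 2} \<and>
          (\<forall>(x :: real ^ 'n) x' \<gamma>0. frn_inputs x x' p0 \<gamma>0 \<and> e \<gamma>0 0 < 1 \<longrightarrow>
             (\<not> (\<sigma>\<^sub>a = 0 \<and> \<sigma>\<^sub>b = 0 \<and> e \<gamma>0 0 = -1) \<longrightarrow>
                e \<gamma>0 \<longlonglongrightarrow> estar \<and>
                check_O (\<lambda>l. \<bar>e \<gamma>0 l - estar\<bar>) (\<lambda>l. real l powr (- frn_delta \<sigma>\<^sub>v \<sigma>\<^sub>a estar))) \<and>
             s \<gamma>0 \<in> \<Theta>(p) \<and> p \<in> \<Theta>(\<lambda>l. real l) \<and> s \<gamma>0 \<in> \<Theta>(\<lambda>l. real l)) \<and>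
          (\<exists>\<gamma>exc. \<forall>(x :: real ^ 'n) x' \<gamma>0. frn_inputs x x' p0 \<gamma>0 \<and> e \<gamma>0 0 < 1 \<and>
             \<not> (\<sigma>\<^sub>a = 0 \<and> \<sigma>\<^sub>b = 0 \<and> e \<gamma>0 0 = -1) \<and> \<gamma>0 \<noteq> \<gamma>exc \<longrightarrow>
             check_Theta (\<lambda>l. \<bar>e \<gamma>0 l - estar\<bar>) (\<lambda>l. real l powr (- frn_delta \<sigma>\<^sub>v \<sigma>\<^sub>a estar)))"
      unfolding eqs
    proof (rule exI[of _ estar], intro conjI unique \<delta> allI impI)
      fix x x' :: "real ^ 'n" and \<gamma>0
      assume h: "frn_inputs x x' p0 \<gamma>0 \<and> N.e \<gamma>0 0 < 1"
      show "N.p \<in> \<Theta>(\<lambda>l. real l)"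
        by (rule N.p_bigtheta)
      show s: "(\<lambda>l. N.p l - N.\<gamma> \<gamma>0 l) \<in> \<Theta>(N.p)"
        using inputs[OF h] by (rule N.s_bigtheta)
      show "(\<lambda>l. N.p l - N.\<gamma> \<gamma>0 l) \<in> \<Theta>(\<lambda>l. real l)"
        using s N.p_bigtheta by (rule landau_theta.trans)
      assume "\<not> (\<sigma>\<^sub>a = 0 \<and> \<sigma>\<^sub>b = 0 \<and> N.e \<gamma>0 0 = -1)"
      note adm = admissible[OF h this]
      show "N.e \<gamma>0 \<longlonglongrightarrow> estar"
        by (rule R.e_tendsto[OF adm])
      show "check_O (\<lambda>l. \<bar>N.e \<gamma>0 l - estar\<bar>) (\<lambda>l. real l powr - frn_delta \<sigma>\<^sub>v \<sigma>\<^sub>a estar)"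
        by (rule R.check_O_dist[OF adm])
    next
      show "\<exists>\<gamma>exc. \<forall>(x :: real ^ 'n) x' \<gamma>0. frn_inputs x x' p0 \<gamma>0 \<and> N.e \<gamma>0 0 < 1 \<and>
          \<not> (\<sigma>\<^sub>a = 0 \<and> \<sigma>\<^sub>b = 0 \<and> N.e \<gamma>0 0 = -1) \<and> \<gamma>0 \<noteq> \<gamma>exc \<longrightarrow>
          check_Theta (\<lambda>l. \<bar>N.e \<gamma>0 l - estar\<bar>) (\<lambda>l. real l powr - frn_delta \<sigma>\<^sub>v \<sigma>\<^sub>a estar)"
      proof (rule exI[of _ exc], intro allI impI)
        fix x x' :: "real ^ 'n" and \<gamma>0
        assume h: "frn_inputs x x' p0 \<gamma>0 \<and> N.e \<gamma>0 0 < 1 \<and>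
          \<not> (\<sigma>\<^sub>a = 0 \<and> \<sigma>\<^sub>b = 0 \<and> N.e \<gamma>0 0 = -1) \<and> \<gamma>0 \<noteq> exc"
        then have adm: "N.admissible \<gamma>0"
          using admissible[of x x' \<gamma>0] by blast
        show "check_Theta (\<lambda>l. \<bar>N.e \<gamma>0 l - estar\<bar>) (\<lambda>l. real l powr - frn_delta \<sigma>\<^sub>v \<sigma>\<^sub>a estar)"
          unfolding check_Theta_def using R.check_O_dist[OF adm] exc adm h by blast
      qed
    qed
  qed
qed

end
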